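(* Let $n\ge 1$ and let $\sigma,\tau\in\mathbb C$ satisfy $\operatorname{Re}\sigma+\operatorname{Re}\tau=-n$ and $\operatorname{Im}\sigma=\operatorname{Im}\tau$. Then the representation $\rho_{\sigma|\tau}$ of $\mathrm U(n,n)^\sim$ is unitary in $L^2(\mathrm U(n))$ (with respect to the Haar measure).
   Context: $\mathrm U(n,n)$ is the group of complex block $(n+n)\times(n+n)$ matrices $g=\begin{pmatrix}a&b\\c&d\end{pmatrix}$ with $g\begin{pmatrix}1&0\\0&-1\end{pmatrix}g^*=\begin{pmatrix}1&0\\0&-1\end{pmatrix}$; it acts on the unitary group $\mathrm U(n)$ by $z^{[g]}=(a+zc)^{-1}(b+zd)$. The universal covering group $\mathrm U(n,n)^\sim$ is realized as the set of triples $(g,s,t)\in\mathrm U(n,n)\times\mathbb C\times\mathbb C$ with $\det a=e^s$, $\det d=e^t$, with product $(g_1,s_1,t_1)(g_2,s_2,t_2)=(g_1g_2,\ s_1+s_2+\operatorname{tr}\ln(a_1^{-1}a_3a_2^{-1}),\ t_1+t_2+\operatorname{tr}\ln(d_1^{-1}d_3d_2^{-1}))$, where $g_j=\begin{pmatrix}a_j&b_j\\c_j&d_j\end{pmatrix}$, $g_3=g_1g_2$, and the logarithms are given by the power series (the arguments differ from $1$ by matrices of norm $<1$). It acts on $\mathrm U(n)$ through $g$. For $(g,s,t)\in \mathrm U(n,n)^\sim$ and $z\in\mathrm U(n)$ one has $\|ca^{-1}\|<1$; put $L(z)=s+\operatorname{tr}\ln(1+zca^{-1})$ (power series), so that $e^{L(z)}=\det(a+zc)$,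 and for $u,v\in\mathbb C$ define $\det(a+zc)^{\{u|v\}}:=\exp\bigl(u\,L(z)+v\,\overline{L(z)}\bigr)$. For $\sigma,\tau\in\mathbb C$ the representation $\rho_{\sigma|\tau}$ of $\mathrm U(n,n)^\sim$ is given by $\rho_{\sigma|\tau}(g)f(z)=f(z^{[g]})\,\det(a+zc)^{\{-n-\tau|-n-\sigma\}}$. *)

theory Defs
  imports "HOL-Analysis.Analysis" "HOL-Algebra.Group"
begin

section \<open>Complex matrices\<close>

definition cadjoint :: "complex^'m^'n \<Rightarrow> complex^'n^'m" where
  "cadjoint A = (\<chi> i j. cnj (A $ j $ i))"

text \<open>The ring operations that the type of vectors of vectors inherits from the type class
  hierarchy are componentwise, so powers with respect to the matrix product are defined here.\<close>

primrec matpow :: "complex^'n^'n \<Rightarrow> nat \<Rightarrow> complex^'n^'n" where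
  "matpow A 0 = mat 1"
| "matpow A (Suc k) = A ** matpow A k"

text \<open>The logarithm of \<open>1 + (A - 1)\<close> by its power series; it is only meaningful when the series
  converges, in particular when \<open>A - 1\<close> has operator norm less than \<open>1\<close>.\<close>

definition matln :: "complex^'n^'n \<Rightarrow> complex^'n^'n" where
  "matln A = (\<Sum>k. ((-1) ^ k / real (Suc k)) *\<^sub>R matpow (A - mat 1) (Suc k))"


section \<open>The groups \<open>U(n)\<close> and \<open>U(n,n)\<close>\<close>

definition unitary_group :: "(complex^'n^'n) set" where
  "unitary_group = {z. z ** cadjoint z = mat 1 \<and> cadjoint z ** z = mat 1}"

type_synonym 'n block_matrix = "complex^('n + 'n)^('n + 'n)"

definition blk_a :: "('n::finite) block_matrix \<Rightarrow> complex^'n^'n" where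
  "blk_a g = (\<chi> i j. g $ Inl i $ Inl j)"

definition blk_b :: "('n::finite) block_matrix \<Rightarrow> complex^'n^'n" where
  "blk_b g = (\<chi> i j. g $ Inl i $ Inr j)"

definition blk_c :: "('n::finite) block_matrix \<Rightarrow> complex^'n^'n" where
  "blk_c g = (\<chi> i j. g $ Inr i $ Inl j)"

definition blk_d :: "('n::finite) block_matrix \<Rightarrow> complex^'n^'n" where
  "blk_d g = (\<chi> i j. g $ Inr i $ Inr j)"

definition J_form :: "('n::finite) block_matrix" where
  "J_form = (\<chi> i j. if i = j then (case i of Inl _ \<Rightarrow> 1 | Inr _ \<Rightarrow> -1) else 0)"

definition Unn :: "('n::finite) block_matrix set" where
  "Unn = {g. g ** J_form ** cadjoint g = J_form}"

definition moebius :: "complex^'n^'n \<Rightarrow> ('n::finite) block_matrix \<Rightarrow> complex^'n^'n" where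
  "moebius z g = matrix_inv (blk_a g + z ** blk_c g) ** (blk_b g + z ** blk_d g)"


section \<open>The universal covering group of \<open>U(n,n)\<close>\<close>

type_synonym 'n cover = "'n block_matrix \<times> complex \<times> complex"

definition cover_set :: "('n::finite) cover set" where
  "cover_set = {(g, s, t). g \<in> Unn \<and> det (blk_a g) = exp s \<and> det (blk_d g) = exp t}"

fun cover_mult :: "('n::finite) cover \<Rightarrow> 'n cover \<Rightarrow> 'n cover" where
  "cover_mult (g1, s1, t1) (g2, s2, t2) =
     (g1 ** g2,
      s1 + s2 + trace (matln (matrix_inv (blk_a g1) ** blk_a (g1 ** g2) ** matrix_inv (blk_a g2))),
      t1 + t2 + trace (matln (matrix_inv (blk_d g1) ** blk_d (g1 ** g2) ** matrix_inv (blk_d g2))))"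

definition Unn_cover :: "('n::finite) cover monoid" where
  "Unn_cover = \<lparr>carrier = cover_set, mult = cover_mult, one = (mat 1, 0, 0)\<rparr>"


section \<open>The representations \<open>\<rho>\<close>\<close>

fun log_det_factor :: "('n::finite) cover \<Rightarrow> complex^'n^'n \<Rightarrow> complex" where
  "log_det_factor (g, s, t) z = s + trace (matln (mat 1 + z ** blk_c g ** matrix_inv (blk_a g)))"

definition det_power :: "('n::finite) cover \<Rightarrow> complex^'n^'n \<Rightarrow> complex \<Rightarrow> complex \<Rightarrow> complex" where
  "det_power G z u v = exp (u * log_det_factor G z + v * cnj (log_det_factor G z))"

definition rho ::
  "complex \<Rightarrow> complex \<Rightarrow> ('n::finite) cover \<Rightarrow> (complex^'n^'n \<Rightarrow> complex) \<Rightarrow> (complex^'n^'n \<Rightarrow> complex)"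
  where
  "rho \<sigma> \<tau> G f z =
     f (moebius z (fst G)) *
     det_power G z (- of_nat CARD('n) - \<tau>) (- of_nat CARD('n) - \<sigma>)"


section \<open>Haar measure on \<open>U(n)\<close>\<close>

text \<open>Finiteness and regularity are what ``Radon'' amounts to on a compact metrizable group, and
  regularity of a finite Borel measure is automatic there. The normalization is left free.\<close>

definition haar_measure :: "(complex^'n^'n) measure \<Rightarrow> bool" where
  "haar_measure M \<longleftrightarrow>
     sets M = sets (restrict_space borel unitary_group) \<and>
     0 < emeasure M (space M) \<and> emeasure M (space M) < \<infinity> \<and>
     (\<forall>u\<in>unitary_group. \<forall>A\<in>sets M. emeasure M ((\<lambda>z. u ** z) ` A) = emeasure M A)"


section \<open>Unitary representations in \<open>L\<^sup>2\<close>\<close>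

text \<open>Elements of \<open>L\<^sup>2(M)\<close> are handled through representatives: all statements about them are
  modulo equality almost everywhere, and operators are required to respect it.\<close>

definition L2_funs :: "'a measure \<Rightarrow> ('a \<Rightarrow> complex) set" where
  "L2_funs M = {f \<in> borel_measurable M. integrable M (\<lambda>x. (norm (f x))\<^sup>2)}"

definition L2_inner :: "'a measure \<Rightarrow> ('a \<Rightarrow> complex) \<Rightarrow> ('a \<Rightarrow> complex) \<Rightarrow> complex" where
  "L2_inner M f h = (LINT x|M. f x * cnj (h x))"

definition L2_norm :: "'a measure \<Rightarrow> ('a \<Rightarrow> complex) \<Rightarrow> real" where
  "L2_norm M f = sqrt (LINT x|M. (norm (f x))\<^sup>2)"

definition unitary_operator_L2 ::
  "'a measure \<Rightarrow> (('a \<Rightarrow> complex) \<Rightarrow> ('a \<Rightarrow> complex)) \<Rightarrow> bool" where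
  "unitary_operator_L2 M T \<longleftrightarrow>
     (\<forall>f\<in>L2_funs M. T f \<in> L2_funs M) \<and>
     (\<forall>f\<in>L2_funs M. \<forall>h\<in>L2_funs M. (AE x in M. f x = h x) \<longrightarrow> (AE x in M. T f x = T h x)) \<and>
     (\<forall>f\<in>L2_funs M. \<forall>h\<in>L2_funs M. AE x in M. T (\<lambda>y. f y + h y) x = T f x + T h x) \<and>
     (\<forall>k. \<forall>f\<in>L2_funs M. AE x in M. T (\<lambda>y. k * f y) x = k * T f x) \<and>
     (\<forall>f\<in>L2_funs M. \<forall>h\<in>L2_funs M. L2_inner M (T f) (T h) = L2_inner M f h) \<and>
     (\<forall>h\<in>L2_funs M. \<exists>f\<in>L2_funs M. AE x in M. T f x = h x)"

text \<open>A unitary representation of a topological group: a homomorphism into the unitary operators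
  that is strongly continuous. The topology on the group is the subspace topology of its carrier.\<close>

definition unitary_representation_L2 ::
  "('g::topological_space) monoid \<Rightarrow> 'a measure \<Rightarrow>
     ('g \<Rightarrow> ('a \<Rightarrow> complex) \<Rightarrow> ('a \<Rightarrow> complex)) \<Rightarrow> bool" where
  "unitary_representation_L2 G M \<pi> \<longleftrightarrow>
     (\<forall>g\<in>carrier G. unitary_operator_L2 M (\<pi> g)) \<and>
     (\<forall>f\<in>L2_funs M. AE x in M. \<pi> \<one>\<^bsub>G\<^esub> f x = f x) \<and>
     (\<forall>g\<in>carrier G. \<forall>h\<in>carrier G. \<forall>f\<in>L2_funs M.
        AE x in M. \<pi> (g \<otimes>\<^bsub>G\<^esub> h) f x = \<pi> g (\<pi> h f) x) \<and>
     (\<forall>f\<in>L2_funs M. \<forall>g\<in>carrier G.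
        ((\<lambda>h. L2_norm M (\<lambda>x. \<pi> h f x - \<pi> g f x)) \<longlongrightarrow> 0) (at g within carrier G))"

end

theory Submission
  imports Defs
begin

text \<open>
  Write \<open>(p, q) = (1, z) g = (a + z c, b + z d)\<close>, so that \<open>z\<^sup>[\<^sup>g\<^sup>] = p\<^sup>-\<^sup>1 q\<close>. The squared modulus of the
  multiplier of \<open>\<rho>\<close> is \<open>\<bar>det p\<bar>\<close> to the power \<open>-2n\<close> under the hypotheses on \<open>\<sigma>, \<tau>\<close>
  (\<open>multiplier_square\<close>), and this is exactly the Jacobian of \<open>z \<mapsto> z\<^sup>[\<^sup>g\<^sup>]\<close> with respect to Haar measure
  (\<open>nn_integral_haar_moebius\<close>). Unitarity is that change of variables.

  \<^emph>\<open>The Jacobian.\<close> The Cayley transform identifies the Hermitian matrices \<open>h\<close> with a part of \<open>U(n)\<close> and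
  turns the action into fractional linear maps \<open>h \<mapsto> P\<^sup>-\<^sup>1 Q\<close> of Hermitian matrices, whose derivative is
  the congruence \<open>k \<mapsto> P\<^sup>-\<^sup>1 k (P\<^sup>-\<^sup>1)\<^sup>*\<close> (\<open>chart_map_has_derivative\<close>). The determinant of a congruence by \<open>A\<close>
  on the \<open>n\<^sup>2\<close>-dimensional real space of Hermitian matrices has modulus \<open>\<bar>det A\<bar>\<close> to the power \<open>2n\<close>
  (\<open>det_congr\<close>). Hence the measure \<open>\<bar>det (1 - \<i> h)\<bar>\<^sup>-\<^sup>2\<^sup>n dh\<close>, transported to \<open>U(n)\<close>, is quasi-invariant
  with the required Jacobian under all of \<open>U(n,n)\<close> (\<open>nn_integral_chart_moebius\<close>); the points whose image
  leaves the chart form a null set (\<open>chart_dom_conull\<close>). The elements with blocks \<open>1, 0, 0, u\<close> act by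
  right multiplication with Jacobian \<open>1\<close>, so this measure is right invariant, and a left invariant and
  a right invariant measure on a group are proportional by Fubini's theorem
  (\<open>haar_chart_proportional\<close>). The transformation law is thereby inherited by every Haar measure.

  \<^emph>\<open>The homomorphism property.\<close> The functions \<open>L\<close> are logarithms of \<open>det p\<close>, because
  \<open>exp (tr ln (1 + X)) = det (1 + X)\<close> (\<open>exp_tlog\<close>). The determinants form a cocycle, so the logarithms form
  one up to a multiple of \<open>2 \<pi> \<i>\<close>. At \<open>z = 0\<close> the cocycle identity of the logarithms is the definition of
  the product of the covering group; for other \<open>z\<close> it follows by continuity along the segment from
  \<open>0\<close> to \<open>z\<close>, which consists of contractions (\<open>log_det_factor_mult\<close>).

  \<^emph>\<open>Strong continuity.\<close> For a continuous function on \<open>U(n)\<close> the orbit map is continuous by dominated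
  convergence. By unitarity the set of all functions with this property is closed in \<open>L\<^sup>2\<close>, so it
  contains the indicators of closed sets, hence of Borel sets, hence everything
  (\<open>continuous_vector_L2\<close>).
\<close>

section \<open>Complex matrices\<close>

lemma matrix_mult_nth: "(A ** B) $ i $ j = (\<Sum>k\<in>UNIV. A $ i $ k * B $ k $ j)"
  by (simp add: matrix_matrix_mult_def)

lemma matrix_add_rdistrib: "(A + B) ** C = A ** C + B ** (C::'a::semiring_1^'p^'n)"
  by (simp add: vec_eq_iff matrix_mult_nth distrib_right sum.distrib)

lemma matrix_diff_rdistrib: "(A - B) ** C = A ** C - B ** (C::'a::ring_1^'p^'n)"
  by (simp add: vec_eq_iff matrix_mult_nth left_diff_distrib sum_subtractf)

lemma matrix_diff_ldistrib: "C ** (A - B) = C ** A - C ** (B::'a::ring_1^'p^'n)"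
  by (simp add: vec_eq_iff matrix_mult_nth right_diff_distrib sum_subtractf)

lemma matrix_minus_left: "(- A) ** C = - (A ** (C::'a::ring_1^'p^'n))"
  by (simp add: vec_eq_iff matrix_mult_nth sum_negf)

lemma matrix_minus_right: "C ** (- A) = - (C ** (A::'a::ring_1^'p^'n))"
  by (simp add: vec_eq_iff matrix_mult_nth sum_negf)

lemmas matrix_distribs =
  matrix_add_ldistrib matrix_add_rdistrib matrix_diff_ldistrib matrix_diff_rdistrib
  matrix_minus_left matrix_minus_right

lemma mat_mult_nth: "(mat c ** A) $ i $ j = c * A $ i $ j" for A :: "'a::comm_semiring_1^'m^'n"
  by (simp add: matrix_mult_nth mat_def if_distrib[where f="\<lambda>x. x * _"] cong: if_cong)

lemma mult_mat_nth: "(A ** mat c) $ i $ j = c * A $ i $ j" for A :: "'a::comm_semiring_1^'n^'m"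
  by (simp add: matrix_mult_nth mat_def if_distrib mult.commute cong: if_cong)

lemma mat_mult_commute: "A ** mat c = mat c ** A" for A :: "'a::comm_semiring_1^'n^'m"
  by (simp add: vec_eq_iff mat_mult_nth mult_mat_nth)

lemma mat_mult_mat: "mat c ** mat d = (mat (c * d) :: 'a::comm_semiring_1^'n^'n)"
  by (simp add: vec_eq_iff mat_mult_nth) (simp add: mat_def)

lemma mat_add: "mat (c + d) = (mat c + mat d :: 'a::comm_semiring_1^'n^'n)"
  by (simp add: vec_eq_iff mat_def)

lemma mat_uminus: "mat (- c) = (- mat c :: 'a::comm_ring_1^'n^'n)"
  by (simp add: vec_eq_iff mat_def)

lemma matrix_inv_right: "invertible A \<Longrightarrow> A ** matrix_inv A = mat 1"
  and matrix_inv_left: "invertible A \<Longrightarrow> matrix_inv A ** A = mat 1"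
proof -
  assume "invertible A"
  then have "\<exists>B. A ** B = mat 1 \<and> B ** A = mat 1" by (simp add: invertible_def)
  from someI_ex[OF this] show "A ** matrix_inv A = mat 1" "matrix_inv A ** A = mat 1"
    by (auto simp: matrix_inv_def)
qed

lemma matrix_inv_eqI:
  fixes A :: "'a::field^'n^'n"
  assumes "A ** B = mat 1"
  shows "matrix_inv A = B" "invertible A"
proof -
  show inv: "invertible A" using assms invertible_right_inverse by blast
  have "matrix_inv A = matrix_inv A ** (A ** B)" by (simp add: assms)
  also have "\<dots> = B" by (simp add: matrix_mul_assoc matrix_inv_left inv)
  finally show "matrix_inv A = B" .
qed

lemma matrix_mult_eq_iff:
  fixes A :: "'a::field^'n^'n"
  assumes "invertible A"
  shows "matrix_inv A ** B = C \<longleftrightarrow> B = A ** C"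
  by (metis assms matrix_inv_left matrix_inv_right matrix_mul_assoc matrix_mul_lid)

lemma invertible_iff_row_kernel:
  fixes A :: "'a::field^'n^'n"
  shows "invertible A \<longleftrightarrow> (\<forall>v. v v* A = 0 \<longrightarrow> v = 0)"
proof -
  have "invertible A \<longleftrightarrow> invertible (transpose A)"
    by (simp add: invertible_det_nz)
  also have "\<dots> \<longleftrightarrow> (\<exists>B. B ** transpose A = mat 1)"
    by (simp add: invertible_left_inverse)
  also have "\<dots> \<longleftrightarrow> (\<forall>v. transpose A *v v = 0 \<longrightarrow> v = 0)"
    by (rule matrix_left_invertible_ker)
  finally show ?thesis by simp
qed

subsection \<open>Adjoints and the Hermitian form on rows\<close>

lemma cadjoint_nth [simp]: "cadjoint A $ i $ j = cnj (A $ j $ i)"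
  by (simp add: cadjoint_def)

lemma cadjoint_mult: "cadjoint (A ** B) = cadjoint B ** cadjoint A"
  by (simp add: vec_eq_iff matrix_mult_nth mult.commute)

lemma cadjoint_add: "cadjoint (A + B) = cadjoint A + cadjoint B"
  and cadjoint_diff: "cadjoint (A - B) = cadjoint A - cadjoint B"
  and cadjoint_uminus: "cadjoint (- A) = - cadjoint A"
  and cadjoint_cadjoint [simp]: "cadjoint (cadjoint A) = A"
  by (simp_all add: vec_eq_iff)

lemma cadjoint_mat: "cadjoint (mat c) = mat (cnj c)"
  by (simp add: vec_eq_iff) (simp add: mat_def)

lemma cadjoint_mat_1 [simp]: "cadjoint (mat 1) = mat 1"
  by (simp add: cadjoint_mat)

lemma det_cadjoint: "det (cadjoint A) = cnj (det A)"
proof -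
  have "det (cadjoint A) = det (\<chi> i j. cnj (transpose A $ i $ j))"
    by (simp add: cadjoint_def transpose_def)
  also have "\<dots> = cnj (det (transpose A))"
    by (simp add: det_def)
  finally show ?thesis by simp
qed

lemma invertible_cadjoint: "invertible (cadjoint A) \<longleftrightarrow> invertible A" for A :: "complex^'n^'n"
  by (simp add: invertible_det_nz det_cadjoint)

lemma vector_matrix_mult_nth: "(v v* A) $ j = (\<Sum>i\<in>UNIV. v $ i * A $ i $ j)"
  by (simp add: vector_matrix_mult_def)

definition row_herm :: "complex^'n \<Rightarrow> complex^'n \<Rightarrow> complex" where
  "row_herm v w = (\<Sum>i\<in>UNIV. v $ i * cnj (w $ i))"

lemma row_herm_self: "row_herm v v = of_real ((norm v)\<^sup>2)"
  by (simp add: row_herm_def norm_vec_def L2_set_def sum_nonneg complex_norm_square del: of_real_power)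

lemma row_herm_adjoint: "row_herm (v v* A) w = row_herm v (w v* cadjoint A)"
proof -
  have "row_herm (v v* A) w = (\<Sum>j\<in>UNIV. \<Sum>i\<in>UNIV. v $ i * A $ i $ j * cnj (w $ j))"
    by (simp add: row_herm_def vector_matrix_mult_nth sum_distrib_right)
  also have "\<dots> = (\<Sum>i\<in>UNIV. \<Sum>j\<in>UNIV. v $ i * A $ i $ j * cnj (w $ j))"
    by (rule sum.swap)
  also have "\<dots> = row_herm v (w v* cadjoint A)"
    by (simp add: row_herm_def vector_matrix_mult_nth sum_distrib_left mult_ac)
  finally show ?thesis .
qed

lemma row_herm_add: "row_herm v (w + x) = row_herm v w + row_herm v x"
  by (simp add: row_herm_def distrib_left sum.distrib)

text \<open>This turns block relations such as \<open>d d\<^sup>* = 1 + c c\<^sup>*\<close> into identities between lengths of rows.\<close>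

lemma norm_row_gram:
  assumes "A ** cadjoint A = B ** cadjoint B + C ** cadjoint C"
  shows "(norm (v v* A))\<^sup>2 = (norm (v v* B))\<^sup>2 + (norm (v v* C))\<^sup>2"
proof -
  have gram: "complex_of_real ((norm (v v* X))\<^sup>2) = row_herm v (v v* (X ** cadjoint X))"
    for X :: "complex^'k^'l" and v :: "complex^'l"
    by (metis row_herm_self row_herm_adjoint vector_matrix_mul_assoc cadjoint_cadjoint cadjoint_mult)
  have "complex_of_real ((norm (v v* A))\<^sup>2) = of_real ((norm (v v* B))\<^sup>2 + (norm (v v* C))\<^sup>2)"
    unfolding of_real_add gram assms vector_matrix_mult_add_rdistrib row_herm_add ..
  then show ?thesis by (simp only: of_real_eq_iff)
qed

subsection \<open>The operator norm of the action on rows\<close>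

text \<open>\<open>U(n,n)\<close> acts through row blocks \<open>(1, z) g\<close>, so the operator norm is that of the action on rows. It is
  this norm, and not the Euclidean norm of the entries, that is less than \<open>1\<close> on the arguments of the
  logarithms.\<close>

definition rnorm :: "complex^'n^'m \<Rightarrow> real" where
  "rnorm A = onorm (\<lambda>v. v v* A)"

lemma bounded_linear_row: "bounded_linear (\<lambda>v. v v* (A::complex^'n^'m))"
proof -
  have "linear (\<lambda>v. v v* (A::complex^'n^'m))"
    by (rule linearI) (simp_all add: algebra_simps vec_eq_iff vector_matrix_mult_nth scaleR_sum_right)
  then show ?thesis by (rule linear_conv_bounded_linear[THEN iffD1])
qed

lemma norm_row_le: "norm (v v* A) \<le> rnorm A * norm v"
  unfolding rnorm_def by (rule onorm[OF bounded_linear_row])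

lemma rnorm_leI: "(\<And>v. norm (v v* A) \<le> b * norm v) \<Longrightarrow> rnorm A \<le> b"
  unfolding rnorm_def by (rule onorm_le)

lemma rnorm_nonneg: "0 \<le> rnorm A"
  unfolding rnorm_def by (rule onorm_pos_le[OF bounded_linear_row])

lemma rnorm_mult: "rnorm (A ** B) \<le> rnorm A * rnorm B"
proof (rule rnorm_leI)
  fix v
  have "norm (v v* (A ** B)) \<le> rnorm B * norm (v v* A)"
    by (metis norm_row_le vector_matrix_mul_assoc)
  also have "\<dots> \<le> rnorm B * (rnorm A * norm v)"
    by (intro mult_left_mono norm_row_le rnorm_nonneg)
  finally show "norm (v v* (A ** B)) \<le> rnorm A * rnorm B * norm v" by (simp add: mult_ac)
qed

lemma rnorm_mat_1: "rnorm (mat 1 :: complex^'n^'n) \<le> 1"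
  by (rule rnorm_leI) simp

lemma rnorm_add: "rnorm (A + B) \<le> rnorm A + rnorm B"
  unfolding rnorm_def vector_matrix_mult_add_rdistrib
  by (rule onorm_triangle) (rule bounded_linear_row)+

lemma rnorm_uminus: "rnorm (- A) = rnorm A"
proof -
  have "(\<lambda>v. v v* - A) = (\<lambda>v. - (v v* A))"
    by (auto simp: vec_eq_iff vector_matrix_mult_nth sum_negf)
  then show ?thesis unfolding rnorm_def by (simp add: onorm_neg)
qed

lemma rnorm_mat_mult: "rnorm (mat c ** A) = norm c * rnorm A"
proof -
  have le: "rnorm (mat c ** A) \<le> norm c * rnorm A" for c and A :: "complex^'n^'m"
  proof (rule rnorm_leI)
    fix v :: "complex^'m"
    have "v v* (mat c ** A) = c *s (v v* A)"
      by (simp add: vec_eq_iff vector_matrix_mult_nth mat_mult_nth sum_distrib_left mult_ac)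
    then have "norm (v v* (mat c ** A)) = norm c * norm (v v* A)"
      by (simp add: norm_vec_def L2_set_right_distrib norm_mult)
    then show "norm (v v* (mat c ** A)) \<le> norm c * rnorm A * norm v"
      using mult_left_mono[OF norm_row_le[of v A], of "norm c"] by (simp add: mult_ac)
  qed
  show ?thesis
  proof (cases "c = 0")
    case True
    then show ?thesis using le[of c A] rnorm_nonneg[of "mat c ** A"] by simp
  next
    case False
    have "rnorm A = rnorm (mat (inverse c) ** (mat c ** A))"
      using False by (simp add: matrix_mul_assoc mat_mult_mat)
    also have "\<dots> \<le> norm (inverse c) * rnorm (mat c ** A)" by (rule le)
    finally have "norm c * rnorm A \<le> rnorm (mat c ** A)"
      using False by (simp add: norm_inverse norm_divide field_simps)
    with le[of c A] show ?thesis by simp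
  qed
qed

lemma norm_entry_le_rnorm: "norm (A $ i $ j) \<le> rnorm A"
proof -
  have "A $ i $ j = (axis i 1 v* A) $ j"
    by (simp add: vector_matrix_mult_nth axis_def if_distrib[where f="\<lambda>x. x * _"] cong: if_cong)
  then have "norm (A $ i $ j) \<le> norm (axis i 1 v* A)" by (metis Finite_Cartesian_Product.norm_nth_le)
  also have "\<dots> \<le> rnorm A" using norm_row_le[of "axis i 1" A] by simp
  finally show ?thesis .
qed

lemma norm_le_rnorm: "norm A \<le> real (CARD('n) * CARD('m)) * rnorm A" for A :: "complex^'n^'m"
proof -
  have "norm A \<le> (\<Sum>i\<in>UNIV. norm (A $ i))"
    unfolding norm_vec_def[of A] by (rule L2_set_le_sum) simp
  also have "\<dots> \<le> (\<Sum>i\<in>(UNIV::'m set). \<Sum>j\<in>(UNIV::'n set). norm (A $ i $ j))"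
    by (intro sum_mono) (simp add: norm_vec_def[of "A $ _"] L2_set_le_sum)
  also have "\<dots> \<le> (\<Sum>i\<in>(UNIV::'m set). \<Sum>j\<in>(UNIV::'n set). rnorm A)"
    by (intro sum_mono norm_entry_le_rnorm)
  finally show ?thesis by (simp add: mult_ac)
qed

lemma rnorm_le_norm: "rnorm A \<le> real CARD('m) * norm A" for A :: "complex^'n^'m"
proof (rule rnorm_leI)
  fix v :: "complex^'m"
  have "v v* A = (\<Sum>i\<in>UNIV. v $ i *s A $ i)"
    by (simp add: vec_eq_iff vector_matrix_mult_nth)
  then have "norm (v v* A) \<le> (\<Sum>i\<in>UNIV. norm (v $ i *s A $ i))" by (simp add: norm_sum)
  also have "\<dots> = (\<Sum>i\<in>UNIV. norm (v $ i) * norm (A $ i))"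
    by (simp add: norm_vec_def L2_set_right_distrib norm_mult)
  also have "\<dots> \<le> (\<Sum>i\<in>(UNIV::'m set). norm v * norm A)"
    by (intro sum_mono mult_mono Finite_Cartesian_Product.norm_nth_le) auto
  finally show "norm (v v* A) \<le> real CARD('m) * norm A * norm v" by (simp add: mult_ac)
qed

lemma tendsto_rnorm:
  assumes "(f \<longlongrightarrow> A) F"
  shows "((\<lambda>x. rnorm (f x)) \<longlongrightarrow> rnorm (A::complex^'n^'m)) F"
proof -
  have "\<bar>rnorm B - rnorm A\<bar> \<le> real CARD('m) * norm (B - A)" for B :: "complex^'n^'m"
    using rnorm_add[of A "B - A"] rnorm_add[of B "A - B"] rnorm_uminus[of "B - A"]
      rnorm_le_norm[of "B - A"] by simp
  then have "\<forall>\<^sub>F x in F. norm (rnorm (f x) - rnorm A) \<le> norm (f x - A) * real CARD('m)"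
    by (simp add: mult.commute)
  moreover have "((\<lambda>x. f x - A) \<longlongrightarrow> 0) F" using assms by (simp add: LIM_zero)
  ultimately have "((\<lambda>x. rnorm (f x) - rnorm A) \<longlongrightarrow> 0) F"
    by (rule Lim_null_comparison[OF _ tendsto_mult_left_zero[OF tendsto_norm_zero]])
  then show ?thesis by (simp add: LIM_zero_cancel)
qed

subsection \<open>Limits of matrix expressions\<close>

lemma tendsto_matrix_mult [tendsto_intros]:
  fixes f :: "'x \<Rightarrow> complex^'n^'m" and g :: "'x \<Rightarrow> complex^'p^'n"
  assumes "(f \<longlongrightarrow> A) F" "(g \<longlongrightarrow> B) F"
  shows "((\<lambda>x. f x ** g x) \<longlongrightarrow> A ** B) F"
  unfolding matrix_matrix_mult_def
  by (intro tendsto_vec_lambda tendsto_sum tendsto_mult tendsto_vec_nth assms)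

lemma tendsto_cadjoint [tendsto_intros]:
  "(f \<longlongrightarrow> A) F \<Longrightarrow> ((\<lambda>x. cadjoint (f x)) \<longlongrightarrow> cadjoint A) F"
  unfolding cadjoint_def by (intro tendsto_vec_lambda tendsto_cnj tendsto_vec_nth)

lemma tendsto_trace [tendsto_intros]:
  fixes f :: "'x \<Rightarrow> complex^'n^'n"
  shows "(f \<longlongrightarrow> A) F \<Longrightarrow> ((\<lambda>x. trace (f x)) \<longlongrightarrow> trace A) F"
  unfolding trace_def by (intro tendsto_sum tendsto_vec_nth)

lemma tendsto_det [tendsto_intros]:
  fixes f :: "'x \<Rightarrow> complex^'n^'n"
  shows "(f \<longlongrightarrow> A) F \<Longrightarrow> ((\<lambda>x. det (f x)) \<longlongrightarrow> det A) F"
  unfolding det_def by (intro tendsto_sum tendsto_mult tendsto_prod tendsto_vec_nth tendsto_const)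

lemma tendsto_mat [tendsto_intros]:
  fixes f :: "'x \<Rightarrow> complex"
  shows "(f \<longlongrightarrow> c) F \<Longrightarrow> ((\<lambda>x. mat (f x) :: complex^'n^'n) \<longlongrightarrow> mat c) F"
  unfolding mat_def by (intro tendsto_vec_lambda) (simp add: tendsto_const)

text \<open>Cramer's rule exhibits the inverse as a rational function of the entries, which gives its
  continuity.\<close>

lemma matrix_inv_cramer:
  fixes A :: "'a::field^'n^'n"
  assumes "invertible A"
  shows "matrix_inv A = (\<chi> k j. det (\<chi> i l. if l = k then axis j 1 $ i else A $ i $ l) / det A)"
proof -
  have "matrix_inv A $ k $ j = det (\<chi> i l. if l = k then axis j 1 $ i else A $ i $ l) / det A" for k j
  proof -
    let ?x = "matrix_inv A *v axis j 1"
    have d: "det A \<noteq> 0" using assms by (simp add: invertible_det_nz)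
    have "A *v ?x = axis j 1"
      by (simp add: matrix_vector_mul_assoc matrix_inv_right assms)
    then have "?x = (\<chi> k. det (\<chi> i l. if l = k then axis j 1 $ i else A $ i $ l) / det A)"
      using cramer[OF d] by blast
    moreover have "?x $ k = matrix_inv A $ k $ j"
      by (simp add: matrix_vector_mult_def axis_def if_distrib cong: if_cong)
    ultimately show ?thesis by (metis (no_types, lifting) vec_lambda_beta)
  qed
  then show ?thesis by (simp add: vec_eq_iff)
qed

lemma eventually_invertible:
  fixes f :: "'x \<Rightarrow> complex^'n^'n"
  assumes "(f \<longlongrightarrow> A) F" "invertible A"
  shows "\<forall>\<^sub>F x in F. invertible (f x)"
  using tendsto_imp_eventually_ne[OF tendsto_det[OF assms(1)], of 0] assms(2)
  by (simp add: invertible_det_nz)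

lemma tendsto_matrix_inv [tendsto_intros]:
  fixes f :: "'x \<Rightarrow> complex^'n^'n"
  assumes "(f \<longlongrightarrow> A) F" "invertible A"
  shows "((\<lambda>x. matrix_inv (f x)) \<longlongrightarrow> matrix_inv A) F"
proof -
  let ?c = "\<lambda>A::complex^'n^'n. \<chi> k j. det (\<chi> i l. if l = k then axis j 1 $ i else A $ i $ l) / det A"
  have "((\<lambda>x. ?c (f x)) \<longlongrightarrow> ?c A) F"
  proof (intro tendsto_vec_lambda tendsto_divide tendsto_det assms(1))
    fix i j k l :: 'n
    show "((\<lambda>x. if l = k then axis j 1 $ i else f x $ i $ l) \<longlongrightarrow> (if l = k then axis j 1 $ i else A $ i $ l)) F"
      using assms(1) by (auto intro!: tendsto_vec_nth)
    show "det A \<noteq> 0" using assms(2) by (simp add: invertible_det_nz)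
  qed
  moreover have "\<forall>\<^sub>F x in F. ?c (f x) = matrix_inv (f x)"
    using eventually_invertible[OF assms] by eventually_elim (simp add: matrix_inv_cramer)
  ultimately have "((\<lambda>x. matrix_inv (f x)) \<longlongrightarrow> ?c A) F"
    by (rule Lim_transform_eventually)
  then show ?thesis by (simp add: matrix_inv_cramer[OF assms(2)])
qed

subsection \<open>The determinant along an affine line\<close>

lemma det_line_polynomial:
  fixes A X :: "complex^'n^'n"
  obtains p where "\<And>t. poly p t = det (A + mat t ** X)"
proof
  fix t
  show "poly (\<Sum>p\<in>{p. p permutes UNIV}. [:of_int (sign p):] * (\<Prod>i\<in>UNIV. [:A $ i $ p i, X $ i $ p i:])) t
      = det (A + mat t ** X)"
    by (simp add: det_def poly_sum poly_prod mat_mult_nth)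
qed

text \<open>In the Leibniz expansion of \<open>det (1 + h X)\<close> a permutation other than the identity contributes at
  least two off-diagonal factors \<open>h\<close>, so only the diagonal product has a linear term.\<close>

lemma det_has_derivative_at_1:
  fixes X :: "complex^'n^'n"
  shows "((\<lambda>h. det (mat 1 + mat h ** X)) has_field_derivative trace X) (at 0)"
proof -
  let ?d = "\<lambda>p::'n\<Rightarrow>'n. \<lambda>i. (mat 1 :: complex^'n^'n) $ i $ p i"
  have "((\<lambda>h. det (mat 1 + mat h ** X)) has_field_derivative
      (\<Sum>p | p permutes UNIV. of_int (sign p) * (\<Sum>i\<in>UNIV. X $ i $ p i * (\<Prod>j\<in>UNIV - {i}. ?d p j)))) (at 0)"
    unfolding det_def
  proof (intro DERIV_sum DERIV_cmult)
    fix p :: "'n \<Rightarrow> 'n"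
    have "((\<lambda>h. (mat 1 + mat h ** X) $ i $ p i) has_field_derivative X $ i $ p i) (at 0)" for i
      by (auto simp: mat_mult_nth intro!: derivative_eq_intros)
    then have "((\<lambda>h. \<Prod>i\<in>UNIV. (mat 1 + mat h ** X) $ i $ p i) has_field_derivative
        (\<Sum>i\<in>UNIV. X $ i $ p i * (\<Prod>j\<in>UNIV - {i}. (mat 1 + mat 0 ** X) $ j $ p j))) (at 0)"
      by (rule has_field_derivative_prod)
    then show "((\<lambda>h. \<Prod>i\<in>UNIV. (mat 1 + mat h ** X) $ i $ p i) has_field_derivative
        (\<Sum>i\<in>UNIV. X $ i $ p i * (\<Prod>j\<in>UNIV - {i}. ?d p j))) (at 0)"
      by simp
  qed
  also have "(\<Sum>p | p permutes UNIV. of_int (sign p) * (\<Sum>i\<in>UNIV. X $ i $ p i * (\<Prod>j\<in>UNIV - {i}. ?d p j)))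
      = (\<Sum>p | p permutes (UNIV::'n set). if p = id then trace X else 0)"
  proof (rule sum.cong[OF refl])
    fix p :: "'n \<Rightarrow> 'n" assume "p \<in> {p. p permutes UNIV}"
    then have p: "p permutes UNIV" by simp
    show "of_int (sign p) * (\<Sum>i\<in>UNIV. X $ i $ p i * (\<Prod>j\<in>UNIV - {i}. ?d p j))
        = (if p = id then trace X else 0)"
    proof (cases "p = id")
      case True
      then show ?thesis by (simp add: sign_id trace_def mat_def)
    next
      case False
      have "(\<Prod>j\<in>UNIV - {i}. ?d p j) = 0" for i
      proof -
        \<comment> \<open>A permutation other than the identity moves at least two indices.\<close>
        obtain k where k: "p k \<noteq> k" using False by (metis ext id_apply)
        then have k2: "p (p k) \<noteq> p k" using permutes_inj[OF p] by (auto dest: injD)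
        obtain j where "j \<noteq> i" "p j \<noteq> j" using k k2 by (cases "k = i") auto
        then show ?thesis by (intro prod_zero bexI[of _ j]) (auto simp: mat_def)
      qed
      then show ?thesis by (simp only: mult_zero_right sum.neutral_const if_not_P[OF False])
    qed
  qed
  also have "\<dots> = trace X"
    by (subst sum.delta) (auto simp: permutes_id finite_permutations)
  finally show ?thesis .
qed

lemma det_shifted_has_derivative:
  fixes Y :: "complex^'n^'n"
  shows "((\<lambda>s. k * det (mat 1 + mat (s - t) ** Y)) has_field_derivative k * trace Y) (at t)"
proof -
  let ?f = "\<lambda>h. det (mat 1 + mat h ** Y)"
  have "(?f has_field_derivative trace Y) (at (t + - t))"
    using det_has_derivative_at_1 by simp
  then have "((\<lambda>s. ?f (s + - t)) has_field_derivative trace Y) (at t)"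
    by (rule DERIV_shift[THEN iffD1])
  then show ?thesis by (intro DERIV_cmult) simp
qed

lemma line_factor:
  fixes A X :: "complex^'n^'n"
  assumes inv: "invertible (A + mat t ** X)"
  shows "A + mat s ** X = (A + mat t ** X) ** (mat 1 + mat (s - t) ** (matrix_inv (A + mat t ** X) ** X))"
proof -
  let ?B = "A + mat t ** X"
  have "?B ** (mat (s - t) ** (matrix_inv ?B ** X)) = mat (s - t) ** (?B ** (matrix_inv ?B ** X))"
    by (simp only: matrix_mul_assoc mat_mult_commute[of ?B])
  also have "?B ** (matrix_inv ?B ** X) = X"
    by (simp only: matrix_mul_assoc matrix_inv_right inv matrix_mul_lid)
  finally have "?B ** (mat 1 + mat (s - t) ** (matrix_inv ?B ** X)) = ?B + mat (s - t) ** X"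
    by (simp only: matrix_add_ldistrib[of ?B] matrix_mul_rid)
  also have "\<dots> = A + mat s ** X"
    by (simp add: vec_eq_iff mat_mult_nth left_diff_distrib)
  finally show ?thesis by simp
qed

lemma det_line_has_derivative:
  fixes A X :: "complex^'n^'n"
  assumes inv: "invertible (A + mat t ** X)"
  shows "((\<lambda>t. det (A + mat t ** X)) has_field_derivative
      det (A + mat t ** X) * trace (matrix_inv (A + mat t ** X) ** X)) (at t)"
  by (subst line_factor[OF inv]) (simp only: det_mul det_shifted_has_derivative)

section \<open>The action of \<open>U(n,n)\<close> on contractions\<close>

lemma sum_UNIV_sum: "(\<Sum>i\<in>UNIV. f i) = (\<Sum>i\<in>UNIV. f (Inl i)) + (\<Sum>i\<in>UNIV. f (Inr i))"
  for f :: "'a::finite + 'b::finite \<Rightarrow> 'c::comm_monoid_add"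
  by (subst UNIV_sum, subst sum.union_disjoint) (auto simp: sum.reindex)

lemmas blk_defs = blk_a_def blk_b_def blk_c_def blk_d_def

lemma blk_mult:
  "blk_a (g ** h) = blk_a g ** blk_a h + blk_b g ** blk_c h"
  "blk_b (g ** h) = blk_a g ** blk_b h + blk_b g ** blk_d h"
  "blk_c (g ** h) = blk_c g ** blk_a h + blk_d g ** blk_c h"
  "blk_d (g ** h) = blk_c g ** blk_b h + blk_d g ** blk_d h"
  by (simp_all add: vec_eq_iff blk_defs matrix_mult_nth sum_UNIV_sum)

lemma blk_cadjoint:
  "blk_a (cadjoint g) = cadjoint (blk_a g)"
  "blk_b (cadjoint g) = cadjoint (blk_c g)"
  "blk_c (cadjoint g) = cadjoint (blk_b g)"
  "blk_d (cadjoint g) = cadjoint (blk_d g)"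
  by (simp_all add: vec_eq_iff blk_defs)

lemma blk_J_form:
  "blk_a J_form = mat 1" "blk_b J_form = 0" "blk_c J_form = 0" "blk_d J_form = - mat 1"
  by (simp_all add: vec_eq_iff blk_defs J_form_def) (simp_all add: mat_def)

lemma blk_mat_1:
  "blk_a (mat 1) = mat 1" "blk_b (mat 1) = 0" "blk_c (mat 1) = 0" "blk_d (mat 1) = mat 1"
  by (simp_all add: vec_eq_iff blk_defs) (simp_all add: mat_def)

lemma block_eq_iff:
  "g = h \<longleftrightarrow> blk_a g = blk_a h \<and> blk_b g = blk_b h \<and> blk_c g = blk_c h \<and> blk_d g = blk_d h"
  by (auto simp: vec_eq_iff blk_defs split_sum_all)

definition block :: "complex^'n^'n \<Rightarrow> complex^'n^'n \<Rightarrow> complex^'n^'n \<Rightarrow> complex^'n^'n \<Rightarrow> ('n::finite) block_matrix"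
  where "block a b c d = (\<chi> i j. case i of
      Inl i \<Rightarrow> (case j of Inl j \<Rightarrow> a $ i $ j | Inr j \<Rightarrow> b $ i $ j)
    | Inr i \<Rightarrow> (case j of Inl j \<Rightarrow> c $ i $ j | Inr j \<Rightarrow> d $ i $ j))"

lemma blk_block [simp]:
  "blk_a (block a b c d) = a" "blk_b (block a b c d) = b"
  "blk_c (block a b c d) = c" "blk_d (block a b c d) = d"
  by (simp_all add: vec_eq_iff blk_defs block_def)

lemma J_form_square: "J_form ** J_form = mat 1"
  by (simp add: block_eq_iff blk_mult blk_J_form blk_mat_1 matrix_distribs)

lemma cadjoint_J_form: "cadjoint J_form = J_form"
  by (simp add: block_eq_iff blk_cadjoint blk_J_form cadjoint_uminus) (simp add: vec_eq_iff)

lemma Unn_iff: "g \<in> Unn \<longleftrightarrow>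
    blk_a g ** cadjoint (blk_a g) = mat 1 + blk_b g ** cadjoint (blk_b g) \<and>
    blk_a g ** cadjoint (blk_c g) = blk_b g ** cadjoint (blk_d g) \<and>
    blk_c g ** cadjoint (blk_a g) = blk_d g ** cadjoint (blk_b g) \<and>
    blk_d g ** cadjoint (blk_d g) = mat 1 + blk_c g ** cadjoint (blk_c g)"
  by (auto simp: Unn_def block_eq_iff blk_mult blk_cadjoint blk_J_form matrix_distribs algebra_simps)

definition Unn_inv :: "('n::finite) block_matrix \<Rightarrow> 'n block_matrix" where
  "Unn_inv g = J_form ** cadjoint g ** J_form"

lemma Unn_inv:
  assumes "g \<in> Unn"
  shows "g ** Unn_inv g = mat 1" "Unn_inv g ** g = mat 1"
proof -
  have "g ** Unn_inv g = (g ** J_form ** cadjoint g) ** J_form"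
    by (simp add: Unn_inv_def matrix_mul_assoc)
  also have "\<dots> = mat 1" using assms by (simp add: Unn_def J_form_square)
  finally show "g ** Unn_inv g = mat 1" .
  then show "Unn_inv g ** g = mat 1" by (rule matrix_left_right_inverse[THEN iffD1])
qed

lemma cadjoint_Unn:
  assumes "g \<in> Unn"
  shows "cadjoint g \<in> Unn"
proof -
  have "cadjoint g ** J_form ** g = J_form ** (Unn_inv g ** g)"
    by (simp add: Unn_inv_def matrix_mul_assoc J_form_square)
  then show ?thesis by (simp add: Unn_def Unn_inv[OF assms])
qed

lemma Unn_mult:
  assumes "g \<in> Unn" "h \<in> Unn"
  shows "g ** h \<in> Unn"
proof -
  have "g ** h ** J_form ** cadjoint (g ** h) = g ** (h ** J_form ** cadjoint h) ** cadjoint g"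
    by (simp add: cadjoint_mult matrix_mul_assoc)
  then show ?thesis using assms by (simp add: Unn_def)
qed

lemma Unn_Unn_inv:
  assumes "g \<in> Unn"
  shows "Unn_inv g \<in> Unn"
proof -
  have "J_form \<in> Unn" by (simp add: Unn_def cadjoint_J_form J_form_square)
  then show ?thesis unfolding Unn_inv_def by (intro Unn_mult cadjoint_Unn assms)
qed

definition contraction :: "complex^'n^'n \<Rightarrow> bool" where
  "contraction z \<longleftrightarrow> (\<forall>v. norm (v v* z) \<le> norm v)"

lemma contraction_rnorm: "contraction z \<Longrightarrow> rnorm z \<le> 1"
  by (rule rnorm_leI) (simp add: contraction_def)

lemma norm_row_isometry: "w ** cadjoint w = mat 1 \<Longrightarrow> norm (v v* w) = norm v" for w :: "complex^'n^'n"
  using norm_row_gram[of w "mat 1" "0 :: complex^'n^'n" v] by (simp add: power2_eq_iff_nonneg)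

lemma unitary_isometry: "z \<in> unitary_group \<Longrightarrow> norm (v v* z) = norm v"
  by (rule norm_row_isometry) (simp add: unitary_group_def)

lemma unitary_contraction: "z \<in> unitary_group \<Longrightarrow> contraction z"
  by (simp add: contraction_def unitary_isometry)

lemma contraction_scaled:
  assumes "contraction z" "norm t \<le> 1"
  shows "contraction (mat t ** z)"
  unfolding contraction_def
proof
  fix v
  have "rnorm (mat t ** z) \<le> 1 * 1"
    unfolding rnorm_mat_mult by (intro mult_mono assms contraction_rnorm rnorm_nonneg) simp
  then show "norm (v v* (mat t ** z)) \<le> norm v"
    using norm_row_le[of v "mat t ** z"] mult_right_mono[of "rnorm (mat t ** z)" 1 "norm v"] by simp
qed

lemma unitary_group_mult: "u \<in> unitary_group \<Longrightarrow> v \<in> unitary_group \<Longrightarrow> u ** v \<in> unitary_group"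
proof -
  assume u: "u \<in> unitary_group" and v: "v \<in> unitary_group"
  have "u ** v ** cadjoint (u ** v) = u ** (v ** cadjoint v) ** cadjoint u"
    "cadjoint (u ** v) ** (u ** v) = cadjoint v ** (cadjoint u ** u) ** v"
    by (simp_all add: cadjoint_mult matrix_mul_assoc)
  then show ?thesis using u v by (simp add: unitary_group_def)
qed

lemma unitary_group_cadjoint: "u \<in> unitary_group \<Longrightarrow> cadjoint u \<in> unitary_group"
  by (simp add: unitary_group_def)

lemma unitary_groupI: "z ** cadjoint z = mat 1 \<Longrightarrow> z \<in> unitary_group"
  using matrix_left_right_inverse[of z "cadjoint z"] by (simp add: unitary_group_def)

text \<open>The pair \<open>(p, q) = (1, z) g\<close> of row blocks.\<close>

definition aut_p :: "('n::finite) block_matrix \<Rightarrow> complex^'n^'n \<Rightarrow> complex^'n^'n" where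
  "aut_p g z = blk_a g + z ** blk_c g"

definition aut_q :: "('n::finite) block_matrix \<Rightarrow> complex^'n^'n \<Rightarrow> complex^'n^'n" where
  "aut_q g z = blk_b g + z ** blk_d g"

lemma moebius_eq: "moebius z g = matrix_inv (aut_p g z) ** aut_q g z"
  by (simp add: moebius_def aut_p_def aut_q_def)

text \<open>With respect to the form preserved by \<open>g\<close>, the rows of \<open>(1, z)\<close> and of \<open>(p, q) = (1, z) g\<close> have the
  same Gram matrix \<open>1 - z z\<^sup>* = p p\<^sup>* - q q\<^sup>*\<close>.\<close>

lemma aut_gram:
  assumes "g \<in> Unn"
  shows "aut_p g z ** cadjoint (aut_p g z) + z ** cadjoint z = aut_q g z ** cadjoint (aut_q g z) + mat 1"
proof -
  have zc: "z ** blk_c g ** cadjoint (blk_a g) = z ** blk_d g ** cadjoint (blk_b g)"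
    "z ** blk_d g ** cadjoint (blk_d g) = z + z ** blk_c g ** cadjoint (blk_c g)"
    using assms[unfolded Unn_iff] by (simp_all flip: matrix_mul_assoc add: matrix_add_ldistrib)
  show ?thesis
    using assms[unfolded Unn_iff]
    by (simp add: aut_p_def aut_q_def cadjoint_add cadjoint_mult matrix_distribs matrix_mul_assoc zc)
qed

lemma aut_norm:
  assumes "g \<in> Unn"
  shows "(norm (v v* aut_p g z))\<^sup>2 + (norm (v v* z))\<^sup>2 = (norm (v v* aut_q g z))\<^sup>2 + (norm v)\<^sup>2"
proof -
  have gram: "complex_of_real ((norm (v v* X))\<^sup>2) = row_herm v (v v* (X ** cadjoint X))"
    for X :: "complex^'k^'l" and v :: "complex^'l"
    by (metis row_herm_self row_herm_adjoint vector_matrix_mul_assoc cadjoint_cadjoint cadjoint_mult)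
  have "complex_of_real ((norm (v v* aut_p g z))\<^sup>2 + (norm (v v* z))\<^sup>2)
      = of_real ((norm (v v* aut_q g z))\<^sup>2 + (norm (v v* mat 1))\<^sup>2)"
    unfolding of_real_add gram row_herm_add[symmetric] vector_matrix_mult_add_rdistrib[symmetric]
      aut_gram[OF assms] by simp
  then show ?thesis by (simp only: of_real_eq_iff vector_matrix_mul_rid)
qed

text \<open>A row in the kernel of \<open>p\<close> is also in the kernel of \<open>q\<close>, since \<open>q\<close> shortens rows at least as much
  as \<open>p\<close> does; but \<open>(p, q) = (1, z) g\<close> has no kernel.\<close>

lemma invertible_aut_p:
  assumes g: "g \<in> Unn" and z: "contraction z"
  shows "invertible (aut_p g z)"
  unfolding invertible_iff_row_kernel
proof (intro allI impI)
  fix v assume p0: "v v* aut_p g z = 0"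
  have "(norm (v v* z))\<^sup>2 \<le> (norm v)\<^sup>2" using z by (simp add: contraction_def)
  then have "(norm (v v* aut_q g z))\<^sup>2 \<le> 0"
    using aut_norm[OF g, of v z] unfolding p0 norm_zero zero_power2 by linarith
  then have q0: "v v* aut_q g z = 0" by simp
  \<comment> \<open>Apply the inverse of \<open>g\<close> to the row \<open>v (1, z) g = 0\<close>.\<close>
  let ?h = "Unn_inv g"
  have "aut_p g z ** blk_a ?h + aut_q g z ** blk_c ?h = blk_a (g ** ?h) + z ** blk_c (g ** ?h)"
    by (simp add: aut_p_def aut_q_def blk_mult matrix_distribs matrix_mul_assoc algebra_simps)
  also have "\<dots> = mat 1" by (simp add: Unn_inv[OF g] blk_mat_1)
  finally have "v = v v* (aut_p g z ** blk_a ?h + aut_q g z ** blk_c ?h)" by simp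
  also have "\<dots> = 0"
    by (simp add: vector_matrix_mult_add_rdistrib vector_matrix_mul_assoc[symmetric] p0 q0)
  finally show "v = 0" .
qed

lemma aut_p_moebius:
  assumes "invertible (aut_p g z)"
  shows "aut_p g z ** moebius z g = aut_q g z"
  by (simp add: moebius_eq matrix_mul_assoc matrix_inv_right assms)

lemma contraction_moebius:
  assumes g: "g \<in> Unn" and z: "contraction z"
  shows "contraction (moebius z g)"
  unfolding contraction_def
proof
  fix v
  let ?w = "v v* matrix_inv (aut_p g z)"
  have "(norm (?w v* z))\<^sup>2 \<le> (norm ?w)\<^sup>2" using z by (simp add: contraction_def)
  then have "norm (?w v* aut_q g z) \<le> norm (?w v* aut_p g z)"
    using aut_norm[OF g, of ?w z] by (intro power2_le_imp_le[OF _ norm_ge_zero]) linarith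
  then show "norm (v v* moebius z g) \<le> norm v"
    by (simp add: vector_matrix_mul_assoc moebius_eq matrix_inv_left invertible_aut_p[OF g z])
qed

lemma moebius_gram:
  assumes "invertible p" "p ** cadjoint p = q ** cadjoint q"
  shows "matrix_inv p ** q \<in> unitary_group"
proof (rule unitary_groupI)
  have "matrix_inv p ** q ** cadjoint (matrix_inv p ** q) = matrix_inv p ** (q ** cadjoint q) ** cadjoint (matrix_inv p)"
    by (simp add: cadjoint_mult matrix_mul_assoc)
  also have "\<dots> = (matrix_inv p ** p) ** cadjoint (matrix_inv p ** p)"
    by (simp add: cadjoint_mult matrix_mul_assoc flip: assms(2))
  finally show "matrix_inv p ** q ** cadjoint (matrix_inv p ** q) = mat 1"
    by (simp add: matrix_inv_left assms(1))
qed

lemma moebius_unitary: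
  assumes g: "g \<in> Unn" and z: "z \<in> unitary_group"
  shows "moebius z g \<in> unitary_group"
  unfolding moebius_eq
proof (rule moebius_gram)
  show "invertible (aut_p g z)" by (intro invertible_aut_p g unitary_contraction z)
  have "z ** cadjoint z = mat 1" using z by (simp add: unitary_group_def)
  with aut_gram[OF g, of z]
  show "aut_p g z ** cadjoint (aut_p g z) = aut_q g z ** cadjoint (aut_q g z)" by simp
qed

lemma aut_p_cocycle:
  assumes "invertible (aut_p g z)"
  shows "aut_p (g ** h) z = aut_p g z ** aut_p h (moebius z g)"
    and "aut_q (g ** h) z = aut_p g z ** aut_q h (moebius z g)"
proof -
  have "aut_p g z ** aut_p h (moebius z g) = aut_p g z ** blk_a h + aut_q g z ** blk_c h"
    "aut_p g z ** aut_q h (moebius z g) = aut_p g z ** blk_b h + aut_q g z ** blk_d h"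
    unfolding aut_p_def[of h] aut_q_def[of h]
    by (simp_all add: matrix_add_ldistrib matrix_mul_assoc aut_p_moebius[OF assms])
  then show "aut_p (g ** h) z = aut_p g z ** aut_p h (moebius z g)"
    "aut_q (g ** h) z = aut_p g z ** aut_q h (moebius z g)"
    by (simp_all add: aut_p_def aut_q_def blk_mult matrix_distribs matrix_mul_assoc algebra_simps)
qed

lemma matrix_inv_mult:
  fixes A B :: "'a::field^'n^'n"
  assumes "invertible A" "invertible B"
  shows "matrix_inv (A ** B) = matrix_inv B ** matrix_inv A"
proof (rule matrix_inv_eqI)
  have "A ** B ** (matrix_inv B ** matrix_inv A) = A ** (B ** matrix_inv B) ** matrix_inv A"
    by (simp add: matrix_mul_assoc)
  then show "A ** B ** (matrix_inv B ** matrix_inv A) = mat 1"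
    by (simp add: matrix_inv_right assms)
qed

lemma moebius_mult:
  assumes "invertible (aut_p g z)" "invertible (aut_p h (moebius z g))"
  shows "moebius z (g ** h) = moebius (moebius z g) h"
proof -
  have "moebius z (g ** h) = matrix_inv (aut_p h (moebius z g)) ** (matrix_inv (aut_p g z) ** aut_p g z) ** aut_q h (moebius z g)"
    by (simp add: moebius_eq[of z "g ** h"] aut_p_cocycle assms matrix_inv_mult matrix_mul_assoc)
  also have "\<dots> = moebius (moebius z g) h"
    by (simp add: matrix_inv_left assms moebius_eq[of "moebius z g" h])
  finally show ?thesis .
qed

lemma moebius_mult_contraction:
  "g \<in> Unn \<Longrightarrow> h \<in> Unn \<Longrightarrow> contraction z \<Longrightarrow> moebius z (g ** h) = moebius (moebius z g) h"
  by (intro moebius_mult invertible_aut_p contraction_moebius)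

lemma moebius_mat_1: "moebius z (mat 1) = z" for z :: "complex^'n^'n"
proof -
  have "matrix_inv (mat 1 :: complex^'n^'n) = mat 1" by (rule matrix_inv_eqI) simp
  then show ?thesis by (simp add: moebius_def blk_mat_1)
qed

lemma contraction_0: "contraction 0"
  by (simp add: contraction_def)

lemma invertible_blk_a: "g \<in> Unn \<Longrightarrow> invertible (blk_a g)"
  using invertible_aut_p[OF _ contraction_0] by (simp add: aut_p_def)

lemma invertible_blk_d:
  assumes "g \<in> Unn"
  shows "invertible (blk_d g)"
  unfolding invertible_iff_row_kernel
proof (intro allI impI)
  fix v assume "v v* blk_d g = 0"
  moreover have "(norm (v v* blk_d g))\<^sup>2 = (norm (v v* mat 1))\<^sup>2 + (norm (v v* blk_c g))\<^sup>2"
    by (rule norm_row_gram) (use assms Unn_iff[of g] in simp)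
  ultimately show "v = 0" by (simp add: add_nonneg_eq_0_iff)
qed

lemma tendsto_blk:
  assumes "(f \<longlongrightarrow> g) F"
  shows "((\<lambda>x. blk_a (f x)) \<longlongrightarrow> blk_a g) F" "((\<lambda>x. blk_b (f x)) \<longlongrightarrow> blk_b g) F"
    "((\<lambda>x. blk_c (f x)) \<longlongrightarrow> blk_c g) F" "((\<lambda>x. blk_d (f x)) \<longlongrightarrow> blk_d g) F"
  unfolding blk_defs by (intro tendsto_vec_lambda tendsto_vec_nth assms)+

text \<open>Applied to \<open>g\<^sup>*\<close>, the defining relations give \<open>c a\<^sup>-\<^sup>1 = (b d\<^sup>-\<^sup>1)\<^sup>*\<close> and \<open>d\<^sup>* d = 1 + b\<^sup>* b\<close>. So under
  \<open>c a\<^sup>-\<^sup>1\<close> the squared length of a row \<open>v\<close> drops by that of \<open>v (d\<^sup>*)\<^sup>-\<^sup>1\<close>, which is bounded below by a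
  multiple of the squared length of \<open>v\<close>.\<close>

lemma rnorm_c_inv_a:
  assumes g: "g \<in> Unn"
  shows "rnorm (blk_c g ** matrix_inv (blk_a g)) < 1"
proof -
  let ?a = "blk_a g" and ?b = "blk_b g" and ?c = "blk_c g" and ?d = "cadjoint (blk_d g)"
  let ?X = "?c ** matrix_inv ?a"
  note rel = cadjoint_Unn[OF g, unfolded Unn_iff blk_cadjoint cadjoint_cadjoint]
  have a: "invertible ?a" and d: "invertible ?d"
    using g by (simp_all add: invertible_blk_a invertible_blk_d invertible_cadjoint)
  have "?d ** ?X = cadjoint ?b ** (?a ** matrix_inv ?a)"
    using rel by (simp add: matrix_mul_assoc)
  then have X: "?X = matrix_inv ?d ** cadjoint ?b"
    by (metis a d matrix_inv_right matrix_mul_rid matrix_mult_eq_iff)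
  have loss: "(norm v)\<^sup>2 = (norm (v v* matrix_inv ?d))\<^sup>2 + (norm (v v* ?X))\<^sup>2" for v
  proof -
    let ?w = "v v* matrix_inv ?d"
    have "(norm (?w v* ?d))\<^sup>2 = (norm (?w v* mat 1))\<^sup>2 + (norm (?w v* cadjoint ?b))\<^sup>2"
      by (rule norm_row_gram) (use rel in simp)
    then show ?thesis
      by (simp add: vector_matrix_mul_assoc matrix_inv_left d X)
  qed
  have low: "(norm v)\<^sup>2 \<le> (rnorm ?d)\<^sup>2 * (norm (v v* matrix_inv ?d))\<^sup>2" for v
  proof -
    have "norm v \<le> rnorm ?d * norm (v v* matrix_inv ?d)"
      using norm_row_le[of "v v* matrix_inv ?d" ?d] by (simp add: vector_matrix_mul_assoc matrix_inv_left d)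
    then show ?thesis by (metis norm_ge_zero power_mono power_mult_distrib)
  qed
  define k where "k = (rnorm ?d)\<^sup>2 + 1"
  have k: "k \<ge> 1" by (simp add: k_def)
  have "norm (v v* ?X) \<le> sqrt (1 - 1 / k) * norm v" for v
  proof -
    have "(norm v)\<^sup>2 \<le> k * (norm (v v* matrix_inv ?d))\<^sup>2"
      using add_increasing2[OF zero_le_power2 low[of v], of "norm (v v* matrix_inv ?d)"]
      by (simp add: k_def distrib_right)
    then have "(norm v)\<^sup>2 / k \<le> (norm (v v* matrix_inv ?d))\<^sup>2"
      using k by (simp add: divide_le_eq mult.commute)
    then have "(norm (v v* ?X))\<^sup>2 \<le> (1 - 1 / k) * (norm v)\<^sup>2"
      using loss[of v] by (simp add: left_diff_distrib)
    then have "sqrt ((norm (v v* ?X))\<^sup>2) \<le> sqrt ((1 - 1 / k) * (norm v)\<^sup>2)" by (rule real_sqrt_le_mono)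
    then show ?thesis by (simp add: real_sqrt_mult)
  qed
  then have "rnorm ?X \<le> sqrt (1 - 1 / k)" by (rule rnorm_leI)
  also have "\<dots> < 1" using k by simp
  finally show ?thesis .
qed

lemma rnorm_z_c_inv_a:
  assumes "contraction z"
  shows "rnorm (z ** blk_c g ** matrix_inv (blk_a g)) \<le> rnorm (blk_c g ** matrix_inv (blk_a g))"
proof -
  have "rnorm (z ** blk_c g ** matrix_inv (blk_a g)) \<le> rnorm z * rnorm (blk_c g ** matrix_inv (blk_a g))"
    by (metis rnorm_mult matrix_mul_assoc)
  also have "\<dots> \<le> 1 * rnorm (blk_c g ** matrix_inv (blk_a g))"
    by (intro mult_right_mono contraction_rnorm assms rnorm_nonneg)
  finally show ?thesis by simp
qed

section \<open>The trace of the logarithm\<close>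

definition tlog :: "complex^'n^'n \<Rightarrow> complex" where
  "tlog X = trace (matln (mat 1 + X))"

lemma bounded_linear_trace: "bounded_linear (trace :: complex^'n^'n \<Rightarrow> complex)"
proof -
  have "linear (trace :: complex^'n^'n \<Rightarrow> complex)"
    by (rule linearI) (simp_all add: trace_def sum.distrib scaleR_sum_right)
  then show ?thesis by (rule linear_conv_bounded_linear[THEN iffD1])
qed

lemma bounded_linear_matrix_mult_left: "bounded_linear (\<lambda>B. A ** (B :: complex^'p^'n))"
proof -
  have "linear (\<lambda>B. A ** (B :: complex^'p^'n))"
    by (rule linearI) (simp_all add: vec_eq_iff matrix_mult_nth sum.distrib distrib_left scaleR_sum_right)
  then show ?thesis by (rule linear_conv_bounded_linear[THEN iffD1])
qed

lemma trace_mat_mult: "trace (mat c ** A) = c * trace A" for A :: "complex^'n^'n"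
  by (simp add: trace_def mat_mult_nth sum_distrib_left)

lemma norm_trace_le: "norm (trace A) \<le> real CARD('n) * rnorm A" for A :: "complex^'n^'n"
proof -
  have "norm (trace A) \<le> (\<Sum>i\<in>(UNIV::'n set). rnorm A)"
    unfolding trace_def by (rule sum_norm_le) (rule norm_entry_le_rnorm)
  then show ?thesis by simp
qed

lemma rnorm_matpow: "rnorm (matpow X k) \<le> rnorm X ^ k"
proof (induction k)
  case (Suc k)
  have "rnorm (matpow X (Suc k)) \<le> rnorm X * rnorm (matpow X k)" by (simp add: rnorm_mult)
  also have "\<dots> \<le> rnorm X * rnorm X ^ k" by (intro mult_left_mono Suc.IH rnorm_nonneg)
  finally show ?case by simp
qed (simp add: rnorm_mat_1)

lemma matpow_mat_mult: "matpow (mat t ** X) k = mat (t ^ k) ** matpow X k"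
proof (induction k)
  case (Suc k)
  have "matpow (mat t ** X) (Suc k) = mat t ** (X ** mat (t ^ k)) ** matpow X k"
    by (simp add: Suc.IH matrix_mul_assoc)
  also have "\<dots> = (mat t ** mat (t ^ k)) ** (X ** matpow X k)"
    by (simp only: mat_mult_commute[of X] matrix_mul_assoc)
  finally show ?case by (simp add: mat_mult_mat)
qed simp

lemma summable_matpow:
  fixes X :: "complex^'n^'n"
  assumes X: "rnorm X < 1" and a: "\<And>k. \<bar>a k\<bar> \<le> 1"
  shows "summable (\<lambda>k. a k *\<^sub>R matpow X k)"
proof (rule summable_comparison_test')
  show "summable (\<lambda>k. real (CARD('n) * CARD('n)) * rnorm X ^ k)"
    by (intro summable_mult summable_geometric) (simp add: X rnorm_nonneg)
  fix k
  have "norm (a k *\<^sub>R matpow X k) \<le> norm (matpow X k)"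
    using mult_right_mono[OF a norm_ge_zero, of k "matpow X k"] by simp
  also have "\<dots> \<le> real (CARD('n) * CARD('n)) * rnorm (matpow X k)"
    by (rule norm_le_rnorm)
  also have "\<dots> \<le> real (CARD('n) * CARD('n)) * rnorm X ^ k"
    by (intro mult_left_mono rnorm_matpow) simp
  finally show "norm (a k *\<^sub>R matpow X k) \<le> real (CARD('n) * CARD('n)) * rnorm X ^ k" .
qed

definition tlog_term :: "nat \<Rightarrow> complex^'n^'n \<Rightarrow> complex" where
  "tlog_term k X = ((-1) ^ k / real (Suc k)) *\<^sub>R trace (matpow X (Suc k))"

lemma tlog_sums:
  fixes X :: "complex^'n^'n"
  assumes "rnorm X < 1"
  shows "(\<lambda>k. tlog_term k X) sums tlog X"
proof -
  have "summable (\<lambda>k. ((-1) ^ (k - 1) / real (max 1 k)) *\<^sub>R matpow X k)"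
    using assms by (rule summable_matpow) (simp add: abs_mult power_abs)
  then have "summable (\<lambda>k. ((-1) ^ k / real (Suc k)) *\<^sub>R matpow X (Suc k))"
    by (subst (asm) summable_Suc_iff[symmetric]) simp
  then have "(\<lambda>k. ((-1) ^ k / real (Suc k)) *\<^sub>R matpow X (Suc k)) sums matln (mat 1 + X)"
    unfolding matln_def by (simp only: add_diff_cancel_left' summable_sums)
  from bounded_linear.sums[OF bounded_linear_trace this] show ?thesis
    unfolding tlog_def tlog_term_def
    by (simp only: linear_scale[OF bounded_linear.linear[OF bounded_linear_trace]])
qed

lemma tlog_0: "tlog (0 :: complex^'n^'n) = 0"
proof -
  have "tlog_term k (0 :: complex^'n^'n) = 0" for k
    by (simp add: tlog_term_def trace_def)
  then have "(\<lambda>k. 0) sums tlog (0 :: complex^'n^'n)"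
    using tlog_sums[of "0 :: complex^'n^'n"] rnorm_mat_mult[of 0 "0 :: complex^'n^'n"] by simp
  then show ?thesis by (simp add: sums_iff)
qed

lemma norm_tlog_term:
  fixes X :: "complex^'n^'n"
  assumes "rnorm X \<le> r"
  shows "norm (tlog_term k X) \<le> real CARD('n) * r ^ Suc k"
proof -
  have "norm (tlog_term k X) \<le> norm (trace (matpow X (Suc k)))"
    by (simp add: tlog_term_def power_abs divide_le_eq distrib_left)
  also have "\<dots> \<le> real CARD('n) * rnorm (matpow X (Suc k))" by (rule norm_trace_le)
  also have "\<dots> \<le> real CARD('n) * r ^ Suc k"
    by (intro mult_left_mono order_trans[OF rnorm_matpow] power_mono assms rnorm_nonneg) simp
  finally show ?thesis .
qed

lemma summable_tlog_bound: "0 \<le> r \<Longrightarrow> r < 1 \<Longrightarrow> summable (\<lambda>k. c * r ^ Suc k)" for r c :: real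
  by (intro summable_mult summable_Suc_iff[THEN iffD2] summable_geometric) simp

lemma norm_tlog_le:
  fixes X :: "complex^'n^'n"
  assumes "rnorm X \<le> r" "r < 1"
  shows "norm (tlog X) \<le> (\<Sum>k. real CARD('n) * r ^ Suc k)"
proof -
  have "norm (\<Sum>k. tlog_term k X) \<le> (\<Sum>k. real CARD('n) * r ^ Suc k)"
    by (rule norm_suminf_le[OF norm_tlog_term[OF assms(1)] summable_tlog_bound])
      (use assms rnorm_nonneg[of X] in auto)
  then show ?thesis using tlog_sums[of X] assms by (simp add: sums_iff)
qed

lemma tendsto_matpow: "(f \<longlongrightarrow> A) F \<Longrightarrow> ((\<lambda>x. matpow (f x) k) \<longlongrightarrow> matpow A k) F"
  by (induction k) (auto intro: tendsto_matrix_mult)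

text \<open>The logarithmic series converges uniformly on every ball \<open>\<parallel>Y\<parallel> < r\<close> with \<open>r < 1\<close>.\<close>

lemma tendsto_tlog:
  fixes X :: "complex^'n^'n"
  assumes f: "(f \<longlongrightarrow> X) F" and X: "rnorm X < 1"
  shows "((\<lambda>x. tlog (f x)) \<longlongrightarrow> tlog X) F"
proof -
  define r where "r = (1 + rnorm X) / 2"
  have r: "rnorm X < r" "r < 1" "0 \<le> r" using X rnorm_nonneg[of X] by (auto simp: r_def)
  let ?S = "{Y :: complex^'n^'n. rnorm Y < r}"
  have "continuous_on UNIV (rnorm :: complex^'n^'n \<Rightarrow> real)"
    unfolding continuous_on_def by (auto intro: tendsto_rnorm)
  then have "open ?S" by (intro open_Collect_less continuous_on_const)
  have "uniform_limit ?S (\<lambda>n Y. \<Sum>k<n. tlog_term k Y) (\<lambda>Y. \<Sum>k. tlog_term k Y) sequentially"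
  proof (rule Weierstrass_m_test)
    show "norm (tlog_term k Y) \<le> real CARD('n) * r ^ Suc k" if "Y \<in> ?S" for k Y
      using that by (intro norm_tlog_term) simp
    show "summable (\<lambda>k. real CARD('n) * r ^ Suc k)" by (rule summable_tlog_bound) (use r in auto)
  qed
  then have "continuous_on ?S (\<lambda>Y. \<Sum>k. tlog_term k Y)"
  proof (rule uniform_limit_theorem[rotated])
    show "\<forall>\<^sub>F n in sequentially. continuous_on ?S (\<lambda>Y. \<Sum>k<n. tlog_term k Y)"
      unfolding tlog_term_def continuous_on_def
      by (intro always_eventually allI ballI tendsto_sum tendsto_scaleR tendsto_const tendsto_trace
          tendsto_matpow tendsto_ident_at)
  qed simp
  moreover have "(\<Sum>k. tlog_term k Y) = tlog Y" if "Y \<in> ?S" for Y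
    using tlog_sums[of Y] that r by (simp add: sums_iff)
  ultimately have "continuous_on ?S tlog" by (rule continuous_on_eq)
  then have "isCont tlog X" using \<open>open ?S\<close> r by (simp add: continuous_on_eq_continuous_at)
  then show ?thesis using f by (rule isCont_tendsto_compose)
qed

lemma neumann:
  fixes Z :: "complex^'n^'n"
  assumes "rnorm Z < 1"
  shows "(\<lambda>k. (-1) ^ k *\<^sub>R matpow Z k) sums matrix_inv (mat 1 + Z)" "invertible (mat 1 + Z)"
proof -
  let ?f = "\<lambda>k. (-1) ^ k *\<^sub>R matpow Z k"
  let ?Y = "suminf ?f"
  have s: "summable ?f" by (rule summable_matpow[OF assms]) (simp add: power_abs)
  have "(\<lambda>k. Z ** ?f k) sums (Z ** ?Y)"
    by (rule bounded_linear.sums[OF bounded_linear_matrix_mult_left summable_sums[OF s]])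
  then have "(\<lambda>k. - (Z ** ?f k)) sums - (Z ** ?Y)" by (rule sums_minus)
  moreover have "- (Z ** ?f k) = ?f (Suc k)" for k
    by (simp add: linear_scale[OF bounded_linear.linear[OF bounded_linear_matrix_mult_left]])
  ultimately have "(\<lambda>k. ?f (Suc k)) sums - (Z ** ?Y)" by simp
  then have "?f sums (- (Z ** ?Y) + ?f 0)" by (rule sums_Suc)
  then have "?Y = - (Z ** ?Y) + mat 1" by (simp add: sums_iff)
  moreover have cancel: "a = - b + c \<Longrightarrow> a + b = c" for a b c :: "complex^'n^'n" by simp
  ultimately have "?Y + Z ** ?Y = mat 1" by (intro cancel)
  then have "(mat 1 + Z) ** ?Y = mat 1" by (simp only: matrix_add_rdistrib matrix_mul_lid)
  then show "invertible (mat 1 + Z)" "?f sums matrix_inv (mat 1 + Z)"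
    using s by (simp_all add: matrix_inv_eqI summable_sums)
qed

text \<open>Along the segment from \<open>0\<close> to \<open>X\<close> both sides satisfy the same linear differential equation:
  Jacobi's formula gives the logarithmic derivative \<open>tr ((1 + t X)\<^sup>-\<^sup>1 X)\<close> of the determinant, and
  termwise differentiation of the logarithmic series gives the Neumann series of the same trace.\<close>

lemma exp_tlog:
  fixes X :: "complex^'n^'n"
  assumes X: "rnorm X < 1"
  shows "exp (tlog X) = det (mat 1 + X)"
proof -
  define K where "K = 2 / (1 + rnorm X)"
  have K: "1 < K" "K * rnorm X < 1"
    using X rnorm_nonneg[of X] by (auto simp: K_def field_simps)
  have small: "rnorm (mat t ** X) < 1" if "norm t < K" for t
  proof -
    have "norm t * rnorm X \<le> K * rnorm X" by (intro mult_right_mono rnorm_nonneg) (use that in simp)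
    then show ?thesis using K by (simp add: rnorm_mat_mult)
  qed
  define c where "c k = (case k of 0 \<Rightarrow> 0 | Suc m \<Rightarrow> tlog_term m X)" for k
  have series: "(\<lambda>k. c k * t ^ k) sums tlog (mat t ** X)" if "norm t < K" for t
  proof (rule sums_Suc_imp)
    show "(\<lambda>k. c (Suc k) * t ^ Suc k) sums tlog (mat t ** X)"
      using tlog_sums[OF small[OF that]]
      by (simp add: tlog_term_def matpow_mat_mult trace_mat_mult c_def mult_ac
          del: matpow.simps power_Suc)
  qed (simp add: c_def)
  have D: "((\<lambda>t. tlog (mat t ** X)) has_field_derivative
      trace (matrix_inv (mat 1 + mat t ** X) ** X)) (at t)" if t: "norm t < K" for t
  proof -
    obtain R where R: "norm t < R" "R < K" using t dense by blast
    then have R0: "0 < R" using norm_ge_zero[of t] by linarith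
    have "summable (\<lambda>k. c k * of_real R ^ k)"
      using series[of "of_real R"] R R0 by (simp add: sums_iff)
    then have "((\<lambda>t. \<Sum>k. c k * t ^ k) has_field_derivative (\<Sum>k. diffs c k * t ^ k)) (at t)"
      by (rule termdiffs_strong) (use R R0 in simp)
    moreover have "(\<Sum>k. diffs c k * t ^ k) = trace (matrix_inv (mat 1 + mat t ** X) ** X)"
    proof -
      have "(\<lambda>k. trace (X ** ((-1) ^ k *\<^sub>R matpow (mat t ** X) k)))
          sums trace (X ** matrix_inv (mat 1 + mat t ** X))"
        by (intro bounded_linear.sums[OF bounded_linear_trace]
            bounded_linear.sums[OF bounded_linear_matrix_mult_left] neumann small t)
      moreover have "trace (X ** ((-1) ^ k *\<^sub>R matpow (mat t ** X) k)) = diffs c k * t ^ k" for k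
      proof -
        have "X ** ((-1) ^ k *\<^sub>R matpow (mat t ** X) k) = (-1) ^ k *\<^sub>R (X ** mat (t ^ k) ** matpow X k)"
          by (simp add: linear_scale[OF bounded_linear.linear[OF bounded_linear_matrix_mult_left]]
              matpow_mat_mult matrix_mul_assoc)
        also have "\<dots> = (-1) ^ k *\<^sub>R (mat (t ^ k) ** matpow X (Suc k))"
          by (simp only: mat_mult_commute matrix_mul_assoc[symmetric] matpow.simps)
        finally have eq: "X ** ((-1) ^ k *\<^sub>R matpow (mat t ** X) k) = (-1) ^ k *\<^sub>R (mat (t ^ k) ** matpow X (Suc k))" .
        have "trace (X ** ((-1) ^ k *\<^sub>R matpow (mat t ** X) k)) = (-1) ^ k *\<^sub>R (t ^ k * trace (matpow X (Suc k)))"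
          unfolding eq by (simp only: linear_scale[OF bounded_linear.linear[OF bounded_linear_trace]] trace_mat_mult)
        also have "\<dots> = diffs c k * t ^ k"
        proof -
          have "diffs c k = of_real (real (Suc k) * ((-1) ^ k / real (Suc k))) * trace (matpow X (Suc k))"
            by (simp only: diffs_def c_def nat.case tlog_term_def scaleR_conv_of_real of_real_mult
                of_real_of_nat_eq mult.assoc)
          also have "real (Suc k) * ((-1) ^ k / real (Suc k)) = (-1) ^ k" by simp
          finally show ?thesis by (simp add: scaleR_conv_of_real mult_ac del: matpow.simps)
        qed
        finally show ?thesis .
      qed
      ultimately show ?thesis by (simp add: sums_iff trace_mul_sym[of X])
    qed
    ultimately have "((\<lambda>t. \<Sum>k. c k * t ^ k) has_field_derivative
        trace (matrix_inv (mat 1 + mat t ** X) ** X)) (at t)" by simp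
    then show ?thesis
    proof (rule has_field_derivative_transform_within_open[where S="ball 0 K"])
      show "(\<Sum>k. c k * s ^ k) = tlog (mat s ** X)" if "s \<in> ball 0 K" for s
        using series[of s] that by (simp add: sums_iff dist_norm)
    qed (use t in \<open>auto simp: dist_norm\<close>)
  qed
  let ?h = "\<lambda>t. det (mat 1 + mat t ** X) * exp (- tlog (mat t ** X))"
  have "\<exists>k. \<forall>t\<in>ball 0 K. ?h t = k"
  proof (rule has_field_derivative_zero_constant)
    fix t :: complex assume "t \<in> ball 0 K"
    then have t: "norm t < K" by (simp add: dist_norm)
    have "(?h has_field_derivative 0) (at t)"
      by (rule derivative_eq_intros det_line_has_derivative D neumann small t refl | simp)+
    then show "(?h has_field_derivative 0) (at t within ball 0 K)" by (rule has_field_derivative_at_within)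
  qed simp
  then obtain k where k: "\<forall>t\<in>ball 0 K. ?h t = k" by blast
  have "(1::complex) \<in> ball 0 K" "(0::complex) \<in> ball 0 K" using K by auto
  then have "?h 1 = ?h 0" using k by metis
  then show ?thesis by (simp add: exp_minus tlog_0 field_simps)
qed

section \<open>The cocycle of logarithms\<close>

lemma log_det_factor_eq:
  "log_det_factor G z = fst (snd G) + tlog (z ** blk_c (fst G) ** matrix_inv (blk_a (fst G)))"
  by (cases G) (simp add: tlog_def)

lemma cover_set_iff: "G \<in> cover_set \<longleftrightarrow>
    fst G \<in> Unn \<and> det (blk_a (fst G)) = exp (fst (snd G)) \<and> det (blk_d (fst G)) = exp (snd (snd G))"
  by (cases G) (simp add: cover_set_def)

lemma rnorm_factor:
  assumes "g \<in> Unn" "contraction z"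
  shows "rnorm (z ** blk_c g ** matrix_inv (blk_a g)) < 1"
  using rnorm_z_c_inv_a[OF assms(2), of g] rnorm_c_inv_a[OF assms(1)] by linarith

lemma exp_log_det_factor:
  assumes g: "fst G \<in> Unn" and a: "det (blk_a (fst G)) = exp (fst (snd G))" and z: "contraction z"
  shows "exp (log_det_factor G z) = det (aut_p (fst G) z)"
proof -
  let ?a = "blk_a (fst G)" and ?X = "z ** blk_c (fst G) ** matrix_inv (blk_a (fst G))"
  have "exp (log_det_factor G z) = det ((mat 1 + ?X) ** ?a)"
    by (simp add: log_det_factor_eq exp_add exp_tlog rnorm_factor g z det_mul a mult.commute)
  also have "(mat 1 + ?X) ** ?a = ?a + z ** blk_c (fst G) ** (matrix_inv ?a ** ?a)"
    by (simp add: matrix_add_rdistrib matrix_mul_assoc)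
  also have "\<dots> = aut_p (fst G) z"
    by (simp add: matrix_inv_left invertible_blk_a g aut_p_def)
  finally show ?thesis .
qed

lemma tendsto_aut:
  assumes "(g \<longlongrightarrow> g0) F" "(z \<longlongrightarrow> z0) F"
  shows "((\<lambda>x. aut_p (g x) (z x)) \<longlongrightarrow> aut_p g0 z0) F" "((\<lambda>x. aut_q (g x) (z x)) \<longlongrightarrow> aut_q g0 z0) F"
  unfolding aut_p_def aut_q_def
  by (intro tendsto_add tendsto_matrix_mult tendsto_blk assms)+

lemma tendsto_moebius:
  assumes "(g \<longlongrightarrow> g0) F" "(z \<longlongrightarrow> z0) F" "g0 \<in> Unn" "contraction z0"
  shows "((\<lambda>x. moebius (z x) (g x)) \<longlongrightarrow> moebius z0 g0) F"
  unfolding moebius_eq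
  by (intro tendsto_matrix_mult tendsto_matrix_inv tendsto_aut invertible_aut_p assms)

lemma tendsto_log_det_factor:
  assumes "(G \<longlongrightarrow> G0) F" "(z \<longlongrightarrow> z0) F" "fst G0 \<in> Unn" "contraction z0"
  shows "((\<lambda>x. log_det_factor (G x) (z x)) \<longlongrightarrow> log_det_factor G0 z0) F"
  unfolding log_det_factor_eq
  by (intro tendsto_add tendsto_tlog tendsto_matrix_mult tendsto_matrix_inv tendsto_blk
      tendsto_fst tendsto_snd assms invertible_blk_a rnorm_factor)

text \<open>The twist in the multiplication of the covering group is the logarithm of the automorphy
  factor of the second element at the image of \<open>0\<close>: it is the cocycle identity at \<open>z = 0\<close>.\<close>

lemma log_det_factor_mult_0:
  assumes g: "fst G \<in> Unn" and h: "fst H \<in> Unn"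
  shows "log_det_factor (cover_mult G H) 0 = log_det_factor G 0 + log_det_factor H (moebius 0 (fst G))"
proof -
  obtain g s t where G: "G = (g, s, t)" by (cases G)
  obtain h s' t' where H: "H = (h, s', t')" by (cases H)
  have a: "invertible (blk_a g)" and a': "invertible (blk_a h)"
    using g h by (simp_all add: G H invertible_blk_a)
  have "matrix_inv (blk_a g) ** blk_a (g ** h) ** matrix_inv (blk_a h)
      = (matrix_inv (blk_a g) ** blk_a g) ** (blk_a h ** matrix_inv (blk_a h))
        + matrix_inv (blk_a g) ** blk_b g ** blk_c h ** matrix_inv (blk_a h)"
    by (simp add: blk_mult matrix_distribs matrix_mul_assoc)
  also have "\<dots> = mat 1 + moebius 0 g ** blk_c h ** matrix_inv (blk_a h)"
    by (simp add: matrix_inv_left matrix_inv_right a a' moebius_def)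
  finally have "trace (matln (matrix_inv (blk_a g) ** blk_a (g ** h) ** matrix_inv (blk_a h)))
      = tlog (moebius 0 g ** blk_c h ** matrix_inv (blk_a h))"
    by (simp add: tlog_def)
  then show ?thesis by (simp add: G H log_det_factor_eq tlog_0)
qed

text \<open>Both sides are logarithms of the same determinant, so their difference is a multiple of
  \<open>2 \<pi> i\<close>. It depends continuously on \<open>z\<close> in the ball of contractions and vanishes at the centre.\<close>

lemma log_det_factor_mult:
  assumes G: "G \<in> cover_set" and H: "H \<in> cover_set" and z: "contraction z"
  shows "log_det_factor (cover_mult G H) z = log_det_factor G z + log_det_factor H (moebius z (fst G))"
proof -
  let ?g = "fst G" and ?h = "fst H"
  have g: "?g \<in> Unn" and h: "?h \<in> Unn" using G H by (simp_all add: cover_set_iff)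
  have fst_mult: "fst (cover_mult G H) = ?g ** ?h" by (cases G; cases H) simp
  have gh: "fst (cover_mult G H) \<in> Unn" by (simp add: fst_mult Unn_mult g h)
  have eG: "exp (log_det_factor G w) = det (aut_p ?g w)" if "contraction w" for w
    using G that by (intro exp_log_det_factor) (simp_all add: cover_set_iff)
  have eH: "exp (log_det_factor H w) = det (aut_p ?h w)" if "contraction w" for w
    using H that by (intro exp_log_det_factor) (simp_all add: cover_set_iff)
  have prod: "det (aut_p (?g ** ?h) w) = det (aut_p ?g w) * det (aut_p ?h (moebius w ?g))"
    if "contraction w" for w
    by (simp add: aut_p_cocycle invertible_aut_p g that det_mul)
  have "exp (log_det_factor (cover_mult G H) 0) = det (aut_p (?g ** ?h) 0)"
    by (simp add: log_det_factor_mult_0 g h exp_add eG eH prod contraction_0 contraction_moebius)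
  then have "det (blk_a (fst (cover_mult G H))) = exp (fst (snd (cover_mult G H)))"
    by (simp add: log_det_factor_eq tlog_0 fst_mult aut_p_def)
  then have eGH: "exp (log_det_factor (cover_mult G H) w) = det (aut_p (?g ** ?h) w)" if "contraction w" for w
    using exp_log_det_factor[OF gh _ that] by (simp add: fst_mult)
  define w where "w t = mat (complex_of_real t) ** z" for t
  have w: "contraction (w t)" if "t \<in> {0..1}" for t
    using that z by (auto simp: w_def intro!: contraction_scaled)
  define D where "D t = log_det_factor (cover_mult G H) (w t) - (log_det_factor G (w t)
      + log_det_factor H (moebius (w t) ?g))" for t
  have "exp (D t) = 1" if "t \<in> {0..1}" for t
    using w[OF that]
    by (simp add: D_def exp_diff exp_add eG eH eGH contraction_moebius g prod)
      (metis g h invertible_aut_p invertible_det_nz contraction_moebius mult_eq_0_iff)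
  then have D: "Re (D t) = 0" "\<exists>n::int. Im (D t) = of_int (2 * n) * pi" if "t \<in> {0..1}" for t
    using that unfolding exp_eq_1 by blast+
  have wt: "((\<lambda>t. w t) \<longlongrightarrow> w t) (at t within S)" for t S
    unfolding w_def by (intro tendsto_matrix_mult tendsto_mat tendsto_of_real tendsto_ident_at tendsto_const)
  have "continuous_on {0..1} D"
    unfolding continuous_on_def D_def
    by (intro ballI tendsto_diff tendsto_add tendsto_log_det_factor tendsto_moebius tendsto_const wt
        gh g h w contraction_moebius)
  then have "D constant_on {0..1}"
  proof (rule continuous_discrete_range_constant[rotated])
    show "\<exists>e>0. \<forall>y. y \<in> {0..1} \<and> D y \<noteq> D x \<longrightarrow> e \<le> norm (D y - D x)" if x: "x \<in> {0..1}" for x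
    proof (intro exI[of _ "2 * pi"] conjI allI impI)
      fix y assume y: "y \<in> {0..1} \<and> D y \<noteq> D x"
      obtain m n :: int where m: "Im (D y) = of_int (2 * m) * pi" and n: "Im (D x) = of_int (2 * n) * pi"
        using D(2) x y by blast
      have "m \<noteq> n" using y D(1)[of x] D(1)[of y] x m n by (auto simp: complex_eq_iff)
      then have "1 \<le> \<bar>m - n\<bar>" by simp
      then have "1 \<le> \<bar>real_of_int m - real_of_int n\<bar>" by linarith
      then have "2 * pi * 1 \<le> 2 * pi * \<bar>real_of_int m - real_of_int n\<bar>" by (intro mult_left_mono) auto
      also have "\<dots> = \<bar>2 * pi * (real_of_int m - real_of_int n)\<bar>" by (simp only: abs_mult) simp
      also have "2 * pi * (real_of_int m - real_of_int n) = Im (D y - D x)"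
        by (simp add: m n right_diff_distrib)
      also have "\<bar>Im (D y - D x)\<bar> \<le> norm (D y - D x)" by (rule abs_Im_le_cmod)
      finally show "2 * pi \<le> norm (D y - D x)" by simp
    qed simp
  qed simp
  then have "D 1 = D 0" by (auto simp: constant_on_def)
  also have "D 0 = 0" by (simp add: D_def w_def log_det_factor_mult_0 g h)
  finally show ?thesis by (simp add: D_def w_def)
qed

section \<open>Real coordinates on Hermitian matrices\<close>

text \<open>The change of variables formula refers to \<open>\<real>\<^sup>k\<close> with a finite well-ordered index type \<open>k\<close>, so the
  real coordinates of a Hermitian matrix are indexed by a copy of the type of pairs that carries an
  arbitrary well-ordering.\<close>

datatype 'n hidx = HIdx 'n 'n

lemma UNIV_hidx: "(UNIV :: 'n hidx set) = (\<lambda>(i, j). HIdx i j) ` UNIV"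
  by (auto intro: hidx.exhaust simp: image_iff) (metis hidx.exhaust)

instance hidx :: (finite) finite
  by standard (simp add: UNIV_hidx)

definition hidx_code :: "('n::finite) hidx \<Rightarrow> nat" where
  "hidx_code = (SOME f. inj f)"

lemma inj_hidx_code: "inj (hidx_code :: ('n::finite) hidx \<Rightarrow> nat)"
proof -
  have "\<exists>f :: 'n hidx \<Rightarrow> nat. inj f"
    using finite_imp_inj_to_nat_seg[of "UNIV :: 'n hidx set"] by auto
  then show ?thesis unfolding hidx_code_def by (rule someI_ex)
qed

instantiation hidx :: (finite) wellorder
begin

definition less_eq_hidx :: "'a hidx \<Rightarrow> 'a hidx \<Rightarrow> bool" where
  "less_eq_hidx x y \<longleftrightarrow> hidx_code x \<le> hidx_code y"

definition less_hidx :: "'a hidx \<Rightarrow> 'a hidx \<Rightarrow> bool" where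
  "less_hidx x y \<longleftrightarrow> hidx_code x < hidx_code y"

instance
proof
  fix x y z :: "'a hidx"
  show "x \<le> y \<Longrightarrow> y \<le> x \<Longrightarrow> x = y"
    by (rule injD[OF inj_hidx_code]) (simp add: less_eq_hidx_def)
  show "P x" if "\<And>x. (\<And>y. y < x \<Longrightarrow> P y) \<Longrightarrow> P x" for P
    by (rule measure_induct_rule[of hidx_code P x]) (rule that, simp add: less_hidx_def)
qed (simp_all add: less_eq_hidx_def less_hidx_def less_le_not_le linear)

end

lemma sum_hidx: "(\<Sum>x\<in>UNIV. f x) = (\<Sum>i\<in>UNIV. \<Sum>j\<in>UNIV. f (HIdx i j))"
  for f :: "('n::finite) hidx \<Rightarrow> 'b::comm_monoid_add"
proof -
  have "inj (\<lambda>(i, j). HIdx i (j::'n))" by (auto simp: inj_def)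
  then have "(\<Sum>x\<in>UNIV. f x) = (\<Sum>p\<in>UNIV. f (case p of (i, j) \<Rightarrow> HIdx i j))"
    unfolding UNIV_hidx by (simp add: sum.reindex)
  also have "\<dots> = (\<Sum>i\<in>UNIV. \<Sum>j\<in>UNIV. f (HIdx i j))"
    by (simp add: sum.cartesian_product split_def flip: UNIV_Times_UNIV)
  finally show ?thesis .
qed

lemma all_hidx: "(\<forall>x. P x) \<longleftrightarrow> (\<forall>i j. P (HIdx i j))"
  by (metis hidx.exhaust)

text \<open>Real coordinates \<open>r\<^sub>i\<^sub>j = Re h\<^sub>i\<^sub>j + Im h\<^sub>i\<^sub>j\<close> of a Hermitian matrix \<open>h\<close>. Both directions are
  given by formulas that extend complex linearly to all matrices, which is what makes the
  determinant of \<open>h \<mapsto> A h A\<^sup>*\<close> computable over the complex numbers.\<close>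

definition hmat :: "complex^('n::finite) hidx \<Rightarrow> complex^'n^'n" where
  "hmat u = (\<chi> i j. ((1 + \<i>) * u $ HIdx i j + (1 - \<i>) * u $ HIdx j i) / 2)"

definition hvec :: "complex^'n^'n \<Rightarrow> complex^('n::finite) hidx" where
  "hvec Y = (\<chi> x. case x of HIdx i j \<Rightarrow> ((1 - \<i>) * Y $ i $ j + (1 + \<i>) * Y $ j $ i) / 2)"

definition cplx_vec :: "real^'k \<Rightarrow> complex^'k" where
  "cplx_vec r = (\<chi> x. of_real (r $ x))"

definition herm :: "real^('n::finite) hidx \<Rightarrow> complex^'n^'n" where
  "herm r = hmat (cplx_vec r)"

definition hcoord :: "complex^'n^'n \<Rightarrow> real^('n::finite) hidx" where
  "hcoord Y = (\<chi> x. Re (hvec Y $ x))"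

lemma hmat_nth: "hmat u $ i $ j = ((1 + \<i>) * u $ HIdx i j + (1 - \<i>) * u $ HIdx j i) / 2"
  by (simp add: hmat_def)

lemma hvec_nth: "hvec Y $ HIdx i j = ((1 - \<i>) * Y $ i $ j + (1 + \<i>) * Y $ j $ i) / 2"
  by (simp add: hvec_def)

lemma hmat_hvec: "hmat (hvec Y) = Y"
  by (simp add: vec_eq_iff hmat_nth hvec_nth field_simps complex_eq_iff)

lemma hvec_hmat: "hvec (hmat u) = u"
  by (simp add: vec_eq_iff all_hidx hmat_nth hvec_nth field_simps complex_eq_iff)

lemma cadjoint_herm: "cadjoint (herm r) = herm r"
  by (simp add: vec_eq_iff herm_def hmat_nth cplx_vec_def complex_eq_iff algebra_simps)

lemma hvec_hermitian:
  assumes "cadjoint Y = Y"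
  shows "hvec Y = cplx_vec (hcoord Y)"
proof -
  have "Im (hvec Y $ HIdx i j) = 0" for i j
  proof -
    have "Y $ j $ i = cnj (Y $ i $ j)" using assms by (metis cadjoint_nth)
    then have "Re (Y $ j $ i) = Re (Y $ i $ j)" "Im (Y $ j $ i) = - Im (Y $ i $ j)" by simp_all
    then show ?thesis by (simp add: hvec_nth)
  qed
  then show ?thesis
    by (simp add: vec_eq_iff all_hidx cplx_vec_def hcoord_def complex_eq_iff)
qed

lemma herm_hcoord: "cadjoint Y = Y \<Longrightarrow> herm (hcoord Y) = Y"
  unfolding herm_def by (metis hvec_hermitian hmat_hvec)

lemma hcoord_herm: "hcoord (herm r) = r"
  by (simp add: hcoord_def herm_def hvec_hmat vec_eq_iff cplx_vec_def)

lemma linear_herm: "linear herm"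
  by (rule linearI)
    (simp_all add: herm_def vec_eq_iff hmat_nth cplx_vec_def complex_eq_iff field_simps)

lemma linear_hcoord: "linear hcoord"
  by (rule linearI) (simp_all add: hcoord_def vec_eq_iff all_hidx hvec_nth field_simps)

lemma bounded_linear_herm: "bounded_linear herm"
  using linear_herm by (rule linear_conv_bounded_linear[THEN iffD1])

lemma bounded_linear_hcoord: "bounded_linear hcoord"
  using linear_hcoord by (rule linear_conv_bounded_linear[THEN iffD1])

subsection \<open>The determinant of a congruence\<close>

text \<open>If a linear family of matrices multiplies in determinant and its trace is \<open>c\<close> times the
  trace, then by Jacobi's formula \<open>det (F A)\<close> and \<open>(det A)\<^sup>c\<close> have the same logarithmic derivative
  along the complex line through \<open>1\<close> and \<open>A\<close>. That line meets the singular matrices in finitely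
  many points only, and the complement of a finite set in the plane is connected.\<close>

lemma det_eq_det_power:
  fixes F :: "complex^'n^'n \<Rightarrow> complex^'k^'k"
  assumes lin: "\<And>A t X. F (A + mat t ** X) = F A + mat t ** F X" and one: "F (mat 1) = mat 1"
    and mult: "\<And>A B. det (F (A ** B)) = det (F A) * det (F B)"
    and tr: "\<And>Y. trace (F Y) = of_nat c * trace Y"
    and A: "invertible A"
  shows "det (F A) = det A ^ c"
proof -
  define X where "X = A - mat 1"
  define L where "L t = mat 1 + mat t ** X" for t
  have L01: "L 0 = mat 1" "L 1 = A" by (simp_all add: L_def X_def)
  obtain p where p: "poly p t = det (L t)" for t
    using det_line_polynomial[of "mat 1" X] unfolding L_def by blast
  define S where "S = - {t. poly p t = 0}"
  have "p \<noteq> 0" using p[of 0] by (auto simp: L01)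
  then have fin: "finite {t. poly p t = 0}" by (rule poly_roots_finite)
  then have S: "open S" "connected S"
    unfolding S_def Compl_eq_Diff_UNIV
    by (auto intro!: connected_open_diff_countable simp: open_Diff finite_imp_closed countable_finite)
  have inv: "invertible (L t)" if "t \<in> S" for t
    using that by (simp add: S_def p invertible_det_nz)
  have d: "((\<lambda>s. det (L s)) has_field_derivative det (L t) * trace (matrix_inv (L t) ** X)) (at t)"
    if "t \<in> S" for t
    using inv[OF that] unfolding L_def by (rule det_line_has_derivative)
  have dF: "((\<lambda>s. det (F (L s))) has_field_derivative
      det (F (L t)) * (of_nat c * trace (matrix_inv (L t) ** X))) (at t)" if t: "t \<in> S" for t
  proof -
    have "det (F (L s)) = det (F (L t)) * det (mat 1 + mat (s - t) ** F (matrix_inv (L t) ** X))" for s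
    proof -
      have "L s = L t ** (mat 1 + mat (s - t) ** (matrix_inv (L t) ** X))"
        using inv[OF t] unfolding L_def by (rule line_factor)
      then show ?thesis by (metis mult lin one)
    qed
    then have "(\<lambda>s. det (F (L s))) = (\<lambda>s. det (F (L t)) * det (mat 1 + mat (s - t) ** F (matrix_inv (L t) ** X)))"
      by (rule ext)
    then show ?thesis by (simp only: tr[symmetric] det_shifted_has_derivative)
  qed
  have D: "((\<lambda>t. det (F (L t)) / det (L t) ^ c) has_field_derivative 0) (at t)" if t: "t \<in> S" for t
  proof -
    have nz: "det (L t) \<noteq> 0" using inv t by (simp add: invertible_det_nz)
    have pw: "((\<lambda>s. det (L s) ^ c) has_field_derivative
        of_nat c * det (L t) ^ c * trace (matrix_inv (L t) ** X)) (at t)"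
      by (rule DERIV_cong[OF DERIV_power[OF d]]) (use t in \<open>cases c; simp add: mult_ac\<close>)+
    show ?thesis
      by (rule DERIV_cong[OF DERIV_divide[OF dF pw]]) (use t nz in auto)
  qed
  have "(\<lambda>t. det (F (L t)) / det (L t) ^ c) constant_on S"
  proof (rule DERIV_zero_connected_constant_on[OF S(2,1) finite.emptyI])
    show "\<forall>t\<in>S - {}. ((\<lambda>t. det (F (L t)) / det (L t) ^ c) has_field_derivative 0) (at t)"
      using D by simp
    show "continuous_on S (\<lambda>t. det (F (L t)) / det (L t) ^ c)"
      using D by (intro continuous_at_imp_continuous_on ballI DERIV_isCont) auto
  qed
  moreover have "0 \<in> S" "1 \<in> S" using A by (simp_all add: S_def p L01 invertible_det_nz)
  ultimately have "det (F (L 1)) / det (L 1) ^ c = det (F (L 0)) / det (L 0) ^ c"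
    unfolding constant_on_def by metis
  then show ?thesis using A by (simp add: L01 one invertible_det_nz)
qed

text \<open>The complex linear extension of a congruence, with the two sides decoupled: left and right
  multiplications commute, and each of them is covered by \<open>det_eq_det_power\<close>.\<close>

definition sandwich :: "complex^'n^'n \<Rightarrow> complex^'n^'n \<Rightarrow> complex^('n::finite) hidx \<Rightarrow> complex^'n hidx" where
  "sandwich A B u = hvec (A ** hmat u ** B)"

lemma hmat_add: "hmat (u + v) = hmat u + hmat v"
  and hmat_scale: "hmat (c *s u) = mat c ** hmat u"
  and hvec_add: "hvec (X + Y) = hvec X + hvec Y"
  and hvec_scale: "hvec (mat c ** X) = c *s hvec X"
  by (simp_all add: vec_eq_iff all_hidx hmat_nth hvec_nth mat_mult_nth field_simps)

lemma linear_sandwich: "Vector_Spaces.linear (*s) (*s) (sandwich A B)"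
proof
  show "sandwich A B (u + v) = sandwich A B u + sandwich A B v" for u v
    by (simp add: sandwich_def hmat_add matrix_distribs hvec_add)
  show "sandwich A B (c *s u) = c *s sandwich A B u" for c u
  proof -
    have "A ** hmat (c *s u) ** B = mat c ** (A ** hmat u ** B)"
      by (metis hmat_scale mat_mult_commute matrix_mul_assoc)
    then show ?thesis by (simp add: sandwich_def hvec_scale)
  qed
qed

lemma sandwich_comp: "matrix (sandwich A B) ** matrix (sandwich A' B') = matrix (sandwich (A ** A') (B' ** B))"
proof -
  have "sandwich A B \<circ> sandwich A' B' = sandwich (A ** A') (B' ** B)"
    by (simp add: fun_eq_iff sandwich_def hmat_hvec matrix_mul_assoc)
  then show ?thesis by (simp add: matrix_compose_gen[OF linear_sandwich linear_sandwich, symmetric])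
qed

lemma sandwich_1: "matrix (sandwich (mat 1) (mat 1)) = (mat 1 :: complex^('n::finite) hidx^'n hidx)"
proof -
  have "sandwich (mat 1) (mat 1) = (id :: complex^'n hidx \<Rightarrow> complex^'n hidx)"
    by (simp add: fun_eq_iff sandwich_def hvec_hmat)
  then show ?thesis by (simp add: matrix_id_mat_1)
qed

lemma hmat_axis: "hmat (axis (HIdx k l) 1) $ i $ j
    = ((1 + \<i>) * (if i = k \<and> j = l then 1 else 0) + (1 - \<i>) * (if j = k \<and> i = l then 1 else 0)) / 2"
  by (auto simp: hmat_nth axis_def)

lemma sum_two_deltas:
  fixes f :: "'n::finite \<Rightarrow> complex"
  shows "(\<Sum>m\<in>UNIV. f m * ((a * (if m = k \<and> P then 1 else 0) + b * (if m = l \<and> Q then 1 else 0)) / 2))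
    = (a * (if P then f k else 0) + b * (if Q then f l else 0)) / 2"
proof -
  have "f m * ((a * (if m = k \<and> P then 1 else 0) + b * (if m = l \<and> Q then 1 else 0)) / 2)
      = (if m = k then (if P then a * f k / 2 else 0) else 0) + (if m = l then (if Q then b * f l / 2 else 0) else 0)"
    for m by (auto simp: field_simps)
  then show ?thesis by (simp add: sum.distrib add_divide_distrib)
qed

lemma trace_sandwich_left: "trace (matrix (sandwich Y (mat 1))) = of_nat CARD('n) * trace Y"
  for Y :: "complex^'n^'n"
proof -
  have e: "(Y ** hmat (axis (HIdx k l) 1)) $ i $ j
      = ((1 + \<i>) * (if j = l then Y $ i $ k else 0) + (1 - \<i>) * (if j = k then Y $ i $ l else 0)) / 2"
    for i j k l :: 'n
    unfolding matrix_mult_nth hmat_axis sum_two_deltas[symmetric] by (intro sum.cong) auto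
  have "matrix (sandwich Y (mat 1)) $ HIdx k l $ HIdx k l = (Y $ k $ k + Y $ l $ l) / 2" for k l :: 'n
    by (simp add: matrix_def sandwich_def hvec_nth e field_simps complex_eq_iff)
  then have "trace (matrix (sandwich Y (mat 1))) = (\<Sum>k\<in>UNIV. \<Sum>l\<in>(UNIV::'n set). (Y $ k $ k + Y $ l $ l) / 2)"
    by (simp only: trace_def sum_hidx)
  also have "\<dots> = of_nat CARD('n) * trace Y"
    by (simp add: add_divide_distrib sum.distrib trace_def flip: sum_divide_distrib sum_distrib_left)
  finally show ?thesis .
qed

lemma trace_sandwich_right: "trace (matrix (sandwich (mat 1) Y)) = of_nat CARD('n) * trace Y"
  for Y :: "complex^'n^'n"
proof -
  have e: "(hmat (axis (HIdx k l) 1) ** Y) $ i $ j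
      = ((1 + \<i>) * (if i = k then Y $ l $ j else 0) + (1 - \<i>) * (if i = l then Y $ k $ j else 0)) / 2"
    for i j k l :: 'n
    unfolding matrix_mult_nth hmat_axis
    using sum_two_deltas[of "\<lambda>m. Y $ m $ j" "1 + \<i>" l "i = k" "1 - \<i>" k "i = l"]
    by (simp only: mult.commute[of _ "Y $ _ $ _"] conj_commute[of "i = k"])
  have "matrix (sandwich (mat 1) Y) $ HIdx k l $ HIdx k l = (Y $ k $ k + Y $ l $ l) / 2" for k l :: 'n
    by (simp add: matrix_def sandwich_def hvec_nth e field_simps complex_eq_iff)
  then have "trace (matrix (sandwich (mat 1) Y)) = (\<Sum>k\<in>UNIV. \<Sum>l\<in>(UNIV::'n set). (Y $ k $ k + Y $ l $ l) / 2)"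
    by (simp only: trace_def sum_hidx)
  also have "\<dots> = of_nat CARD('n) * trace Y"
    by (simp add: add_divide_distrib sum.distrib trace_def flip: sum_divide_distrib sum_distrib_left)
  finally show ?thesis .
qed

lemma det_sandwich:
  fixes A B :: "complex^'n^'n"
  assumes "invertible A" "invertible B"
  shows "det (matrix (sandwich A B)) = det A ^ CARD('n) * det B ^ CARD('n)"
proof -
  have lin: "matrix (sandwich (A + mat t ** X) (mat 1)) = matrix (sandwich A (mat 1)) + mat t ** matrix (sandwich X (mat 1))"
    "matrix (sandwich (mat 1) (A + mat t ** X)) = matrix (sandwich (mat 1) A) + mat t ** matrix (sandwich (mat 1) X)"
    for A X :: "complex^'n^'n" and t
  proof -
    have "hmat u ** (mat t ** X) = mat t ** (hmat u ** X)" "mat t ** X ** hmat u = mat t ** (X ** hmat u)" for u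
      by (simp_all only: matrix_mul_assoc mat_mult_commute[of "hmat u"])
    then show "matrix (sandwich (A + mat t ** X) (mat 1)) = matrix (sandwich A (mat 1)) + mat t ** matrix (sandwich X (mat 1))"
      "matrix (sandwich (mat 1) (A + mat t ** X)) = matrix (sandwich (mat 1) A) + mat t ** matrix (sandwich (mat 1) X)"
      by (simp_all add: vec_eq_iff[of "matrix _"] mat_mult_nth matrix_def sandwich_def matrix_distribs hvec_add hvec_scale)
        (simp_all add: vec_eq_iff mat_mult_nth)
  qed
  have "det (matrix (sandwich A (mat 1))) = det A ^ CARD('n)"
    using assms(1)
    by (rule det_eq_det_power[rotated -1])
      (simp_all add: lin sandwich_1 trace_sandwich_left sandwich_comp flip: det_mul)
  moreover have "det (matrix (sandwich (mat 1) B)) = det B ^ CARD('n)"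
  proof (rule det_eq_det_power[OF _ _ _ _ assms(2)])
    show "det (matrix (sandwich (mat 1) (X ** Y))) = det (matrix (sandwich (mat 1) X)) * det (matrix (sandwich (mat 1) Y))"
      for X Y :: "complex^'n^'n"
      by (subst mult.commute) (simp add: sandwich_comp flip: det_mul)
  qed (simp_all add: lin sandwich_1 trace_sandwich_right)
  ultimately show ?thesis
    by (metis det_mul sandwich_comp matrix_mul_lid matrix_mul_rid)
qed

definition congr :: "complex^'n^'n \<Rightarrow> real^('n::finite) hidx \<Rightarrow> real^'n hidx" where
  "congr A r = hcoord (A ** herm r ** cadjoint A)"

lemma linear_congr: "linear (congr A)"
proof (rule linearI)
  show "congr A (x + y) = congr A x + congr A y" for x y
    by (simp add: congr_def linear_add[OF linear_herm] matrix_distribs linear_add[OF linear_hcoord])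
  show "congr A (c *\<^sub>R x) = c *\<^sub>R congr A x" for c x
    by (simp add: congr_def linear_scale[OF linear_herm] matrix_scalar_ac flip: scalar_matrix_assoc linear_scale[OF linear_hcoord])
qed

lemma det_congr:
  fixes A :: "complex^'n^'n"
  assumes "invertible A"
  shows "\<bar>det (matrix (congr A))\<bar> = norm (det A) ^ (2 * CARD('n))"
proof -
  have "complex_of_real (matrix (congr A) $ x $ y) = matrix (sandwich A (cadjoint A)) $ x $ y" for x y
  proof -
    have ax: "cplx_vec (axis y 1) = axis y 1" by (simp add: cplx_vec_def axis_def vec_eq_iff)
    have "cplx_vec (congr A (axis y 1)) = hvec (A ** herm (axis y 1) ** cadjoint A)"
      unfolding congr_def
      by (rule hvec_hermitian[symmetric]) (simp add: cadjoint_mult cadjoint_herm matrix_mul_assoc)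
    then have "cplx_vec (congr A (axis y 1)) = sandwich A (cadjoint A) (axis y 1)"
      by (simp add: sandwich_def herm_def ax)
    then show ?thesis by (simp add: matrix_def vec_eq_iff cplx_vec_def)
  qed
  then have "complex_of_real (det (matrix (congr A))) = det (matrix (sandwich A (cadjoint A)))"
    by (simp add: det_def)
  then have "\<bar>det (matrix (congr A))\<bar> = norm (det (matrix (sandwich A (cadjoint A))))"
    by (metis norm_of_real real_norm_def)
  also have "\<dots> = norm (det A) ^ (2 * CARD('n))"
    by (simp add: det_sandwich assms invertible_cadjoint det_cadjoint norm_mult norm_power mult_2 power_add)
  finally show ?thesis .
qed

section \<open>The action in the Cayley chart\<close>

text \<open>The Cayley transform carries the form defining \<open>U(n,n)\<close> to a multiple of this skew form, whose
  isotropic graphs \<open>(1, h)\<close> are those of Hermitian \<open>h\<close>.\<close>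

definition siegel_form :: "('n::finite) block_matrix" where
  "siegel_form = block 0 (mat 1) (- mat 1) 0"

definition siegel :: "('n::finite) block_matrix \<Rightarrow> bool" where
  "siegel g \<longleftrightarrow> g ** siegel_form ** cadjoint g = siegel_form"

lemma siegel_iff: "siegel g \<longleftrightarrow>
    blk_a g ** cadjoint (blk_b g) = blk_b g ** cadjoint (blk_a g) \<and>
    blk_c g ** cadjoint (blk_d g) = blk_d g ** cadjoint (blk_c g) \<and>
    blk_a g ** cadjoint (blk_d g) = mat 1 + blk_b g ** cadjoint (blk_c g) \<and>
    blk_d g ** cadjoint (blk_a g) = mat 1 + blk_c g ** cadjoint (blk_b g)"
  unfolding siegel_def block_eq_iff siegel_form_def
  by (auto simp: blk_mult blk_cadjoint matrix_distribs algebra_simps)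

lemma aut_siegel:
  assumes "siegel g"
  shows "aut_p g z ** cadjoint (aut_q g z) - aut_q g z ** cadjoint (aut_p g z) = cadjoint z - z"
proof -
  note rel = assms[unfolded siegel_iff]
  have z: "z ** blk_c g ** cadjoint (blk_d g) = z ** blk_d g ** cadjoint (blk_c g)"
    "z ** blk_d g ** cadjoint (blk_a g) = z + z ** blk_c g ** cadjoint (blk_b g)"
    using rel by (simp_all flip: matrix_mul_assoc add: matrix_add_ldistrib)
  show ?thesis using rel
    by (simp add: aut_p_def aut_q_def cadjoint_add cadjoint_mult matrix_distribs matrix_mul_assoc z)
qed

lemma aut_siegel_hermitian:
  assumes g: "siegel g" and h: "cadjoint h = h"
  shows "aut_p g h ** cadjoint (aut_q g h) = aut_q g h ** cadjoint (aut_p g h)"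
    and "blk_d g ** cadjoint (aut_p g h) = mat 1 + blk_c g ** cadjoint (aut_q g h)"
proof -
  show "aut_p g h ** cadjoint (aut_q g h) = aut_q g h ** cadjoint (aut_p g h)"
    using aut_siegel[OF g, of h] h by simp
  note rel = g[unfolded siegel_iff]
  show "blk_d g ** cadjoint (aut_p g h) = mat 1 + blk_c g ** cadjoint (aut_q g h)" using rel
    by (simp add: aut_p_def aut_q_def cadjoint_add cadjoint_mult matrix_distribs matrix_mul_assoc h)
qed

lemma moebius_siegel:
  assumes g: "siegel g" and h: "cadjoint h = h" and inv: "invertible (aut_p g h)"
  shows "moebius h g = cadjoint (aut_q g h) ** cadjoint (matrix_inv (aut_p g h))"
    and "cadjoint (moebius h g) = moebius h g"
    and "blk_d g - blk_c g ** moebius h g = cadjoint (matrix_inv (aut_p g h))"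
proof -
  let ?p = "aut_p g h" and ?q = "aut_q g h"
  have pp: "cadjoint ?p ** cadjoint (matrix_inv ?p) = mat 1"
    by (metis cadjoint_mat_1 cadjoint_mult inv matrix_inv_left)
  have "?p ** (cadjoint ?q ** cadjoint (matrix_inv ?p)) = ?q ** (cadjoint ?p ** cadjoint (matrix_inv ?p))"
    by (simp add: matrix_mul_assoc aut_siegel_hermitian(1)[OF g h])
  then show m: "moebius h g = cadjoint ?q ** cadjoint (matrix_inv ?p)"
    by (simp add: moebius_eq pp matrix_mult_eq_iff[OF inv])
  show "cadjoint (moebius h g) = moebius h g"
    by (simp only: m cadjoint_mult cadjoint_cadjoint) (simp only: m[symmetric] moebius_eq)
  have "cadjoint (matrix_inv ?p) = (blk_d g ** cadjoint ?p - blk_c g ** cadjoint ?q) ** cadjoint (matrix_inv ?p)"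
    by (simp add: aut_siegel_hermitian(2)[OF g h])
  also have "\<dots> = blk_d g ** (cadjoint ?p ** cadjoint (matrix_inv ?p)) - blk_c g ** moebius h g"
    by (simp add: m matrix_diff_rdistrib matrix_mul_assoc)
  finally show "blk_d g - blk_c g ** moebius h g = cadjoint (matrix_inv ?p)" by (simp add: pp)
qed

text \<open>An exact formula for the increment of a fractional linear map; its derivative is then a matter
  of the continuity of the inverse.\<close>

lemma moebius_diff:
  assumes g: "siegel g" and h: "cadjoint h = h"
    and inv: "invertible (aut_p g h)" and inv': "invertible (aut_p g k)"
  shows "moebius k g - moebius h g
    = matrix_inv (aut_p g k) ** (k - h) ** cadjoint (matrix_inv (aut_p g h))"
proof -
  have pk: "aut_p g k = aut_p g h + (k - h) ** blk_c g" "aut_q g k = aut_q g h + (k - h) ** blk_d g"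
    by (simp_all add: aut_p_def aut_q_def matrix_diff_rdistrib)
  have "aut_p g k ** (moebius k g - moebius h g) = aut_q g k - aut_p g k ** moebius h g"
    by (simp add: matrix_diff_ldistrib aut_p_moebius inv')
  also have "\<dots> = (k - h) ** (blk_d g - blk_c g ** moebius h g)"
    by (simp add: pk matrix_diff_ldistrib matrix_add_rdistrib aut_p_moebius[OF inv] matrix_mul_assoc)
  finally have "moebius k g - moebius h g = matrix_inv (aut_p g k) ** ((k - h) ** (blk_d g - blk_c g ** moebius h g))"
    by (metis inv' matrix_mult_eq_iff)
  then show ?thesis by (simp only: moebius_siegel(3)[OF g h inv] matrix_mul_assoc)
qed

text \<open>At the point \<open>h + \<i>\<close> of the Siegel upper half plane the invariant form of the rows of \<open>(p, q)\<close> is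
  the definite matrix \<open>-2\<i>\<close>, so \<open>p\<close> has no kernel.\<close>

lemma invertible_aut_p_siegel:
  assumes g: "siegel g" and h: "cadjoint h = h"
  shows "invertible (aut_p g (h + mat \<i>))"
  unfolding invertible_iff_row_kernel
proof (intro allI impI)
  let ?z = "h + mat \<i>"
  fix v assume v: "v v* aut_p g ?z = 0"
  have "row_herm v (v v* (aut_p g ?z ** cadjoint (aut_q g ?z) - aut_q g ?z ** cadjoint (aut_p g ?z)))
      = row_herm v (v v* aut_p g ?z v* cadjoint (aut_q g ?z)) - row_herm v (v v* aut_q g ?z v* cadjoint (aut_p g ?z))"
    by (simp add: vector_matrix_mult_diff_rdistrib vector_matrix_mul_assoc row_herm_def
        right_diff_distrib sum_subtractf)
  also have "\<dots> = row_herm v 0 - row_herm (v v* aut_p g ?z) (v v* aut_q g ?z)"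
    unfolding row_herm_adjoint by (simp add: v)
  also have "\<dots> = 0" by (simp add: v) (simp add: row_herm_def)
  finally have "row_herm v (v v* (cadjoint ?z - ?z)) = 0" by (simp only: aut_siegel[OF g])
  also have "cadjoint ?z - ?z = mat (- 2 * \<i>)"
    by (simp add: cadjoint_add h cadjoint_mat vec_eq_iff) (simp add: mat_def)
  also have "row_herm v (v v* mat (- 2 * \<i>)) = 2 * \<i> * row_herm v v"
    by (simp add: row_herm_def vector_matrix_mult_nth mat_def if_distrib sum_distrib_left mult_ac cong: if_cong)
  finally show "v = 0" by (simp add: row_herm_self)
qed

subsection \<open>The Cayley transform\<close>

definition cayley :: "('n::finite) block_matrix" where
  "cayley = block (mat 1) (mat 1) (mat (- \<i>)) (mat \<i>)"

definition cayley_inv :: "('n::finite) block_matrix" where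
  "cayley_inv = block (mat (1/2)) (mat (\<i>/2)) (mat (1/2)) (mat (- \<i>/2))"

lemma cayley_cayley_inv:
  "cayley ** cayley_inv = (mat 1 :: ('n::finite) block_matrix)"
  "cayley_inv ** cayley = (mat 1 :: 'n block_matrix)"
proof -
  show *: "cayley ** cayley_inv = (mat 1 :: 'n block_matrix)"
    by (simp add: cayley_def cayley_inv_def block_eq_iff blk_mult blk_mat_1 mat_mult_mat flip: mat_add)
  show "cayley_inv ** cayley = (mat 1 :: 'n block_matrix)"
    by (rule matrix_left_right_inverse[THEN iffD1, OF *])
qed

lemma blk_mat_mult:
  "blk_a (mat c ** g) = mat c ** blk_a g" "blk_b (mat c ** g) = mat c ** blk_b g"
  "blk_c (mat c ** g) = mat c ** blk_c g" "blk_d (mat c ** g) = mat c ** blk_d g"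
  by (simp_all add: vec_eq_iff blk_defs mat_mult_nth)

lemma cayley_form: "cayley ** J_form ** cadjoint cayley = mat (2 * \<i>) ** siegel_form"
  unfolding block_eq_iff blk_mat_mult
  by (simp add: blk_mult blk_cadjoint blk_J_form cayley_def siegel_form_def
      cadjoint_mat mat_mult_mat matrix_distribs)
    (simp add: vec_eq_iff mat_def)

definition cay :: "('n::finite) block_matrix \<Rightarrow> 'n block_matrix" where
  "cay g = cayley ** g ** cayley_inv"

lemma cay_mult: "cay g ** cay h = cay (g ** h)"
proof -
  have "cay g ** cay h = cayley ** g ** (cayley_inv ** cayley) ** h ** cayley_inv"
    by (simp add: cay_def matrix_mul_assoc)
  then show ?thesis by (simp add: cayley_cayley_inv cay_def matrix_mul_assoc)
qed

lemma cay_mat_1: "cay (mat 1) = mat 1"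
  by (simp add: cay_def cayley_cayley_inv)

lemma cay_cayley: "cay g ** cayley = cayley ** g"
  by (simp add: cay_def cayley_cayley_inv flip: matrix_mul_assoc)

lemma siegel_cay:
  assumes "g \<in> Unn"
  shows "siegel (cay g)"
proof -
  have "mat (2 * \<i>) ** (cay g ** siegel_form ** cadjoint (cay g))
      = cay g ** (mat (2 * \<i>) ** siegel_form) ** cadjoint (cay g)"
    by (simp only: matrix_mul_assoc mat_mult_commute[of "cay g"])
  also have "\<dots> = (cay g ** cayley) ** J_form ** cadjoint (cay g ** cayley)"
    by (simp add: cayley_form[symmetric] cadjoint_mult matrix_mul_assoc)
  also have "\<dots> = cayley ** (g ** J_form ** cadjoint g) ** cadjoint cayley"
    by (simp add: cay_cayley cadjoint_mult matrix_mul_assoc)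
  also have "\<dots> = mat (2 * \<i>) ** siegel_form"
    using assms by (simp add: Unn_def cayley_form)
  finally have "mat (1 / (2 * \<i>)) ** (mat (2 * \<i>) ** (cay g ** siegel_form ** cadjoint (cay g)))
      = mat (1 / (2 * \<i>)) ** (mat (2 * \<i>) ** siegel_form)" by simp
  then show ?thesis by (simp add: matrix_mul_assoc mat_mult_mat siegel_def)
qed

lemma
  assumes h: "cadjoint h = h"
  shows invertible_cayley: "invertible (aut_p cayley h)"
    and cayley_unitary: "moebius h cayley \<in> unitary_group"
proof -
  have p: "aut_p cayley h = mat 1 + h ** mat (- \<i>)" and q: "aut_q cayley h = mat 1 + h ** mat \<i>"
    by (simp_all add: aut_p_def aut_q_def cayley_def)
  have m: "mat (- \<i>) ** h = - (mat \<i> ** h)" "h ** mat (- \<i>) = - (mat \<i> ** h)" "h ** mat \<i> = mat \<i> ** h"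
    by (simp_all add: vec_eq_iff mat_mult_nth mult_mat_nth)
  have sq: "mat \<i> ** h ** mat \<i> ** h = - (h ** h)" "mat \<i> ** h ** (mat \<i> ** h) = - (h ** h)"
  proof -
    have "mat \<i> ** h ** (mat \<i> ** h) = mat \<i> ** (h ** mat \<i>) ** h" by (simp only: matrix_mul_assoc)
    also have "\<dots> = mat (\<i> * \<i>) ** (h ** h)" by (simp only: m(3) matrix_mul_assoc mat_mult_mat)
    finally show "mat \<i> ** h ** (mat \<i> ** h) = - (h ** h)" by (simp add: mat_uminus matrix_minus_left)
    then show "mat \<i> ** h ** mat \<i> ** h = - (h ** h)" by (simp only: matrix_mul_assoc)
  qed
  have pp: "aut_p cayley h ** cadjoint (aut_p cayley h) = mat 1 + h ** h"
    and qq: "aut_q cayley h ** cadjoint (aut_q cayley h) = mat 1 + h ** h"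
    by (simp_all add: p q cadjoint_add cadjoint_diff cadjoint_mult cadjoint_uminus cadjoint_mat h m matrix_distribs sq)
  show inv: "invertible (aut_p cayley h)"
    unfolding invertible_iff_row_kernel
  proof (intro allI impI)
    fix v assume "v v* aut_p cayley h = 0"
    moreover have "(norm (v v* aut_p cayley h))\<^sup>2 = (norm (v v* mat 1))\<^sup>2 + (norm (v v* h))\<^sup>2"
      by (rule norm_row_gram) (simp add: pp h)
    ultimately show "v = 0" by (simp add: add_nonneg_eq_0_iff)
  qed
  show "moebius h cayley \<in> unitary_group"
    unfolding moebius_eq by (rule moebius_gram[OF inv]) (simp add: pp qq)
qed

definition chart :: "real^('n::finite) hidx \<Rightarrow> complex^'n^'n" where
  "chart r = moebius (herm r) cayley"

lemma chart_unitary: "chart r \<in> unitary_group"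
  unfolding chart_def by (rule cayley_unitary[OF cadjoint_herm])

text \<open>A left inverse is the action of the inverse Cayley matrix.\<close>

lemma inj_chart: "inj chart"
proof (rule inj_on_inverseI)
  fix r :: "real^('n::finite) hidx"
  have inv: "invertible (aut_p cayley (herm r))" by (rule invertible_cayley[OF cadjoint_herm])
  have "aut_p cayley (herm r) ** aut_p cayley_inv (chart r) = mat 1"
    unfolding chart_def using aut_p_cocycle(1)[OF inv, of cayley_inv]
    by (simp add: cayley_cayley_inv aut_p_def blk_mat_1)
  then have "invertible (aut_p cayley_inv (moebius (herm r) cayley))"
    using invertible_left_inverse chart_def by metis
  then have "moebius (chart r) cayley_inv = herm r"
    unfolding chart_def using moebius_mult[OF inv, of cayley_inv]
    by (simp add: cayley_cayley_inv moebius_mat_1)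
  then show "hcoord (moebius (chart r) cayley_inv) = r" by (simp add: hcoord_herm)
qed

subsection \<open>The action in coordinates\<close>

definition chart_aut :: "('n::finite) block_matrix \<Rightarrow> real^'n hidx \<Rightarrow> complex^'n^'n" where
  "chart_aut g r = aut_p (cay g) (herm r)"

text \<open>The Hermitian matrices whose image under the action is again in the chart.\<close>

definition chart_dom :: "('n::finite) block_matrix \<Rightarrow> (real^'n hidx) set" where
  "chart_dom g = {r. invertible (chart_aut g r)}"

definition chart_map :: "('n::finite) block_matrix \<Rightarrow> real^'n hidx \<Rightarrow> real^'n hidx" where
  "chart_map g r = hcoord (moebius (herm r) (cay g))"

lemma herm_chart_map:
  assumes "g \<in> Unn" "r \<in> chart_dom g"
  shows "herm (chart_map g r) = moebius (herm r) (cay g)"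
  unfolding chart_map_def
  by (intro herm_hcoord moebius_siegel(2) siegel_cay cadjoint_herm)
    (use assms in \<open>simp_all add: chart_dom_def chart_aut_def\<close>)

lemma chart_map_inverse:
  assumes g: "g \<in> Unn" and gh: "g ** h = mat 1" and r: "r \<in> chart_dom g"
  shows "chart_map g r \<in> chart_dom h" "chart_map h (chart_map g r) = r"
proof -
  have inv: "invertible (aut_p (cay g) (herm r))" using r by (simp add: chart_dom_def chart_aut_def)
  have "aut_p (cay g) (herm r) ** aut_p (cay h) (moebius (herm r) (cay g)) = mat 1"
    using aut_p_cocycle(1)[OF inv, of "cay h"] by (simp add: cay_mult gh cay_mat_1 aut_p_def blk_mat_1)
  then have inv': "invertible (aut_p (cay h) (moebius (herm r) (cay g)))"
    using invertible_left_inverse by metis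
  then show "chart_map g r \<in> chart_dom h"
    by (simp only: chart_dom_def mem_Collect_eq chart_aut_def herm_chart_map[OF g r])
  have "moebius (moebius (herm r) (cay g)) (cay h) = herm r"
    using moebius_mult[OF inv inv'] by (simp add: cay_mult gh cay_mat_1 moebius_mat_1)
  then show "chart_map h (chart_map g r) = r"
    by (simp add: chart_map_def[of h] herm_chart_map g r hcoord_herm)
qed

text \<open>Both sides of \<open>cayley ** g = cay g ** cayley\<close> act on the frame \<open>(1, h)\<close>.\<close>

lemma chart_moebius:
  assumes g: "g \<in> Unn" and r: "r \<in> chart_dom g"
  shows "moebius (chart r) g = chart (chart_map g r)"
    and "det (aut_p cayley (herm r)) * det (aut_p g (chart r))
      = det (chart_aut g r) * det (aut_p cayley (herm (chart_map g r)))"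
proof -
  have inv: "invertible (aut_p cayley (herm r))" by (rule invertible_cayley[OF cadjoint_herm])
  have inv2: "invertible (aut_p g (chart r))"
    by (intro invertible_aut_p g unitary_contraction chart_unitary)
  have inv3: "invertible (aut_p (cay g) (herm r))" using r by (simp add: chart_dom_def chart_aut_def)
  have inv4: "invertible (aut_p cayley (moebius (herm r) (cay g)))"
    by (metis herm_chart_map[OF g r] invertible_cayley cadjoint_herm)
  have "moebius (chart r) g = moebius (herm r) (cayley ** g)"
    using moebius_mult[OF inv inv2[unfolded chart_def]] by (simp add: chart_def)
  also have "\<dots> = chart (chart_map g r)"
    using moebius_mult[OF inv3 inv4] by (simp add: chart_def cay_cayley herm_chart_map g r)
  finally show "moebius (chart r) g = chart (chart_map g r)" .
  have "aut_p cayley (herm r) ** aut_p g (chart r) = aut_p (cayley ** g) (herm r)"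
    using aut_p_cocycle(1)[OF inv, of g] by (simp add: chart_def)
  also have "\<dots> = chart_aut g r ** aut_p cayley (herm (chart_map g r))"
    using aut_p_cocycle(1)[OF inv3, of cayley] by (simp add: cay_cayley chart_aut_def herm_chart_map g r)
  finally show "det (aut_p cayley (herm r)) * det (aut_p g (chart r))
      = det (chart_aut g r) * det (aut_p cayley (herm (chart_map g r)))"
    by (metis det_mul)
qed

lemma tendsto_herm: "(f \<longlongrightarrow> r) F \<Longrightarrow> ((\<lambda>x. herm (f x)) \<longlongrightarrow> herm r) F"
  by (rule bounded_linear.tendsto[OF bounded_linear_herm])

lemma tendsto_chart_aut: "(f \<longlongrightarrow> r) F \<Longrightarrow> ((\<lambda>x. chart_aut g (f x)) \<longlongrightarrow> chart_aut g r) F"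
  unfolding chart_aut_def by (intro tendsto_aut tendsto_herm tendsto_const)

lemma open_chart_dom: "open (chart_dom g)"
proof -
  have "continuous_on UNIV (\<lambda>r. det (chart_aut g r))"
    unfolding continuous_on_def by (intro ballI tendsto_det tendsto_chart_aut tendsto_ident_at)
  then have "open {r. det (chart_aut g r) \<noteq> 0}"
    by (intro open_Collect_neq continuous_on_const)
  then show ?thesis by (simp add: chart_dom_def invertible_det_nz)
qed

lemma chart_map_has_derivative:
  assumes g: "g \<in> Unn" and r: "r \<in> chart_dom g"
  shows "(chart_map g has_derivative congr (matrix_inv (chart_aut g r))) (at r)"
proof -
  let ?p = "\<lambda>s. matrix_inv (chart_aut g s)"
  let ?E = "\<lambda>s. hcoord ((?p s - ?p r) ** herm (s - r) ** cadjoint (?p r))"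
  have inv: "invertible (chart_aut g r)" using r by (simp add: chart_dom_def)
  have diff: "chart_map g s - chart_map g r - congr (?p r) (s - r) = ?E s" if "s \<in> chart_dom g" for s
  proof -
    have "chart_map g s - chart_map g r = hcoord (moebius (herm s) (cay g) - moebius (herm r) (cay g))"
      by (simp add: chart_map_def linear_diff[OF linear_hcoord])
    also have "\<dots> = hcoord (?p s ** herm (s - r) ** cadjoint (?p r))"
      using that r by (subst moebius_diff[OF siegel_cay[OF g] cadjoint_herm])
        (simp_all add: chart_dom_def chart_aut_def linear_diff[OF linear_herm])
    finally show ?thesis
      by (simp add: congr_def matrix_diff_rdistrib linear_diff[OF linear_hcoord])
  qed
  obtain K1 where K1: "\<And>Y. norm (hcoord Y :: real^'a hidx) \<le> norm Y * K1" "K1 > 0"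
    using bounded_linear.pos_bounded[OF bounded_linear_hcoord] by blast
  obtain K2 where K2: "\<And>k :: real^'a hidx. norm (herm k) \<le> norm k * K2" "K2 > 0"
    using bounded_linear.pos_bounded[OF bounded_linear_herm] by blast
  define N where "N = real (CARD('a) * CARD('a))"
  define n where "n = real CARD('a)"
  define C where "C = N * n * K2 * rnorm (cadjoint (?p r)) * K1"
  have N: "N \<ge> 0" "n \<ge> 0" by (simp_all add: N_def n_def)
  have bound: "norm (?E s) \<le> rnorm (?p s - ?p r) * C * norm (s - r)" for s
  proof -
    have "rnorm ((?p s - ?p r) ** herm (s - r) ** cadjoint (?p r))
        \<le> rnorm (?p s - ?p r) * rnorm (herm (s - r)) * rnorm (cadjoint (?p r))"
      by (meson mult_right_mono order_trans rnorm_mult rnorm_nonneg)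
    also have "\<dots> \<le> rnorm (?p s - ?p r) * (n * (norm (s - r) * K2)) * rnorm (cadjoint (?p r))"
    proof (intro mult_right_mono mult_left_mono rnorm_nonneg)
      have "rnorm (herm (s - r)) \<le> n * norm (herm (s - r))" unfolding n_def by (rule rnorm_le_norm)
      also have "\<dots> \<le> n * (norm (s - r) * K2)" by (intro mult_left_mono K2 N)
      finally show "rnorm (herm (s - r)) \<le> n * (norm (s - r) * K2)" .
    qed
    finally have "N * rnorm ((?p s - ?p r) ** herm (s - r) ** cadjoint (?p r))
        \<le> N * (rnorm (?p s - ?p r) * (n * (norm (s - r) * K2)) * rnorm (cadjoint (?p r)))"
      using N by (intro mult_left_mono)
    then have "norm ((?p s - ?p r) ** herm (s - r) ** cadjoint (?p r))
        \<le> N * (rnorm (?p s - ?p r) * (n * (norm (s - r) * K2)) * rnorm (cadjoint (?p r)))"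
      using norm_le_rnorm[of "(?p s - ?p r) ** herm (s - r) ** cadjoint (?p r)"] unfolding N_def by linarith
    then have "norm ((?p s - ?p r) ** herm (s - r) ** cadjoint (?p r)) * K1
        \<le> N * (rnorm (?p s - ?p r) * (n * (norm (s - r) * K2)) * rnorm (cadjoint (?p r))) * K1"
      by (rule mult_right_mono[OF _ less_imp_le[OF K1(2)]])
    with K1(1) have "norm (?E s) \<le> N * (rnorm (?p s - ?p r) * (n * (norm (s - r) * K2)) * rnorm (cadjoint (?p r))) * K1"
      by (rule order_trans)
    then show ?thesis by (simp add: C_def mult_ac)
  qed
  have "((\<lambda>s. ?p s) \<longlongrightarrow> ?p r) (at r)"
    by (intro tendsto_matrix_inv tendsto_chart_aut inv tendsto_ident_at)
  then have "((\<lambda>s. rnorm (?p s - ?p r)) \<longlongrightarrow> rnorm (?p r - ?p r)) (at r)"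
    by (intro tendsto_rnorm tendsto_diff tendsto_const)
  moreover have "rnorm (?p r - ?p r) = 0" using rnorm_mat_mult[of 0 "?p r"] by simp
  ultimately have lim: "((\<lambda>s. rnorm (?p s - ?p r) * C) \<longlongrightarrow> 0) (at r)"
    by (auto intro: tendsto_mult_left_zero)
  have ev: "\<forall>\<^sub>F s in at r. s \<in> chart_dom g"
    using eventually_at_topological open_chart_dom r by blast
  have "((\<lambda>s. norm (chart_map g s - chart_map g r - congr (?p r) (s - r)) / norm (s - r)) \<longlongrightarrow> 0) (at r)"
  proof (rule Lim_null_comparison[OF _ lim])
    show "\<forall>\<^sub>F s in at r. norm (norm (chart_map g s - chart_map g r - congr (?p r) (s - r)) / norm (s - r))
        \<le> rnorm (?p s - ?p r) * C"
      using ev eventually_neq_at_within[of r r UNIV]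
    proof eventually_elim
      case (elim s)
      have "norm (?E s) / norm (s - r) \<le> rnorm (?p s - ?p r) * C"
        using bound[of s] elim(2) by (simp add: divide_le_eq)
      then show ?case by (simp only: diff[OF elim(1)] real_norm_def abs_divide abs_norm_cancel)
    qed
  qed
  then show ?thesis
    unfolding has_derivative_iff_norm
    using linear_congr by (simp add: linear_conv_bounded_linear)
qed

section \<open>Haar measure in the Cayley chart\<close>

subsection \<open>Measurability\<close>

lemma borel_measurable_tendsto:
  fixes f :: "'a::topological_space \<Rightarrow> 'b::topological_space"
  assumes "\<And>x. (f \<longlongrightarrow> f x) (at x)"
  shows "f \<in> borel_measurable borel"
  by (rule borel_measurable_continuous_onI) (simp add: continuous_on_def assms)

lemma borel_measurable_matrix_mult [measurable (raw)]:
  fixes f :: "'x \<Rightarrow> complex^'n^'m" and g :: "'x \<Rightarrow> complex^'p^'n"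
  assumes "f \<in> borel_measurable M" "g \<in> borel_measurable M"
  shows "(\<lambda>x. f x ** g x) \<in> borel_measurable M"
proof (rule borel_measurable_continuous_Pair[OF assms])
  show "continuous_on UNIV (\<lambda>x :: (complex^'n^'m) \<times> (complex^'p^'n). fst x ** snd x)"
    unfolding continuous_on_def by (intro ballI tendsto_matrix_mult tendsto_fst tendsto_snd tendsto_ident_at)
qed

lemma borel_measurable_det [measurable]: "(det :: complex^'n^'n \<Rightarrow> complex) \<in> borel_measurable borel"
  by (intro borel_measurable_tendsto tendsto_det tendsto_ident_at)

lemma borel_measurable_matrix_inv [measurable]:
  "(matrix_inv :: complex^'n^'n \<Rightarrow> complex^'n^'n) \<in> borel_measurable borel"
proof -
  let ?S = "{A :: complex^'n^'n. invertible A}"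
  have "continuous_on UNIV (det :: complex^'n^'n \<Rightarrow> complex)"
    unfolding continuous_on_def by (intro ballI tendsto_det tendsto_ident_at)
  then have "open ?S"
    unfolding invertible_det_nz by (intro open_Collect_neq continuous_on_const)
  moreover have "continuous_on ?S matrix_inv"
    unfolding continuous_on_def by (auto intro!: tendsto_matrix_inv tendsto_ident_at)
  ultimately have "(\<lambda>A. if A \<in> ?S then matrix_inv A else (SOME B. False)) \<in> borel_measurable borel"
    by (intro borel_measurable_continuous_on_if) auto
  \<comment> \<open>On singular matrices the inverse is an arbitrary but fixed matrix.\<close>
  moreover have "(\<lambda>A. if A \<in> ?S then matrix_inv A else (SOME B. False)) = matrix_inv"
  proof
    fix A :: "complex^'n^'n"
    have "(SOME B. False) = matrix_inv A" if "\<not> invertible A"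
    proof -
      have "(\<lambda>B. A ** B = mat 1 \<and> B ** A = mat 1) = (\<lambda>B. False)"
        using that by (auto simp: invertible_def)
      then show ?thesis by (simp only: matrix_inv_def)
    qed
    then show "(if A \<in> ?S then matrix_inv A else (SOME B. False)) = matrix_inv A" by auto
  qed
  ultimately show ?thesis by simp
qed

lemma borel_measurable_herm [measurable]: "herm \<in> borel_measurable borel"
  by (intro borel_measurable_tendsto tendsto_herm tendsto_ident_at)

lemma borel_measurable_hcoord [measurable]: "hcoord \<in> borel_measurable borel"
  by (intro borel_measurable_tendsto bounded_linear.tendsto[OF bounded_linear_hcoord] tendsto_ident_at)

lemma borel_measurable_aut [measurable]:
  "aut_p g \<in> borel_measurable borel" "aut_q g \<in> borel_measurable borel"
  by (intro borel_measurable_tendsto tendsto_aut tendsto_ident_at tendsto_const)+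

lemma borel_measurable_moebius [measurable]: "(\<lambda>z. moebius z g) \<in> borel_measurable borel"
  unfolding moebius_eq by measurable

lemma borel_measurable_chart [measurable]: "chart \<in> borel_measurable borel"
  unfolding chart_def by measurable

lemma borel_measurable_chart_aut [measurable]: "chart_aut g \<in> borel_measurable borel"
  unfolding chart_aut_def by measurable

lemma borel_measurable_chart_map [measurable]: "chart_map g \<in> borel_measurable borel"
  unfolding chart_map_def by measurable

subsection \<open>The singular set of the action in coordinates\<close>

text \<open>On every line \<open>h + t\<close> the singular set is given by a polynomial in \<open>t\<close>, which does not vanish
  at \<open>t = \<i>\<close>.\<close>

lemma finite_singular_line:
  assumes g: "g \<in> Unn"
  shows "finite {t :: real. r + t *\<^sub>R hcoord (mat 1) \<notin> chart_dom g}"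
proof -
  obtain p where p: "poly p t = det (aut_p (cay g) (herm r) + mat t ** blk_c (cay g))" for t
    using det_line_polynomial by blast
  have "poly p \<i> = det (aut_p (cay g) (herm r + mat \<i>))"
    by (simp add: p aut_p_def matrix_add_rdistrib algebra_simps)
  then have "poly p \<i> \<noteq> 0"
    using invertible_aut_p_siegel[OF siegel_cay[OF g] cadjoint_herm] by (simp add: invertible_det_nz)
  then have "p \<noteq> 0" by auto
  then have fin: "finite {t. poly p t = 0}" by (rule poly_roots_finite)
  have "herm (r + t *\<^sub>R hcoord (mat 1)) = herm r + mat (of_real t)" for t
    by (simp add: linear_add[OF linear_herm] linear_scale[OF linear_herm] herm_hcoord vec_eq_iff)
      (simp add: mat_def scaleR_conv_of_real)
  then have "r + t *\<^sub>R hcoord (mat 1) \<notin> chart_dom g \<longleftrightarrow> poly p (of_real t) = 0" for t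
    by (simp add: chart_dom_def chart_aut_def invertible_det_nz p aut_p_def matrix_add_rdistrib algebra_simps)
  then have "{t. r + t *\<^sub>R hcoord (mat 1) \<notin> chart_dom g} = complex_of_real -` {t. poly p t = 0}"
    by auto
  then show ?thesis by (simp only: finite_vimageI[OF fin inj_of_real])
qed

text \<open>Translation invariance of Lebesgue measure and Fubini's theorem reduce the claim to lines \<open>h + t\<close>.\<close>

lemma chart_dom_conull:
  assumes g: "g \<in> Unn"
  shows "emeasure lborel (- chart_dom g) = 0"
proof -
  let ?N = "- chart_dom g" and ?e = "hcoord (mat 1 :: complex^'a^'a)"
  let ?F = "\<lambda>(t, r). indicator {0..1} t * indicator ?N (r + t *\<^sub>R ?e) :: ennreal"
  have [measurable]: "chart_dom g \<in> sets borel" using open_chart_dom by (rule borel_open)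
  have meas: "?F \<in> borel_measurable (lborel \<Otimes>\<^sub>M lborel)" by measurable
  have trans: "(\<integral>\<^sup>+r. indicator ?N (r + c) \<partial>lborel) = emeasure lborel ?N" for c
  proof -
    have "(\<integral>\<^sup>+r. indicator ?N (r + c) \<partial>lborel) = (\<integral>\<^sup>+r. indicator ?N r \<partial>distr lborel borel ((+) c))"
      by (subst nn_integral_distr) (simp_all add: add.commute)
    then show ?thesis by (simp add: lborel_distr_plus)
  qed
  have "emeasure lborel ?N = (\<integral>\<^sup>+t. indicator {0..1::real} t * emeasure lborel ?N \<partial>lborel)"
    by (simp add: nn_integral_multc)
  also have "\<dots> = (\<integral>\<^sup>+t. (\<integral>\<^sup>+r. ?F (t, r) \<partial>lborel) \<partial>lborel)"
    by (simp add: nn_integral_cmult trans)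
  also have "\<dots> = (\<integral>\<^sup>+r. (\<integral>\<^sup>+t. ?F (t, r) \<partial>lborel) \<partial>lborel)"
    by (rule lborel_pair.Fubini'[symmetric]) (use meas in simp)
  also have "\<dots> = (\<integral>\<^sup>+r. 0 \<partial>(lborel :: (real^'a hidx) measure))"
  proof (intro nn_integral_cong)
    fix r
    let ?T = "{t. r + t *\<^sub>R ?e \<notin> chart_dom g}"
    have fin: "finite ?T" by (rule finite_singular_line[OF g])
    have "(\<integral>\<^sup>+t. ?F (t, r) \<partial>lborel) \<le> (\<integral>\<^sup>+t. indicator ?T t \<partial>lborel)"
      by (intro nn_integral_mono) (auto simp: indicator_def)
    also have "\<dots> = emeasure lborel ?T"
      using fin by (intro nn_integral_indicator) (simp add: borel_closed finite_imp_closed)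
    also have "\<dots> = 0" using fin by (intro emeasure_lborel_countable countable_finite)
    finally show "(\<integral>\<^sup>+t. ?F (t, r) \<partial>lborel) = 0" by simp
  qed
  finally show ?thesis by simp
qed

subsection \<open>Change of variables for nonnegative functions\<close>

text \<open>On bounded sets the image has finite measure and the change of variables formula for measures
  applies; the general case follows by exhaustion.\<close>

lemma emeasure_change_of_variables:
  fixes f :: "real^'k::{finite,wellorder} \<Rightarrow> real^'k::_"
  assumes D [measurable]: "D \<in> sets borel" and D' [measurable]: "D' \<in> sets borel"
    and f [measurable]: "f \<in> borel_measurable borel"
    and J [measurable]: "J \<in> borel_measurable borel"
    and der: "\<And>x. x \<in> D \<Longrightarrow> (f has_derivative f' x) (at x)"
    and det: "\<And>x. x \<in> D \<Longrightarrow> J x = \<bar>det (matrix (f' x))\<bar>"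
    and bij: "bij_betw f D D'"
    and E [measurable]: "E \<in> sets borel"
  shows "(\<integral>\<^sup>+x. indicator D x * ennreal (J x) * indicator E (f x) \<partial>lborel) = emeasure lborel (D' \<inter> E)"
proof -
  have bounded: "(\<integral>\<^sup>+x. indicator D x * ennreal (J x) * indicator B (f x) \<partial>lborel) = emeasure lborel (D' \<inter> B)"
    if B [measurable]: "B \<in> sets borel" and bd: "bounded B" for B
  proof -
    let ?S = "D \<inter> f -` B"
    have S: "?S \<in> sets borel"
      using measurable_sets[OF f B] by (intro sets.Int D) simp
    have img: "f ` ?S = D' \<inter> B" using bij by (auto simp: bij_betw_def)
    have inj: "inj_on f ?S" using bij by (auto simp: bij_betw_def intro: inj_on_subset)
    have fin: "emeasure lborel (D' \<inter> B) < \<infinity>"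
      by (rule emeasure_bounded_finite) (use bd in \<open>auto intro: bounded_subset\<close>)
    have DB: "D' \<inter> B \<in> sets borel" by measurable
    have "f ` ?S \<in> lmeasurable"
      unfolding img by (rule fmeasurableI) (use fin DB in \<open>simp_all add: sets_completionI_sets\<close>)
    then have "((\<lambda>x. \<bar>det (matrix (f' x))\<bar>) has_integral measure lebesgue (f ` ?S)) ?S"
      using has_measure_differentiable_image[where S="?S" and f=f and f'=f'] S inj der
      by (auto intro: has_derivative_at_withinI)
    then have "(J has_integral measure lebesgue (f ` ?S)) ?S"
      by (rule has_integral_eq[rotated]) (simp add: det)
    then have int: "((\<lambda>x. if x \<in> ?S then J x else 0) has_integral measure lebesgue (f ` ?S)) UNIV"
      by (simp only: has_integral_restrict_UNIV)
    have "(\<integral>\<^sup>+x. ennreal (if x \<in> ?S then J x else 0) \<partial>lborel) = ennreal (measure lebesgue (f ` ?S))"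
    proof (rule nn_integral_has_integral_lborel[OF _ _ int])
      show "(\<lambda>x. if x \<in> ?S then J x else 0) \<in> borel_measurable borel" using S by measurable
    qed (auto simp: det)
    also have "ennreal (measure lebesgue (f ` ?S)) = emeasure lborel (D' \<inter> B)"
      unfolding img using fin DB
      by (simp add: emeasure_eq_ennreal_measure measure_completion)
    also have "(\<integral>\<^sup>+x. ennreal (if x \<in> ?S then J x else 0) \<partial>lborel)
        = (\<integral>\<^sup>+x. indicator D x * ennreal (J x) * indicator B (f x) \<partial>lborel)"
      by (intro nn_integral_cong) (auto simp: indicator_def)
    finally show ?thesis .
  qed
  let ?B = "\<lambda>k::nat. E \<inter> ball 0 (real k)"
  have UB: "(\<Union>k. ?B k) = E"
    using reals_Archimedean2 by (auto simp: dist_norm)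
  have incB: "incseq ?B" by (auto simp: incseq_def)
  let ?P = "density lborel (\<lambda>x. indicator D x * ennreal (J x))"
  have P: "emeasure ?P (f -` A) = (\<integral>\<^sup>+x. indicator D x * ennreal (J x) * indicator A (f x) \<partial>lborel)"
    if [measurable]: "A \<in> sets borel" for A
    using measurable_sets[OF f that] by (subst emeasure_density) (auto intro!: nn_integral_cong simp: indicator_def)
  have "emeasure ?P (f -` E) = emeasure ?P (\<Union>k. f -` ?B k)"
    by (simp only: vimage_UN[symmetric] UB)
  also have "\<dots> = (SUP k. emeasure ?P (f -` ?B k))"
  proof (rule SUP_emeasure_incseq[symmetric])
    show "range (\<lambda>k. f -` ?B k) \<subseteq> sets ?P"
      using measurable_sets[OF f, of "?B _"] by auto
    show "incseq (\<lambda>k. f -` ?B k)" using incB by (auto simp: incseq_def)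
  qed
  also have "\<dots> = (SUP k. emeasure lborel (D' \<inter> ?B k))"
  proof (intro SUP_cong refl)
    fix k :: nat
    have "bounded (?B k)" by (rule bounded_subset[OF bounded_ball]) blast
    then show "emeasure ?P (f -` ?B k) = emeasure lborel (D' \<inter> ?B k)"
      by (subst P) (simp_all add: bounded)
  qed
  also have "\<dots> = emeasure lborel (\<Union>k. D' \<inter> ?B k)"
    by (rule SUP_emeasure_incseq) (use incB in \<open>auto simp: incseq_def\<close>)
  also have "(\<Union>k. D' \<inter> ?B k) = D' \<inter> E" using UB by auto
  finally show ?thesis by (simp add: P)
qed

lemma nn_integral_change_of_variables:
  fixes f :: "real^'k::{finite,wellorder} \<Rightarrow> real^'k::_"
  assumes D [measurable]: "D \<in> sets borel" and D' [measurable]: "D' \<in> sets borel"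
    and f [measurable]: "f \<in> borel_measurable borel"
    and J [measurable]: "J \<in> borel_measurable borel"
    and der: "\<And>x. x \<in> D \<Longrightarrow> (f has_derivative f' x) (at x)"
    and det: "\<And>x. x \<in> D \<Longrightarrow> J x = \<bar>det (matrix (f' x))\<bar>"
    and bij: "bij_betw f D D'"
    and F [measurable]: "F \<in> borel_measurable borel"
  shows "(\<integral>\<^sup>+x. indicator D x * ennreal (J x) * F (f x) \<partial>lborel) = (\<integral>\<^sup>+y. indicator D' y * F y \<partial>lborel)"
proof -
  let ?P = "density lborel (\<lambda>x. indicator D x * ennreal (J x))"
  have "distr ?P borel f = density lborel (indicator D')"
  proof (rule measure_eqI)
    fix E assume "E \<in> sets (distr ?P borel f)"
    then have E [measurable]: "E \<in> sets borel" by simp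
    have "emeasure (distr ?P borel f) E = emeasure ?P (f -` E)"
      by (subst emeasure_distr) simp_all
    also have "\<dots> = (\<integral>\<^sup>+x. indicator D x * ennreal (J x) * indicator E (f x) \<partial>lborel)"
      using measurable_sets[OF f E] by (subst emeasure_density) (auto intro!: nn_integral_cong simp: indicator_def)
    also have "\<dots> = emeasure lborel (D' \<inter> E)"
      by (rule emeasure_change_of_variables[OF D D' f J der det bij E])
    also have "\<dots> = emeasure (density lborel (indicator D')) E"
      by (simp add: emeasure_density indicator_inter_arith[symmetric])
    finally show "emeasure (distr ?P borel f) E = emeasure (density lborel (indicator D')) E" .
  qed simp
  then have "(\<integral>\<^sup>+y. F y \<partial>distr ?P borel f) = (\<integral>\<^sup>+y. F y \<partial>density lborel (indicator D'))" by simp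
  then show ?thesis
    by (simp add: nn_integral_distr nn_integral_density)
qed

subsection \<open>Quasi-invariance of Haar measure\<close>

definition jac :: "('n::finite) block_matrix \<Rightarrow> complex^'n^'n \<Rightarrow> real" where
  "jac g z = (1 / norm (det (aut_p g z))) ^ (2 * CARD('n))"

definition chart_density :: "real^('n::finite) hidx \<Rightarrow> real" where
  "chart_density r = jac cayley (herm r)"

lemma borel_measurable_jac [measurable]: "jac g \<in> borel_measurable borel"
  unfolding jac_def by measurable

lemma borel_measurable_chart_density [measurable]: "chart_density \<in> borel_measurable borel"
  unfolding chart_density_def by measurable

lemma jac_nonneg: "0 \<le> jac g z"
  by (simp add: jac_def)

lemma chart_density_pos: "0 < chart_density r"
  using invertible_cayley[OF cadjoint_herm[of r]]
  by (simp add: chart_density_def jac_def invertible_det_nz)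

lemma nn_integral_chart_map:
  fixes g :: "('n::finite) block_matrix"
  assumes g: "g \<in> Unn" and F [measurable]: "F \<in> borel_measurable borel"
  shows "(\<integral>\<^sup>+r. ennreal (jac (cay g) (herm r)) * F (chart_map g r) \<partial>lborel) = (\<integral>\<^sup>+r. F r \<partial>lborel)"
proof -
  let ?h = "Unn_inv g"
  have h: "?h \<in> Unn" using g by (rule Unn_Unn_inv)
  have [measurable]: "chart_dom g' \<in> sets borel" for g' :: "'n block_matrix"
    using open_chart_dom by (rule borel_open)
  have ae: "AE r in lborel. r \<in> chart_dom g'" if "g' \<in> Unn" for g' :: "'n block_matrix"
    using chart_dom_conull[OF that] by (intro AE_I[of _ _ "- chart_dom g'"]) auto
  have "(\<integral>\<^sup>+r. ennreal (jac (cay g) (herm r)) * F (chart_map g r) \<partial>lborel)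
      = (\<integral>\<^sup>+r. indicator (chart_dom g) r * ennreal (jac (cay g) (herm r)) * F (chart_map g r) \<partial>lborel)"
    by (rule nn_integral_cong_AE) (use ae[OF g] in eventually_elim, simp)
  also have "\<dots> = (\<integral>\<^sup>+r. indicator (chart_dom ?h) r * F r \<partial>lborel)"
  proof (rule nn_integral_change_of_variables)
    fix r assume r: "r \<in> chart_dom g"
    show "(chart_map g has_derivative congr (matrix_inv (chart_aut g r))) (at r)"
      by (rule chart_map_has_derivative[OF g r])
    have inv: "invertible (chart_aut g r)" using r by (simp add: chart_dom_def)
    have "det (chart_aut g r) * det (matrix_inv (chart_aut g r)) = 1"
      by (metis det_I det_mul inv matrix_inv_right)
    then have "det (matrix_inv (chart_aut g r)) = 1 / det (chart_aut g r)"
      using inv by (simp add: invertible_det_nz field_simps)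
    moreover have "invertible (matrix_inv (chart_aut g r))"
      using inv by (metis invertible_def matrix_inv_left matrix_inv_right)
    ultimately show "jac (cay g) (herm r) = \<bar>det (matrix (congr (matrix_inv (chart_aut g r))))\<bar>"
      by (simp add: det_congr jac_def chart_aut_def norm_divide)
  next
    show "bij_betw (chart_map g) (chart_dom g) (chart_dom ?h)"
      by (rule bij_betw_byWitness[where f'="chart_map ?h"])
        (use chart_map_inverse[OF g Unn_inv(1)[OF g]] chart_map_inverse[OF h Unn_inv(2)[OF g]] in auto)
  qed measurable
  also have "\<dots> = (\<integral>\<^sup>+r. F r \<partial>lborel)"
    by (rule nn_integral_cong_AE) (use ae[OF h] in eventually_elim, simp)
  finally show ?thesis .
qed

text \<open>The density is the automorphy factor of the Cayley matrix raised to the power that occurs in the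
  Jacobian, so the chain rule for \<open>cayley ** g = cay g ** cayley\<close> turns the Jacobian of the action in
  coordinates into that of the action on \<open>U(n)\<close>.\<close>

lemma nn_integral_chart_moebius:
  fixes g :: "('n::finite) block_matrix"
  assumes g: "g \<in> Unn" and f [measurable]: "f \<in> borel_measurable borel"
  shows "(\<integral>\<^sup>+r. ennreal (chart_density r) * (ennreal (jac g (chart r)) * f (moebius (chart r) g)) \<partial>lborel)
    = (\<integral>\<^sup>+r. ennreal (chart_density r) * f (chart r) \<partial>lborel)"
proof -
  have "AE r in lborel. r \<in> chart_dom g"
    using chart_dom_conull[OF g] borel_open[OF open_chart_dom[of g]] by (intro AE_I[of _ _ "- chart_dom g"]) auto
  then have "(\<integral>\<^sup>+r. ennreal (chart_density r) * (ennreal (jac g (chart r)) * f (moebius (chart r) g)) \<partial>lborel)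
      = (\<integral>\<^sup>+r. ennreal (jac (cay g) (herm r)) * (ennreal (chart_density (chart_map g r)) * f (chart (chart_map g r))) \<partial>lborel)"
  proof (rule nn_integral_cong_AE[OF AE_mp], intro AE_I2 impI)
    fix r assume r: "r \<in> chart_dom g"
    have "chart_density r * jac g (chart r) = (1 / norm (det (aut_p cayley (herm r)) * det (aut_p g (chart r)))) ^ (2 * CARD('n))"
      by (simp add: chart_density_def jac_def norm_mult power_mult_distrib[symmetric])
    also have "\<dots> = jac (cay g) (herm r) * chart_density (chart_map g r)"
      by (simp add: chart_moebius(2)[OF g r])
        (simp add: chart_density_def jac_def chart_aut_def norm_mult power_mult_distrib[symmetric])
    finally have "ennreal (chart_density r) * ennreal (jac g (chart r))
        = ennreal (jac (cay g) (herm r)) * ennreal (chart_density (chart_map g r))"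
      by (simp add: ennreal_mult[symmetric] jac_nonneg chart_density_def)
    then show "ennreal (chart_density r) * (ennreal (jac g (chart r)) * f (moebius (chart r) g))
        = ennreal (jac (cay g) (herm r)) * (ennreal (chart_density (chart_map g r)) * f (chart (chart_map g r)))"
      by (simp only: chart_moebius(1)[OF g r] mult.assoc[symmetric])
  qed
  also have "\<dots> = (\<integral>\<^sup>+r. ennreal (chart_density r) * f (chart r) \<partial>lborel)"
    by (rule nn_integral_chart_map[OF g]) measurable
  finally show ?thesis .
qed

lemma nn_integral_chart_mult_right:
  assumes u: "u \<in> unitary_group" and f [measurable]: "f \<in> borel_measurable borel"
  shows "(\<integral>\<^sup>+r. ennreal (chart_density r) * f (chart r ** u) \<partial>lborel)
    = (\<integral>\<^sup>+r. ennreal (chart_density r) * f (chart r) \<partial>lborel)"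
proof -
  let ?g = "block (mat 1) 0 0 u"
  have g: "?g \<in> Unn"
    using u unfolding Unn_iff by (simp add: unitary_group_def) (simp add: cadjoint_def vec_eq_iff matrix_mult_nth)
  have inv1: "matrix_inv (mat 1) = (mat 1 :: complex^'a^'a)" by (rule matrix_inv_eqI) simp
  have "jac ?g z = 1" "moebius z ?g = z ** u" for z
    by (simp_all add: jac_def aut_p_def aut_q_def moebius_eq inv1)
  then show ?thesis using nn_integral_chart_moebius[OF g f] by simp
qed

definition chart_measure :: "(real^('n::finite) hidx) measure" where
  "chart_measure = density lborel (\<lambda>r. ennreal (chart_density r))"

lemma sets_chart_measure [measurable_cong]: "sets chart_measure = sets borel"
  by (simp add: chart_measure_def)

lemma space_chart_measure: "space chart_measure = UNIV"
  by (simp add: chart_measure_def)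

lemma nn_integral_chart_measure:
  "f \<in> borel_measurable borel \<Longrightarrow> (\<integral>\<^sup>+r. f r \<partial>chart_measure) = (\<integral>\<^sup>+r. ennreal (chart_density r) * f r \<partial>lborel)"
  unfolding chart_measure_def by (rule nn_integral_density) simp_all

lemma sigma_finite_chart_measure: "sigma_finite_measure chart_measure"
  unfolding chart_measure_def by (subst sigma_finite_measure.sigma_finite_iff_density_finite[OF sigma_finite_lborel]) simp_all

lemma emeasure_chart_measure_cball:
  fixes c :: "real^('n::finite) hidx"
  shows "0 < emeasure chart_measure (cball c 1)" "emeasure chart_measure (cball c 1) < \<infinity>"
proof -
  have em: "emeasure chart_measure (cball c 1) = (\<integral>\<^sup>+r. ennreal (chart_density r) * indicator (cball c 1) r \<partial>lborel)"
    unfolding chart_measure_def by (rule emeasure_density) simp_all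
  have [measurable]: "cball c 1 \<in> sets borel" by simp
  have "emeasure chart_measure (cball c 1) \<noteq> 0"
  proof
    assume "emeasure chart_measure (cball c 1) = 0"
    then have "AE r in lborel. ennreal (chart_density r) * indicator (cball c 1) r = 0"
      unfolding em by (subst (asm) nn_integral_0_iff_AE) measurable
    then have "AE r in lborel. r \<notin> cball c 1"
    proof eventually_elim
      case (elim r)
      then show ?case using chart_density_pos[of r] by (auto simp: indicator_def ennreal_eq_0_iff)
    qed
    then have "emeasure lborel (cball c 1) = 0"
    proof (subst (asm) AE_iff_measurable[where N="cball c 1"])
      show "cball c 1 \<in> sets lborel" by simp
      show "{r \<in> space lborel. \<not> r \<notin> cball c 1} = cball c 1" by auto
    qed
    moreover have "emeasure lborel (cball c 1) \<noteq> 0"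
      using unit_ball_vol_pos[of "real CARD('n hidx)"] by (simp add: emeasure_cball less_imp_neq[symmetric])
    ultimately show False by simp
  qed
  then show "0 < emeasure chart_measure (cball c 1)" by (simp add: zero_less_iff_neq_zero)
  have "continuous_on (cball c 1) chart_density"
    unfolding continuous_on_def chart_density_def jac_def
    by (intro ballI tendsto_power tendsto_divide tendsto_norm tendsto_det tendsto_aut tendsto_herm
        tendsto_const tendsto_ident_at)
      (use invertible_cayley[OF cadjoint_herm] in \<open>simp add: invertible_det_nz\<close>)
  then have "bounded (chart_density ` cball c 1)"
    by (intro compact_imp_bounded compact_continuous_image) simp_all
  then obtain B where B: "\<And>r. r \<in> cball c 1 \<Longrightarrow> norm (chart_density r) \<le> B"
    unfolding bounded_iff by blast
  have "(\<integral>\<^sup>+r. ennreal (chart_density r) * indicator (cball c 1) r \<partial>lborel)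
      \<le> (\<integral>\<^sup>+r. ennreal B * indicator (cball c 1) r \<partial>lborel)"
    by (intro nn_integral_mono) (use B in \<open>auto simp: indicator_def intro!: ennreal_leI dest: abs_le_D1\<close>)
  also have "\<dots> = ennreal B * emeasure lborel (cball c 1)" by (simp add: nn_integral_cmult_indicator)
  also have "\<dots> < \<infinity>"
    by (simp add: emeasure_cball ennreal_mult_less_top)
  finally show "emeasure chart_measure (cball c 1) < \<infinity>" by (simp add: em)
qed

context
  fixes M :: "(complex^'n^'n) measure"
  assumes haar: "haar_measure M"
begin

lemma sets_haar: "sets M = sets (restrict_space borel unitary_group)"
  using haar by (simp add: haar_measure_def)

lemma space_haar: "space M = unitary_group"
  using sets_eq_imp_space_eq[OF sets_haar] by (simp add: space_restrict_space)

lemma finite_measure_haar: "finite_measure M"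
  using haar by (intro finite_measureI) (auto simp: haar_measure_def)

lemma haar_measurable:
  "f \<in> borel \<rightarrow>\<^sub>M N \<Longrightarrow> f \<in> M \<rightarrow>\<^sub>M N"
  by (subst measurable_cong_sets[OF sets_haar refl]) (rule measurable_restrict_space1)

lemma measurable_into_haar:
  assumes "f \<in> N \<rightarrow>\<^sub>M borel" "\<And>x. x \<in> space N \<Longrightarrow> f x \<in> unitary_group"
  shows "f \<in> N \<rightarrow>\<^sub>M M"
  by (subst measurable_cong_sets[OF refl sets_haar]) (rule measurable_restrict_space2, use assms in auto)

lemma measurable_matrix_mult_haar: "u \<in> unitary_group \<Longrightarrow> (\<lambda>z. u ** z) \<in> M \<rightarrow>\<^sub>M M"
  by (intro measurable_into_haar haar_measurable) (auto simp: space_haar intro: unitary_group_mult)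

lemma distr_haar_mult_left:
  assumes u: "u \<in> unitary_group"
  shows "distr M M (\<lambda>z. u ** z) = M"
proof (rule measure_eqI)
  fix A assume "A \<in> sets (distr M M (\<lambda>z. u ** z))"
  then have A: "A \<in> sets M" by simp
  have uu: "u ** cadjoint u = mat 1" "cadjoint u ** u = mat 1" using u by (simp_all add: unitary_group_def)
  have "A \<subseteq> unitary_group" using sets.sets_into_space[OF A] by (simp add: space_haar)
  then have "(\<lambda>z. u ** z) -` A \<inter> space M = (\<lambda>z. cadjoint u ** z) ` A"
    using uu by (auto simp: space_haar image_iff matrix_mul_assoc intro: unitary_group_mult unitary_group_cadjoint[OF u]
        intro!: bexI[of _ "u ** _"])
  then show "emeasure (distr M M (\<lambda>z. u ** z)) A = emeasure M A"
    using haar A unitary_group_cadjoint[OF u]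
    by (simp add: emeasure_distr measurable_matrix_mult_haar u haar_measure_def)
qed simp

text \<open>Integrate \<open>f (x z)\<close> over \<open>z\<close> with respect to the left invariant measure and over \<open>x\<close> with respect to
  the right invariant one, in both orders.\<close>

lemma haar_chart_proportional:
  assumes f [measurable]: "f \<in> borel_measurable borel"
  shows "emeasure (chart_measure :: (real^'n hidx) measure) UNIV * (\<integral>\<^sup>+z. f z \<partial>M)
    = emeasure M (space M) * (\<integral>\<^sup>+r. f (chart r) \<partial>chart_measure)"
proof -
  interpret M: finite_measure M by (rule finite_measure_haar)
  interpret N: sigma_finite_measure "chart_measure :: (real^'n hidx) measure" by (rule sigma_finite_chart_measure)
  interpret P: pair_sigma_finite M "chart_measure :: (real^'n hidx) measure" ..
  have [measurable]: "(\<lambda>z. z) \<in> M \<rightarrow>\<^sub>M borel" by (rule haar_measurable) simp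
  have meas: "(\<lambda>(z, r). f (chart r ** z)) \<in> borel_measurable (M \<Otimes>\<^sub>M chart_measure)"
    by measurable
  have left: "(\<integral>\<^sup>+z. f (u ** z) \<partial>M) = (\<integral>\<^sup>+z. f z \<partial>M)" if u: "u \<in> unitary_group" for u
  proof -
    have "(\<integral>\<^sup>+z. f (u ** z) \<partial>M) = (\<integral>\<^sup>+z. f z \<partial>distr M M (\<lambda>z. u ** z))"
      by (rule nn_integral_distr[symmetric])
        (simp_all add: measurable_matrix_mult_haar u haar_measurable)
    then show ?thesis by (simp add: distr_haar_mult_left u)
  qed
  have right: "(\<integral>\<^sup>+r. f (chart r ** z) \<partial>chart_measure) = (\<integral>\<^sup>+r. f (chart r) \<partial>chart_measure)"
    if z: "z \<in> unitary_group" for z :: "complex^'n^'n"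
    by (subst nn_integral_chart_measure, measurable)+ (rule nn_integral_chart_mult_right[OF z f])
  have "emeasure (chart_measure :: (real^'n hidx) measure) UNIV * (\<integral>\<^sup>+z. f z \<partial>M)
      = (\<integral>\<^sup>+r. (\<integral>\<^sup>+z. f (chart r ** z) \<partial>M) \<partial>(chart_measure :: (real^'n hidx) measure))"
    by (simp add: left chart_unitary space_chart_measure mult.commute)
  also have "\<dots> = (\<integral>\<^sup>+z. (\<integral>\<^sup>+r. f (chart r ** z) \<partial>chart_measure) \<partial>M)"
    using P.Fubini'[OF meas] by simp
  also have "\<dots> = (\<integral>\<^sup>+z. (\<integral>\<^sup>+r. f (chart r) \<partial>chart_measure) \<partial>M)"
    by (rule nn_integral_cong) (simp only: space_haar right)
  also have "\<dots> = emeasure M (space M) * (\<integral>\<^sup>+r. f (chart r) \<partial>chart_measure)"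
    by (simp add: mult.commute)
  finally show ?thesis .
qed

text \<open>The total mass of the chart density is the integral of \<open>\<bar>det (1 - \<i> h)\<bar>\<^sup>-\<^sup>2\<^sup>n\<close>. Its finiteness is a
  consequence of proportionality: the image of a ball has positive finite mass, which leaves no
  room for an infinite constant.\<close>

lemma emeasure_chart_measure_finite:
  "emeasure (chart_measure :: (real^'n hidx) measure) UNIV \<noteq> 0"
  "emeasure (chart_measure :: (real^'n hidx) measure) UNIV \<noteq> \<infinity>"
proof -
  let ?N = "chart_measure :: (real^'n hidx) measure" and ?C = "cball (0 :: real^'n hidx) 1"
  let ?B = "chart ` ?C"
  have C: "0 < emeasure ?N ?C" "emeasure ?N ?C < \<infinity>" by (rule emeasure_chart_measure_cball)+
  have "emeasure ?N ?C \<le> emeasure ?N UNIV" by (rule emeasure_mono) (simp_all add: sets_chart_measure)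
  then show "emeasure ?N UNIV \<noteq> 0" using C by auto
  have "continuous_on ?C chart"
    unfolding continuous_on_def chart_def moebius_eq
    by (intro ballI tendsto_matrix_mult tendsto_matrix_inv tendsto_aut tendsto_herm tendsto_const
        tendsto_ident_at invertible_cayley cadjoint_herm)
  then have "closed ?B" by (intro compact_imp_closed compact_continuous_image) simp_all
  then have B [measurable]: "?B \<in> sets borel" by (rule borel_closed)
  have "(\<integral>\<^sup>+r. indicator ?B (chart r) \<partial>?N) = (\<integral>\<^sup>+r. indicator ?C r \<partial>?N)"
    by (intro nn_integral_cong) (auto simp: indicator_def inj_image_mem_iff[OF inj_chart])
  also have "\<dots> = emeasure ?N ?C" by (simp add: sets_chart_measure)
  finally have eq: "emeasure ?N UNIV * (\<integral>\<^sup>+z. indicator ?B z \<partial>M) = emeasure M (space M) * emeasure ?N ?C"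
    using haar_chart_proportional[of "indicator ?B"] by simp
  have M: "0 < emeasure M (space M)" "emeasure M (space M) < \<infinity>"
    using haar by (simp_all add: haar_measure_def)
  show "emeasure ?N UNIV \<noteq> \<infinity>"
  proof
    assume "emeasure ?N UNIV = \<infinity>"
    then have "emeasure M (space M) * emeasure ?N ?C = 0 \<or> emeasure M (space M) * emeasure ?N ?C = \<infinity>"
      using eq[symmetric] by (auto simp: ennreal_top_mult split: if_splits)
    then show False using C M by (auto simp: ennreal_mult_eq_top_iff)
  qed
qed

lemma nn_integral_haar_moebius:
  assumes g: "g \<in> Unn" and f [measurable]: "f \<in> borel_measurable borel"
  shows "(\<integral>\<^sup>+z. ennreal (jac g z) * f (moebius z g) \<partial>M) = (\<integral>\<^sup>+z. f z \<partial>M)"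
proof -
  let ?N = "chart_measure :: (real^'n hidx) measure"
  have "emeasure ?N UNIV * (\<integral>\<^sup>+z. ennreal (jac g z) * f (moebius z g) \<partial>M)
      = emeasure M (space M) * (\<integral>\<^sup>+r. ennreal (jac g (chart r)) * f (moebius (chart r) g) \<partial>?N)"
    by (rule haar_chart_proportional) measurable
  also have "(\<integral>\<^sup>+r. ennreal (jac g (chart r)) * f (moebius (chart r) g) \<partial>?N) = (\<integral>\<^sup>+r. f (chart r) \<partial>?N)"
    by (simp add: nn_integral_chart_measure nn_integral_chart_moebius[OF g])
  also have "emeasure M (space M) * \<dots> = emeasure ?N UNIV * (\<integral>\<^sup>+z. f z \<partial>M)"
    by (rule haar_chart_proportional[symmetric]) (rule f)
  finally show ?thesis
    using emeasure_chart_measure_finite by (simp add: ennreal_mult_cancel_left)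
qed

end

section \<open>Unitarity\<close>

lemma closed_unitary_group: "closed (unitary_group :: (complex^'n^'n) set)"
proof -
  have "continuous_on UNIV (\<lambda>z :: complex^'n^'n. z ** cadjoint z)"
    "continuous_on UNIV (\<lambda>z :: complex^'n^'n. cadjoint z ** z)"
    unfolding continuous_on_def
    by (intro ballI tendsto_matrix_mult tendsto_cadjoint tendsto_ident_at)+
  then show ?thesis
    unfolding unitary_group_def by (intro closed_Collect_conj closed_Collect_eq continuous_on_const)
qed

lemma norm_det_power:
  assumes "Re u + Re v = - real n" "Im u = Im v"
  shows "norm (det_power G z u v) = (1 / norm (exp (log_det_factor G z))) ^ n"
proof -
  let ?L = "log_det_factor G z"
  have "Re (u * ?L + v * cnj ?L) = (Re u + Re v) * Re ?L - (Im u - Im v) * Im ?L"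
    by (simp add: algebra_simps)
  also have "\<dots> = - (real n * Re ?L)" using assms by simp
  finally have "norm (det_power G z u v) = exp (- (real n * Re ?L))" by (simp add: det_power_def)
  also have "\<dots> = (1 / norm (exp ?L)) ^ n"
    by (simp add: exp_minus power_one_over exp_of_nat_mult inverse_eq_divide)
  finally show ?thesis .
qed

lemma det_power_nonzero: "det_power G z u v \<noteq> 0"
  by (simp add: det_power_def)

lemma tendsto_det_power:
  assumes "(G \<longlongrightarrow> G0) F" "(z \<longlongrightarrow> z0) F" "fst G0 \<in> Unn" "contraction z0"
  shows "((\<lambda>x. det_power (G x) (z x) u v) \<longlongrightarrow> det_power G0 z0 u v) F"
  unfolding det_power_def
  by (intro tendsto_exp tendsto_add tendsto_mult tendsto_const tendsto_cnj tendsto_log_det_factor assms)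

lemma det_power_mult:
  assumes "G \<in> cover_set" "H \<in> cover_set" "contraction z"
  shows "det_power (cover_mult G H) z u v = det_power G z u v * det_power H (moebius z (fst G)) u v"
  using log_det_factor_mult[OF assms]
  by (simp add: det_power_def exp_add[symmetric] distrib_left add_ac)

lemma rho_mult:
  assumes "G \<in> cover_set" "H \<in> cover_set" "contraction z"
  shows "rho \<sigma> \<tau> (cover_mult G H) f z = rho \<sigma> \<tau> G (rho \<sigma> \<tau> H f) z"
proof -
  have "fst (cover_mult G H) = fst G ** fst H" by (cases G; cases H) simp
  then show ?thesis
    using assms by (simp add: rho_def det_power_mult moebius_mult_contraction cover_set_iff mult_ac)
qed

lemma rho_one: "rho \<sigma> \<tau> (mat 1, 0, 0) f z = f z"
  by (simp add: rho_def moebius_mat_1 det_power_def log_det_factor_eq blk_mat_1 tlog_0 del: log_det_factor.simps)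

lemma rho_add: "rho \<sigma> \<tau> G (\<lambda>y. f y + h y) z = rho \<sigma> \<tau> G f z + rho \<sigma> \<tau> G h z"
  by (simp add: rho_def distrib_right)

lemma rho_diff: "rho \<sigma> \<tau> G (\<lambda>y. f y - h y) z = rho \<sigma> \<tau> G f z - rho \<sigma> \<tau> G h z"
  by (simp add: rho_def left_diff_distrib)

lemma rho_scale: "rho \<sigma> \<tau> G (\<lambda>y. k * f y) z = k * rho \<sigma> \<tau> G f z"
  by (simp add: rho_def)

text \<open>The squared norm as an extended nonnegative number, which makes sense for all measurable
  functions.\<close>

definition sqnorm :: "'a measure \<Rightarrow> ('a \<Rightarrow> complex) \<Rightarrow> ennreal" where
  "sqnorm M f = (\<integral>\<^sup>+z. ennreal ((norm (f z))\<^sup>2) \<partial>M)"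

lemma L2_funs_iff: "f \<in> L2_funs M \<longleftrightarrow> f \<in> borel_measurable M \<and> sqnorm M f < \<infinity>"
proof -
  have "integrable M (\<lambda>x. (norm (f x))\<^sup>2) \<longleftrightarrow> sqnorm M f < \<infinity>" if "f \<in> borel_measurable M"
    using that unfolding sqnorm_def integrable_iff_bounded by simp
  then show ?thesis by (auto simp: L2_funs_def)
qed

context
  fixes M :: "(complex^'n^'n) measure"
  assumes haar: "haar_measure M"
begin

lemma AE_haarI: "(\<And>z. z \<in> unitary_group \<Longrightarrow> P z) \<Longrightarrow> AE z in M. P z"
  by (rule AE_I2) (simp add: space_haar[OF haar])

lemma continuous_haar_measurable:
  "continuous_on unitary_group f \<Longrightarrow> f \<in> borel_measurable M"
  by (subst measurable_cong_sets[OF sets_haar[OF haar] refl]) (rule borel_measurable_continuous_on_restrict)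

lemma measurable_moebius_haar:
  assumes "g \<in> Unn"
  shows "(\<lambda>z. moebius z g) \<in> M \<rightarrow>\<^sub>M M"
  by (intro measurable_into_haar[OF haar] haar_measurable[OF haar] borel_measurable_moebius)
    (simp add: space_haar[OF haar] moebius_unitary assms)

lemma measurable_moebius_comp:
  "g \<in> Unn \<Longrightarrow> f \<in> M \<rightarrow>\<^sub>M N \<Longrightarrow> (\<lambda>z. f (moebius z g)) \<in> M \<rightarrow>\<^sub>M N"
  by (rule measurable_compose[OF measurable_moebius_haar])

lemma jac_haar_measurable: "jac g \<in> borel_measurable M"
  by (intro haar_measurable[OF haar] borel_measurable_jac)

lemma distr_haar_moebius:
  assumes g: "g \<in> Unn"
  shows "distr (density M (\<lambda>z. ennreal (jac g z))) M (\<lambda>z. moebius z g) = M"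
proof (rule measure_eqI)
  fix A assume "A \<in> sets (distr (density M (\<lambda>z. ennreal (jac g z))) M (\<lambda>z. moebius z g))"
  then have A: "A \<in> sets M" by simp
  have "unitary_group \<in> sets (borel :: (complex^'n^'n) measure)"
    by (rule borel_closed[OF closed_unitary_group])
  then have Ab [measurable]: "A \<in> sets borel"
    using A unfolding sets_haar[OF haar] by (auto simp: sets_restrict_space)
  note [measurable] = jac_haar_measurable measurable_moebius_haar[OF g]
  have "emeasure (distr (density M (\<lambda>z. ennreal (jac g z))) M (\<lambda>z. moebius z g)) A
      = emeasure (density M (\<lambda>z. ennreal (jac g z))) ((\<lambda>z. moebius z g) -` A \<inter> space M)"
    by (subst emeasure_distr) (use A in simp_all)
  also have "\<dots> = (\<integral>\<^sup>+z. ennreal (jac g z) * indicator ((\<lambda>z. moebius z g) -` A \<inter> space M) z \<partial>M)"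
    by (rule emeasure_density) (use A in measurable)
  also have "\<dots> = (\<integral>\<^sup>+z. ennreal (jac g z) * indicator A (moebius z g) \<partial>M)"
    by (rule nn_integral_cong) (auto simp: indicator_def)
  also have "\<dots> = (\<integral>\<^sup>+z. indicator A z \<partial>M)" by (rule nn_integral_haar_moebius[OF haar g]) measurable
  also have "\<dots> = emeasure M A" using A by simp
  finally show "emeasure (distr (density M (\<lambda>z. ennreal (jac g z))) M (\<lambda>z. moebius z g)) A = emeasure M A" .
qed simp

lemma nn_integral_haar_moebius':
  assumes g: "g \<in> Unn" and f: "f \<in> borel_measurable M"
  shows "(\<integral>\<^sup>+z. ennreal (jac g z) * f (moebius z g) \<partial>M) = (\<integral>\<^sup>+z. f z \<partial>M)"
proof -
  note [measurable] = jac_haar_measurable measurable_moebius_haar[OF g] f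
  have "(\<integral>\<^sup>+z. f z \<partial>M) = (\<integral>\<^sup>+z. f z \<partial>distr (density M (\<lambda>z. ennreal (jac g z))) M (\<lambda>z. moebius z g))"
    by (simp only: distr_haar_moebius[OF g])
  also have "\<dots> = (\<integral>\<^sup>+z. ennreal (jac g z) * f (moebius z g) \<partial>M)"
    by (subst nn_integral_distr) (simp_all add: nn_integral_density)
  finally show ?thesis by simp
qed

lemma integral_haar_moebius:
  fixes f :: "_ \<Rightarrow> complex"
  assumes g: "g \<in> Unn" and f: "f \<in> borel_measurable M"
  shows "(LINT z|M. jac g z *\<^sub>R f (moebius z g)) = (LINT z|M. f z)"
proof -
  note [measurable] = jac_haar_measurable measurable_moebius_haar[OF g] f
  have "(LINT z|M. f z) = (LINT z|distr (density M (\<lambda>z. ennreal (jac g z))) M (\<lambda>z. moebius z g). f z)"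
    by (simp only: distr_haar_moebius[OF g])
  also have "\<dots> = (LINT z|M. jac g z *\<^sub>R f (moebius z g))"
    by (subst integral_distr) (simp_all add: integral_density jac_nonneg)
  finally show ?thesis by simp
qed

lemma AE_haar_moebius:
  assumes g: "g \<in> Unn" and P: "AE z in M. P z"
  shows "AE z in M. P (moebius z g)"
proof -
  note [measurable] = jac_haar_measurable measurable_moebius_haar[OF g]
  have "AE z in distr (density M (\<lambda>z. ennreal (jac g z))) M (\<lambda>z. moebius z g). P z"
    unfolding distr_haar_moebius[OF g] by (rule P)
  then have "AE z in density M (\<lambda>z. ennreal (jac g z)). P (moebius z g)"
    by (rule AE_distrD[rotated]) measurable
  then have "AE z in M. 0 < ennreal (jac g z) \<longrightarrow> P (moebius z g)"
    by (subst (asm) AE_density) measurable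
  moreover have "AE z in M. 0 < ennreal (jac g z)"
  proof (rule AE_haarI)
    fix z :: "complex^'n^'n" assume "z \<in> unitary_group"
    then have "invertible (aut_p g z)" by (intro invertible_aut_p g unitary_contraction)
    then show "0 < ennreal (jac g z)" by (simp add: jac_def invertible_det_nz)
  qed
  ultimately show ?thesis by eventually_elim simp
qed

lemma det_power_haar_measurable:
  fixes G :: "'n cover"
  assumes "G \<in> cover_set"
  shows "(\<lambda>z. det_power G z u v) \<in> borel_measurable M"
  by (rule continuous_haar_measurable, unfold continuous_on_def)
    (use assms in \<open>auto simp: cover_set_iff intro!: tendsto_det_power unitary_contraction tendsto_ident_at tendsto_const\<close>)

lemma rho_measurable:
  fixes G :: "'n cover"
  assumes G: "G \<in> cover_set" and f: "f \<in> borel_measurable M"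
  shows "rho \<sigma> \<tau> G f \<in> borel_measurable M"
proof -
  have "(\<lambda>z. f (moebius z (fst G))) \<in> borel_measurable M"
    using G by (intro measurable_moebius_comp f) (simp add: cover_set_iff)
  then show ?thesis
    unfolding rho_def[abs_def] by (intro borel_measurable_times det_power_haar_measurable G)
qed

context
  fixes \<sigma> \<tau> :: complex
  assumes re: "Re \<sigma> + Re \<tau> = - real CARD('n)" and im: "Im \<sigma> = Im \<tau>"
begin

text \<open>With \<open>u = -n - \<tau>\<close> and \<open>v = -n - \<sigma>\<close> the hypotheses say \<open>Re u + Re v = -n\<close> and \<open>Im u = Im v\<close>, so the
  modulus of \<open>exp (u L + v cnj L)\<close> is \<open>exp (- n Re L)\<close>, which is \<open>\<bar>det p\<bar>\<close> to the power \<open>-n\<close>.\<close>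

lemma multiplier_square:
  fixes G :: "'n cover"
  assumes G: "G \<in> cover_set" and z: "z \<in> unitary_group"
  shows "(norm (det_power G z (- of_nat CARD('n) - \<tau>) (- of_nat CARD('n) - \<sigma>)))\<^sup>2 = jac (fst G) z"
proof -
  have "exp (log_det_factor G z) = det (aut_p (fst G) z)"
    using G by (intro exp_log_det_factor unitary_contraction z) (simp_all add: cover_set_iff)
  moreover have "norm (det_power G z (- of_nat CARD('n) - \<tau>) (- of_nat CARD('n) - \<sigma>))
      = (1 / norm (exp (log_det_factor G z))) ^ CARD('n)"
    by (rule norm_det_power) (use re im in simp_all)
  ultimately show ?thesis by (simp add: jac_def power_mult[symmetric] mult.commute)
qed

lemma norm_rho_square:
  fixes G :: "'n cover"
  assumes "G \<in> cover_set" "z \<in> unitary_group"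
  shows "(norm (rho \<sigma> \<tau> G f z))\<^sup>2 = jac (fst G) z * (norm (f (moebius z (fst G))))\<^sup>2"
  by (simp add: rho_def norm_mult power_mult_distrib multiplier_square assms)

lemma sqnorm_cong: "(\<And>z. z \<in> unitary_group \<Longrightarrow> norm (f z) = norm (h z)) \<Longrightarrow> sqnorm M f = sqnorm M h"
  unfolding sqnorm_def by (rule nn_integral_cong) (simp add: space_haar[OF haar])

lemma sqnorm_rho:
  fixes G :: "'n cover"
  assumes G: "G \<in> cover_set" and f [measurable]: "f \<in> borel_measurable M"
  shows "sqnorm M (rho \<sigma> \<tau> G f) = sqnorm M f"
proof -
  have "sqnorm M (rho \<sigma> \<tau> G f) = (\<integral>\<^sup>+z. ennreal (jac (fst G) z) * ennreal ((norm (f (moebius z (fst G))))\<^sup>2) \<partial>M)"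
    unfolding sqnorm_def
    by (rule nn_integral_cong) (simp add: norm_rho_square G space_haar[OF haar] ennreal_mult jac_nonneg)
  also have "\<dots> = sqnorm M f"
    unfolding sqnorm_def using G by (intro nn_integral_haar_moebius') (simp add: cover_set_iff, measurable)
  finally show ?thesis .
qed

lemma rho_L2: "G \<in> cover_set \<Longrightarrow> f \<in> L2_funs M \<Longrightarrow> rho \<sigma> \<tau> G f \<in> L2_funs M" for G :: "'n cover"
  by (simp add: L2_funs_iff rho_measurable sqnorm_rho)

lemma rho_inner:
  fixes G :: "'n cover"
  assumes G: "G \<in> cover_set" and f: "f \<in> L2_funs M" and h: "h \<in> L2_funs M"
  shows "L2_inner M (rho \<sigma> \<tau> G f) (rho \<sigma> \<tau> G h) = L2_inner M f h"
proof -
  let ?g = "fst G" and ?d = "\<lambda>z. det_power G z (- of_nat CARD('n) - \<tau>) (- of_nat CARD('n) - \<sigma>)"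
  have [measurable]: "f \<in> borel_measurable M" "h \<in> borel_measurable M" using f h by (simp_all add: L2_funs_iff)
  have cnj [measurable]: "cnj \<in> borel_measurable borel"
    by (intro borel_measurable_continuous_onI continuous_intros)
  have "L2_inner M (rho \<sigma> \<tau> G f) (rho \<sigma> \<tau> G h)
      = (LINT z|M. jac ?g z *\<^sub>R (f (moebius z ?g) * cnj (h (moebius z ?g))))"
    unfolding L2_inner_def
  proof (rule Bochner_Integration.integral_cong[OF refl])
    fix z assume "z \<in> space M"
    then have z: "z \<in> unitary_group" by (simp add: space_haar[OF haar])
    have "rho \<sigma> \<tau> G f z * cnj (rho \<sigma> \<tau> G h z) = (?d z * cnj (?d z)) * (f (moebius z ?g) * cnj (h (moebius z ?g)))"
      by (simp add: rho_def mult_ac)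
    also have "?d z * cnj (?d z) = of_real (jac ?g z)"
      by (simp only: complex_norm_square[symmetric] multiplier_square[OF G z, symmetric])
    finally show "rho \<sigma> \<tau> G f z * cnj (rho \<sigma> \<tau> G h z) = jac ?g z *\<^sub>R (f (moebius z ?g) * cnj (h (moebius z ?g)))"
      by (simp add: scaleR_conv_of_real)
  qed
  also have "\<dots> = L2_inner M f h"
    unfolding L2_inner_def using G
    by (intro integral_haar_moebius[where f="\<lambda>z. f z * cnj (h z)"]) (simp add: cover_set_iff, measurable)
  finally show ?thesis .
qed

text \<open>The preimage is written down directly: transport \<open>h\<close> back by \<open>g\<^sup>-\<^sup>1\<close> and divide by the multiplier.\<close>

lemma rho_surj:
  fixes G :: "'n cover"
  assumes G: "G \<in> cover_set" and h: "h \<in> L2_funs M"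
  shows "\<exists>f\<in>L2_funs M. \<forall>z\<in>unitary_group. rho \<sigma> \<tau> G f z = h z"
proof
  let ?g = "fst G" and ?d = "\<lambda>z. det_power G z (- of_nat CARD('n) - \<tau>) (- of_nat CARD('n) - \<sigma>)"
  let ?k = "Unn_inv ?g"
  let ?f = "\<lambda>z. h (moebius z ?k) / ?d (moebius z ?k)"
  have g: "?g \<in> Unn" and k: "?k \<in> Unn" using G by (simp_all add: cover_set_iff Unn_Unn_inv)
  show eq: "\<forall>z\<in>unitary_group. rho \<sigma> \<tau> G ?f z = h z"
  proof
    fix z :: "complex^'n^'n" assume z: "z \<in> unitary_group"
    have "moebius (moebius z ?g) ?k = z"
      using moebius_mult_contraction[OF g k unitary_contraction[OF z]] by (simp add: Unn_inv[OF g] moebius_mat_1)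
    then show "rho \<sigma> \<tau> G ?f z = h z" by (simp add: rho_def det_power_nonzero)
  qed
  have hm: "h \<in> borel_measurable M" using h by (simp add: L2_funs_iff)
  have fm: "?f \<in> borel_measurable M"
    by (intro borel_measurable_divide measurable_moebius_comp[OF k] hm det_power_haar_measurable[OF G])
  have "sqnorm M ?f = sqnorm M (rho \<sigma> \<tau> G ?f)" by (rule sqnorm_rho[OF G fm, symmetric])
  also have "\<dots> = sqnorm M h" by (rule sqnorm_cong) (simp add: eq)
  finally show "?f \<in> L2_funs M" using h fm by (simp add: L2_funs_iff)
qed

lemma rho_unitary:
  fixes G :: "'n cover"
  assumes G: "G \<in> cover_set"
  shows "unitary_operator_L2 M (rho \<sigma> \<tau> G)"
  unfolding unitary_operator_L2_def
proof (intro conjI ballI allI impI)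
  have g: "fst G \<in> Unn" using G by (simp add: cover_set_iff)
  show "rho \<sigma> \<tau> G f \<in> L2_funs M" if "f \<in> L2_funs M" for f by (rule rho_L2[OF G that])
  show "AE z in M. rho \<sigma> \<tau> G f z = rho \<sigma> \<tau> G h z" if "AE z in M. f z = h z" for f h
    using AE_haar_moebius[OF g that] by eventually_elim (simp add: rho_def)
  show "AE z in M. rho \<sigma> \<tau> G (\<lambda>y. f y + h y) z = rho \<sigma> \<tau> G f z + rho \<sigma> \<tau> G h z" for f h
    by (simp add: rho_add)
  show "AE z in M. rho \<sigma> \<tau> G (\<lambda>y. k * f y) z = k * rho \<sigma> \<tau> G f z" for k f
    by (simp add: rho_scale)
  show "L2_inner M (rho \<sigma> \<tau> G f) (rho \<sigma> \<tau> G h) = L2_inner M f h" if "f \<in> L2_funs M" "h \<in> L2_funs M" for f h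
    by (rule rho_inner[OF G that])
  show "\<exists>f\<in>L2_funs M. AE z in M. rho \<sigma> \<tau> G f z = h z" if "h \<in> L2_funs M" for h
    using rho_surj[OF G that] by (auto intro!: AE_haarI)
qed

end

end

section \<open>Strong continuity\<close>

text \<open>The norm of \<open>c a\<^sup>-\<^sup>1\<close> stays below some \<open>r < 1\<close> near \<open>G\<close>, and on \<open>\<parallel>X\<parallel> \<le> r\<close> the logarithmic series is
  bounded.\<close>

lemma eventually_det_power_bounded:
  fixes X :: "'x \<Rightarrow> ('n::finite) cover"
  assumes X: "(X \<longlongrightarrow> G) F" and G: "fst G \<in> Unn"
  obtains B where "\<forall>\<^sub>F x in F. \<forall>z. contraction z \<longrightarrow> norm (det_power (X x) z u v) \<le> B"
proof -
  let ?q = "\<lambda>G :: 'n cover. rnorm (blk_c (fst G) ** matrix_inv (blk_a (fst G)))"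
  define r where "r = (1 + ?q G) / 2"
  have r: "?q G < r" "r < 1" using rnorm_c_inv_a[OF G] by (simp_all add: r_def)
  define B0 where "B0 = norm (fst (snd G)) + 1 + (\<Sum>k. real CARD('n) * r ^ Suc k)"
  have "((\<lambda>x. ?q (X x)) \<longlongrightarrow> ?q G) F"
    by (intro tendsto_rnorm tendsto_matrix_mult tendsto_matrix_inv tendsto_blk tendsto_fst X invertible_blk_a G)
  then have "\<forall>\<^sub>F x in F. ?q (X x) < r" using r(1) by (rule order_tendstoD)
  moreover have "((\<lambda>x. norm (fst (snd (X x)))) \<longlongrightarrow> norm (fst (snd G))) F"
    by (intro tendsto_norm tendsto_fst tendsto_snd X)
  then have "\<forall>\<^sub>F x in F. norm (fst (snd (X x))) < norm (fst (snd G)) + 1"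
    by (rule order_tendstoD) simp
  ultimately have "\<forall>\<^sub>F x in F. \<forall>z. contraction z \<longrightarrow>
      norm (det_power (X x) z u v) \<le> exp ((norm u + norm v) * B0)"
  proof eventually_elim
    case (elim x)
    show ?case
    proof (intro allI impI)
      fix z :: "complex^'n^'n" assume z: "contraction z"
      let ?L = "log_det_factor (X x) z"
      have "rnorm (z ** blk_c (fst (X x)) ** matrix_inv (blk_a (fst (X x)))) \<le> r"
        using rnorm_z_c_inv_a[OF z, of "fst (X x)"] elim(1) by linarith
      then have "norm (tlog (z ** blk_c (fst (X x)) ** matrix_inv (blk_a (fst (X x)))))
          \<le> (\<Sum>k. real CARD('n) * r ^ Suc k)"
        using r(2) by (rule norm_tlog_le)
      then have L: "norm ?L \<le> B0"
        using elim(2) norm_triangle_ineq[of "fst (snd (X x))" "tlog (z ** blk_c (fst (X x)) ** matrix_inv (blk_a (fst (X x))))"]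
        unfolding log_det_factor_eq B0_def by linarith
      have "norm (u * ?L + v * cnj ?L) \<le> (norm u + norm v) * norm ?L"
        using norm_triangle_ineq[of "u * ?L" "v * cnj ?L"] by (simp add: norm_mult distrib_right)
      also have "\<dots> \<le> (norm u + norm v) * B0" by (rule mult_left_mono[OF L]) simp
      finally have "exp (norm (u * ?L + v * cnj ?L)) \<le> exp ((norm u + norm v) * B0)" by simp
      then show "norm (det_power (X x) z u v) \<le> exp ((norm u + norm v) * B0)"
        using norm_exp[of "u * ?L + v * cnj ?L"] unfolding det_power_def by linarith
    qed
  qed
  then show thesis by (rule that)
qed

lemma norm_add_square_le: "(norm (a + b))\<^sup>2 \<le> 2 * (norm a)\<^sup>2 + 2 * (norm b)\<^sup>2" for a b :: "'a::real_normed_vector"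
proof -
  have "(norm (a + b))\<^sup>2 \<le> (norm a + norm b)\<^sup>2" by (intro power_mono norm_triangle_ineq norm_ge_zero)
  also have "\<dots> \<le> 2 * (norm a)\<^sup>2 + 2 * (norm b)\<^sup>2" using zero_le_power2[of "norm a - norm b"] by (simp add: power2_eq_square algebra_simps)
  finally show ?thesis .
qed

context
  fixes M :: "(complex^'n^'n) measure" and \<sigma> \<tau> :: complex
  assumes haar: "haar_measure M"
    and re: "Re \<sigma> + Re \<tau> = - real CARD('n)" and im: "Im \<sigma> = Im \<tau>"
begin

lemma sqnorm_add_le:
  assumes [measurable]: "f \<in> borel_measurable M" "h \<in> borel_measurable M"
  shows "sqnorm M (\<lambda>z. f z + h z) \<le> 2 * sqnorm M f + 2 * sqnorm M h"
proof -
  have "sqnorm M (\<lambda>z. f z + h z) \<le> (\<integral>\<^sup>+z. 2 * ennreal ((norm (f z))\<^sup>2) + 2 * ennreal ((norm (h z))\<^sup>2) \<partial>M)"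
    unfolding sqnorm_def
  proof (rule nn_integral_mono)
    fix z
    have "ennreal ((norm (f z + h z))\<^sup>2) \<le> ennreal (2 * (norm (f z))\<^sup>2 + 2 * (norm (h z))\<^sup>2)"
      by (intro ennreal_leI norm_add_square_le)
    then show "ennreal ((norm (f z + h z))\<^sup>2) \<le> 2 * ennreal ((norm (f z))\<^sup>2) + 2 * ennreal ((norm (h z))\<^sup>2)"
      by (simp add: ennreal_mult)
  qed
  also have "\<dots> = 2 * sqnorm M f + 2 * sqnorm M h"
    unfolding sqnorm_def by (simp add: nn_integral_add nn_integral_cmult)
  finally show ?thesis .
qed

lemma sqnorm_minus: "sqnorm M (\<lambda>z. - f z) = sqnorm M f"
  by (simp add: sqnorm_def)

definition continuous_vector :: "(complex^'n^'n \<Rightarrow> complex) \<Rightarrow> bool" where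
  "continuous_vector f \<longleftrightarrow> f \<in> borel_measurable M \<and>
    (\<forall>G\<in>cover_set. ((\<lambda>H. sqnorm M (\<lambda>z. rho \<sigma> \<tau> H f z - rho \<sigma> \<tau> G f z)) \<longlongrightarrow> 0) (at G within cover_set))"

lemma continuous_vectorD:
  "continuous_vector f \<Longrightarrow> f \<in> borel_measurable M"
  "continuous_vector f \<Longrightarrow> G \<in> cover_set \<Longrightarrow>
    ((\<lambda>H. sqnorm M (\<lambda>z. rho \<sigma> \<tau> H f z - rho \<sigma> \<tau> G f z)) \<longlongrightarrow> 0) (at G within cover_set)"
  by (simp_all add: continuous_vector_def)

lemma rho_diff_measurable:
  fixes G H :: "'n cover"
  assumes "G \<in> cover_set" "H \<in> cover_set" "f \<in> borel_measurable M"
  shows "(\<lambda>z. rho \<sigma> \<tau> H f z - rho \<sigma> \<tau> G f z) \<in> borel_measurable M"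
  using assms by (intro borel_measurable_diff rho_measurable[OF haar])

lemma continuous_vector_add:
  assumes f: "continuous_vector f" and h: "continuous_vector h"
  shows "continuous_vector (\<lambda>z. f z + h z)"
  unfolding continuous_vector_def
proof (intro conjI ballI)
  note fm = continuous_vectorD(1)[OF f] and hm = continuous_vectorD(1)[OF h]
  show "(\<lambda>z. f z + h z) \<in> borel_measurable M" by (intro borel_measurable_add fm hm)
  fix G :: "'n cover" assume G: "G \<in> cover_set"
  let ?D = "\<lambda>f H z. rho \<sigma> \<tau> H f z - rho \<sigma> \<tau> G f z"
  have "((\<lambda>H. 2 * sqnorm M (?D f H) + 2 * sqnorm M (?D h H)) \<longlongrightarrow> 2 * 0 + 2 * 0) (at G within cover_set)"
    by (intro tendsto_add ennreal_tendsto_cmult continuous_vectorD f h G) simp_all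
  then have lim: "((\<lambda>H. 2 * sqnorm M (?D f H) + 2 * sqnorm M (?D h H)) \<longlongrightarrow> 0) (at G within cover_set)" by simp
  show "((\<lambda>H. sqnorm M (?D (\<lambda>z. f z + h z) H)) \<longlongrightarrow> 0) (at G within cover_set)"
  proof (rule tendsto_sandwich[OF _ _ tendsto_const lim])
    show "\<forall>\<^sub>F H in at G within cover_set. sqnorm M (?D (\<lambda>z. f z + h z) H) \<le> 2 * sqnorm M (?D f H) + 2 * sqnorm M (?D h H)"
      unfolding eventually_at_filter
    proof (intro always_eventually allI impI)
      fix H :: "'n cover" assume "H \<in> cover_set"
      then show "sqnorm M (?D (\<lambda>z. f z + h z) H) \<le> 2 * sqnorm M (?D f H) + 2 * sqnorm M (?D h H)"
        using sqnorm_add_le[OF rho_diff_measurable[OF G _ fm] rho_diff_measurable[OF G _ hm], of H H]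
        by (simp add: rho_add algebra_simps)
    qed
  qed simp
qed

lemma continuous_vector_scale:
  assumes f: "continuous_vector f"
  shows "continuous_vector (\<lambda>z. k * f z)"
  unfolding continuous_vector_def
proof (intro conjI ballI)
  note fm [measurable] = continuous_vectorD(1)[OF f]
  show "(\<lambda>z. k * f z) \<in> borel_measurable M" by measurable
  fix G :: "'n cover" assume G: "G \<in> cover_set"
  let ?D = "\<lambda>f H z. rho \<sigma> \<tau> H f z - rho \<sigma> \<tau> G f z"
  have "((\<lambda>H. ennreal ((norm k)\<^sup>2) * sqnorm M (?D f H)) \<longlongrightarrow> ennreal ((norm k)\<^sup>2) * 0) (at G within cover_set)"
    by (intro ennreal_tendsto_cmult continuous_vectorD f G) simp_all
  moreover have "sqnorm M (?D (\<lambda>z. k * f z) H) = ennreal ((norm k)\<^sup>2) * sqnorm M (?D f H)"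
    if H: "H \<in> cover_set" for H :: "'n cover"
  proof -
    note [measurable] = rho_diff_measurable[OF G H fm]
    have "(norm (?D (\<lambda>z. k * f z) H z))\<^sup>2 = (norm k)\<^sup>2 * (norm (?D f H z))\<^sup>2" for z
      by (simp add: rho_scale norm_mult power_mult_distrib flip: right_diff_distrib)
    then show ?thesis
      unfolding sqnorm_def by (simp add: ennreal_mult nn_integral_cmult)
  qed
  ultimately show "((\<lambda>H. sqnorm M (?D (\<lambda>z. k * f z) H)) \<longlongrightarrow> 0) (at G within cover_set)"
    by (subst tendsto_cong[where g="\<lambda>H. ennreal ((norm k)\<^sup>2) * sqnorm M (?D f H)"])
      (auto simp: eventually_at_filter)
qed

text \<open>By unitarity the operators are equicontinuous, so the vectors with a continuous orbit form a
  closed subspace; in particular they are closed under dominated pointwise limits.\<close>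

lemma continuous_vector_limit:
  assumes fk: "\<And>k. continuous_vector (f k)" and h: "h \<in> borel_measurable M"
    and lim: "\<And>z. z \<in> unitary_group \<Longrightarrow> (\<lambda>k. f k z) \<longlonglongrightarrow> h z"
    and w: "w \<in> borel_measurable M" "sqnorm M w < \<infinity>"
    and bound: "\<And>k z. z \<in> unitary_group \<Longrightarrow> norm (f k z - h z) \<le> norm (w z)"
  shows "continuous_vector h"
  unfolding continuous_vector_def
proof (intro conjI ballI)
  show "h \<in> borel_measurable M" by (rule h)
  note fm = continuous_vectorD(1)[OF fk]
  note [measurable] = h w(1) fm
  have "(\<lambda>k. \<integral>\<^sup>+z. ennreal ((norm (f k z - h z))\<^sup>2) \<partial>M) \<longlonglongrightarrow> (\<integral>\<^sup>+z. 0 \<partial>M)"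
  proof (rule nn_integral_dominated_convergence)
    show "AE z in M. ennreal ((norm (f k z - h z))\<^sup>2) \<le> ennreal ((norm (w z))\<^sup>2)" for k
      by (intro AE_haarI[OF haar] ennreal_leI power_mono bound norm_ge_zero)
    show "(\<integral>\<^sup>+z. ennreal ((norm (w z))\<^sup>2) \<partial>M) < \<infinity>" using w(2) by (simp add: sqnorm_def)
    show "AE z in M. (\<lambda>k. ennreal ((norm (f k z - h z))\<^sup>2)) \<longlonglongrightarrow> 0"
    proof (rule AE_haarI[OF haar])
      fix z :: "complex^'n^'n" assume "z \<in> unitary_group"
      then have "(\<lambda>k. ennreal ((norm (f k z - h z))\<^sup>2)) \<longlonglongrightarrow> ennreal ((norm (h z - h z))\<^sup>2)"
        by (intro tendsto_ennrealI tendsto_power tendsto_norm tendsto_diff lim tendsto_const)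
      then show "(\<lambda>k. ennreal ((norm (f k z - h z))\<^sup>2)) \<longlonglongrightarrow> 0" by simp
    qed
  qed measurable
  then have conv: "(\<lambda>k. sqnorm M (\<lambda>z. h z - f k z)) \<longlonglongrightarrow> 0"
    by (simp add: sqnorm_def norm_minus_commute)
  fix G :: "'n cover" assume G: "G \<in> cover_set"
  let ?D = "\<lambda>f H z. rho \<sigma> \<tau> H f z - rho \<sigma> \<tau> G f z"
  show "((\<lambda>H. sqnorm M (?D h H)) \<longlongrightarrow> 0) (at G within cover_set)"
  proof (rule order_tendstoI)
    fix a :: ennreal assume "0 < a"
    then obtain b where b: "0 < b" "b < a" using dense by blast
    obtain e where e: "b = ennreal e" "0 < e"
      using b by (cases b) (auto simp: top_unique)
    have "\<forall>\<^sub>F k in sequentially. sqnorm M (\<lambda>z. h z - f k z) < ennreal (e / 16)"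
      using conv by (rule order_tendstoD) (use e in simp)
    then obtain k where k: "sqnorm M (\<lambda>z. h z - f k z) < ennreal (e / 16)"
      by (auto simp: eventually_sequentially)
    have "\<forall>\<^sub>F H in at G within cover_set. sqnorm M (?D (f k) H) < ennreal (e / 16)"
      using continuous_vectorD(2)[OF fk G] by (rule order_tendstoD) (use e in simp)
    moreover have "\<forall>\<^sub>F H in at G within cover_set. H \<in> cover_set"
      by (simp add: eventually_at_filter)
    ultimately show "\<forall>\<^sub>F H in at G within cover_set. sqnorm M (?D h H) < a"
    proof eventually_elim
      case (elim H)
      let ?r = "\<lambda>z. h z - f k z"
      note H = elim(2)
      have rm: "?r \<in> borel_measurable M" by measurable
      have "sqnorm M (?D h H) = sqnorm M (\<lambda>z. ?D (f k) H z + ?D ?r H z)"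
        by (simp add: rho_diff)
      also have "\<dots> \<le> 2 * sqnorm M (?D (f k) H) + 2 * sqnorm M (?D ?r H)"
        by (intro sqnorm_add_le rho_diff_measurable G H fm rm)
      also have "sqnorm M (?D ?r H) \<le> 2 * sqnorm M ?r + 2 * sqnorm M ?r"
        using sqnorm_add_le[OF rho_measurable[OF haar H rm, where \<sigma>=\<sigma> and \<tau>=\<tau>]
            borel_measurable_uminus[OF rho_measurable[OF haar G rm, where \<sigma>=\<sigma> and \<tau>=\<tau>]]]
        by (simp add: sqnorm_minus sqnorm_rho[OF haar re im _ rm] G H)
      finally have "sqnorm M (?D h H) \<le> 2 * sqnorm M (?D (f k) H) + 2 * (2 * sqnorm M ?r + 2 * sqnorm M ?r)"
        by (simp add: mult_left_mono add_left_mono)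
      also have "\<dots> \<le> 2 * ennreal (e / 16) + 2 * (2 * ennreal (e / 16) + 2 * ennreal (e / 16))"
        using elim(1) k by (intro add_mono mult_left_mono) (auto intro: less_imp_le)
      also have "\<dots> = (2 + (4 + 4)) * ennreal (e / 16)" unfolding distrib_right by (simp add: distrib_left)
      also have "\<dots> = ennreal (10 * (e / 16))" using e by (simp add: ennreal_mult del: times_divide_eq_right)
      also have "\<dots> \<le> b" unfolding e(1) using e(2) by (intro ennreal_leI) simp
      finally show ?case using b by simp
    qed
  qed simp
qed

lemma continuous_vector_continuous:
  assumes f: "continuous_on unitary_group f" and bound: "\<And>z. z \<in> unitary_group \<Longrightarrow> norm (f z) \<le> B"
  shows "continuous_vector f"
  unfolding continuous_vector_def
proof (intro conjI ballI)
  interpret M: finite_measure M by (rule finite_measure_haar[OF haar])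
  show fm: "f \<in> borel_measurable M" by (rule continuous_haar_measurable[OF haar f])
  fix G :: "'n cover" assume G: "G \<in> cover_set"
  then have g: "fst G \<in> Unn" by (simp add: cover_set_iff)
  let ?u = "- of_nat CARD('n) - \<tau>" and ?v = "- of_nat CARD('n) - \<sigma>"
  show "((\<lambda>H. sqnorm M (\<lambda>z. rho \<sigma> \<tau> H f z - rho \<sigma> \<tau> G f z)) \<longlongrightarrow> 0) (at G within cover_set)"
    unfolding tendsto_at_iff_sequentially
  proof (intro allI impI)
    fix X assume "\<forall>i. X i \<in> cover_set - {G}" and X: "X \<longlonglongrightarrow> G"
    then have Xc: "X i \<in> cover_set" for i by blast
    obtain C where "\<forall>\<^sub>F i in sequentially. \<forall>z. contraction z \<longrightarrow> norm (det_power (X i) z ?u ?v) \<le> C"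
      using eventually_det_power_bounded[OF X g] by blast
    then obtain K where K: "\<And>i z. i \<ge> K \<Longrightarrow> contraction z \<Longrightarrow> norm (det_power (X i) z ?u ?v) \<le> C"
      unfolding eventually_sequentially by blast
    have XG: "(\<lambda>i. X (i + K)) \<longlonglongrightarrow> G" using X by (rule LIMSEQ_ignore_initial_segment)
    have rho_bound: "norm (rho \<sigma> \<tau> (X i) f z) \<le> B * C" if "i \<ge> K" "z \<in> unitary_group" for i z
    proof -
      have m: "moebius z (fst (X i)) \<in> unitary_group"
        using Xc that by (intro moebius_unitary) (simp_all add: cover_set_iff)
      show ?thesis
        unfolding rho_def norm_mult
        by (intro mult_mono bound m K that unitary_contraction norm_ge_zero order_trans[OF norm_ge_zero bound[OF m]])
    qed
    have rho_lim: "(\<lambda>i. rho \<sigma> \<tau> (X (i + K)) f z) \<longlonglongrightarrow> rho \<sigma> \<tau> G f z" if z: "z \<in> unitary_group" for z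
      unfolding rho_def
    proof (intro tendsto_mult tendsto_det_power XG tendsto_const g unitary_contraction z)
      show "(\<lambda>i. f (moebius z (fst (X (i + K))))) \<longlonglongrightarrow> f (moebius z (fst G))"
      proof (rule continuous_on_tendsto_compose[OF f])
        show "(\<lambda>i. moebius z (fst (X (i + K)))) \<longlonglongrightarrow> moebius z (fst G)"
          by (intro tendsto_moebius tendsto_fst XG tendsto_const g unitary_contraction z)
        show "moebius z (fst G) \<in> unitary_group" by (intro moebius_unitary g z)
        show "\<forall>\<^sub>F i in sequentially. moebius z (fst (X (i + K))) \<in> unitary_group"
          using Xc z by (intro always_eventually allI moebius_unitary) (simp_all add: cover_set_iff)
      qed
    qed
    note [measurable] = rho_measurable[OF haar Xc fm] rho_measurable[OF haar G fm]
    have "(\<lambda>i. \<integral>\<^sup>+z. ennreal ((norm (rho \<sigma> \<tau> (X (i + K)) f z - rho \<sigma> \<tau> G f z))\<^sup>2) \<partial>M) \<longlonglongrightarrow> (\<integral>\<^sup>+z. 0 \<partial>M)"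
    proof (rule nn_integral_dominated_convergence[where w="\<lambda>z. ennreal ((2 * (B * C))\<^sup>2)"])
      show "AE z in M. ennreal ((norm (rho \<sigma> \<tau> (X (i + K)) f z - rho \<sigma> \<tau> G f z))\<^sup>2) \<le> ennreal ((2 * (B * C))\<^sup>2)" for i
      proof (intro AE_haarI[OF haar] ennreal_leI power_mono norm_ge_zero)
        fix z :: "complex^'n^'n" assume z: "z \<in> unitary_group"
        have "norm (rho \<sigma> \<tau> G f z) \<le> B * C"
          by (rule LIMSEQ_le_const2[OF tendsto_norm[OF rho_lim[OF z]]]) (use rho_bound z in auto)
        then show "norm (rho \<sigma> \<tau> (X (i + K)) f z - rho \<sigma> \<tau> G f z) \<le> 2 * (B * C)"
          using rho_bound[of "i + K" z] z norm_triangle_ineq4[of "rho \<sigma> \<tau> (X (i + K)) f z" "rho \<sigma> \<tau> G f z"] by simp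
      qed
      show "(\<integral>\<^sup>+z. ennreal ((2 * (B * C))\<^sup>2) \<partial>M) < \<infinity>"
        by (simp add: less_top[symmetric] ennreal_mult_eq_top_iff M.emeasure_finite)
      show "AE z in M. (\<lambda>i. ennreal ((norm (rho \<sigma> \<tau> (X (i + K)) f z - rho \<sigma> \<tau> G f z))\<^sup>2)) \<longlonglongrightarrow> 0"
      proof (rule AE_haarI[OF haar])
        fix z :: "complex^'n^'n" assume "z \<in> unitary_group"
        then have "(\<lambda>i. ennreal ((norm (rho \<sigma> \<tau> (X (i + K)) f z - rho \<sigma> \<tau> G f z))\<^sup>2))
            \<longlonglongrightarrow> ennreal ((norm (rho \<sigma> \<tau> G f z - rho \<sigma> \<tau> G f z))\<^sup>2)"
          by (intro tendsto_ennrealI tendsto_power tendsto_norm tendsto_diff rho_lim tendsto_const)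
        then show "(\<lambda>i. ennreal ((norm (rho \<sigma> \<tau> (X (i + K)) f z - rho \<sigma> \<tau> G f z))\<^sup>2)) \<longlonglongrightarrow> 0" by simp
      qed
    qed measurable
    then have "(\<lambda>i. sqnorm M (\<lambda>z. rho \<sigma> \<tau> (X (i + K)) f z - rho \<sigma> \<tau> G f z)) \<longlonglongrightarrow> 0"
      by (simp add: sqnorm_def)
    then show "((\<lambda>H. sqnorm M (\<lambda>z. rho \<sigma> \<tau> H f z - rho \<sigma> \<tau> G f z)) \<circ> X) \<longlonglongrightarrow> 0"
      unfolding comp_def by (rule LIMSEQ_offset)
  qed
qed

lemma sqnorm_const: "sqnorm M (\<lambda>z. c) < \<infinity>"
proof -
  interpret M: finite_measure M by (rule finite_measure_haar[OF haar])
  show ?thesis by (simp add: sqnorm_def less_top[symmetric] ennreal_mult_eq_top_iff M.emeasure_finite)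
qed

lemma continuous_vector_const: "continuous_vector (\<lambda>z. c)"
  by (rule continuous_vector_continuous[where B="norm c"]) simp_all

lemma continuous_vector_sum:
  "finite I \<Longrightarrow> (\<And>i. i \<in> I \<Longrightarrow> continuous_vector (f i)) \<Longrightarrow> continuous_vector (\<lambda>z. \<Sum>i\<in>I. f i z)"
  by (induction I rule: finite_induct) (auto intro: continuous_vector_const continuous_vector_add)

text \<open>The indicator of a closed set is a limit of continuous functions of the distance to it.\<close>

lemma continuous_vector_closed:
  assumes A: "closed A"
  shows "continuous_vector (indicator A)"
proof (cases "A = {}")
  case True
  then show ?thesis using continuous_vector_const[of 0] by (simp add: indicator_def[abs_def])
next
  case False
  let ?f = "\<lambda>k z. complex_of_real (max 0 (1 - real k * infdist z A))"
  show ?thesis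
  proof (rule continuous_vector_limit[where f="?f" and w="\<lambda>z. 1"])
    show "continuous_vector (?f k)" for k
      by (rule continuous_vector_continuous[where B=1])
        (auto intro!: continuous_intros simp: infdist_nonneg)
    have "A \<in> sets borel" using A by (rule borel_closed)
    then show "indicator A \<in> borel_measurable M"
      by (intro haar_measurable[OF haar] borel_measurable_indicator)
    show "(\<lambda>k. ?f k z) \<longlonglongrightarrow> indicator A z" for z
    proof (cases "z \<in> A")
      case True
      then show ?thesis by simp
    next
      case z: False
      have pos: "0 < infdist z A" by (rule infdist_pos_not_in_closed[OF A False z])
      obtain K where K: "1 / infdist z A < real K" using reals_Archimedean2 by blast
      have "?f k z = 0" if "k \<ge> K" for k
      proof -
        have "1 / infdist z A < real k" using K that by linarith
        then show ?thesis using pos by (simp add: divide_less_eq max_def)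
      qed
      then have "\<forall>\<^sub>F k in sequentially. ?f k z = 0" unfolding eventually_sequentially by blast
      then have "(\<lambda>k. ?f k z) \<longlonglongrightarrow> 0" by (rule tendsto_eventually)
      then show ?thesis using z by simp
    qed
    show "norm (?f k z - indicator A z) \<le> norm (1 :: complex)" for k z
    proof -
      have "0 \<le> real k * infdist z A" by (simp add: infdist_nonneg)
      then have "\<bar>max 0 (1 - real k * infdist z A) - indicator A z\<bar> \<le> 1"
        by (auto simp: indicator_def)
      moreover have "?f k z - indicator A z = of_real (max 0 (1 - real k * infdist z A) - indicator A z)"
        by (simp add: indicator_def)
      ultimately show ?thesis by (simp only: norm_of_real norm_one)
    qed
  qed (simp_all add: sqnorm_const[simplified])
qed

lemma continuous_vector_borel:
  assumes "A \<in> sets (borel :: (complex^'n^'n) measure)"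
  shows "continuous_vector (indicator A)"
proof -
  have sets: "sets (borel :: (complex^'n^'n) measure) = sigma_sets UNIV (Collect closed)"
    unfolding borel_eq_closed by (rule sets_measure_of) simp
  have "Int_stable (Collect closed :: (complex^'n^'n) set set)"
    by (auto simp: Int_stable_def)
  moreover have "Collect closed \<subseteq> Pow (UNIV :: (complex^'n^'n) set)" by simp
  moreover have "A \<in> sigma_sets UNIV (Collect closed)" using assms by (simp only: sets)
  ultimately show ?thesis
  proof (induction A rule: sigma_sets_induct_disjoint)
    case (basic A)
    then show ?case by (simp add: continuous_vector_closed)
  next
    case empty
    show ?case by (rule continuous_vector_closed) simp
  next
    case (compl A)
    have "continuous_vector (\<lambda>z. 1 + (- 1) * indicator A z)"
      by (intro continuous_vector_add continuous_vector_const continuous_vector_scale compl.IH)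
    also have "(\<lambda>z. 1 + (- 1) * indicator A z) = (indicator (UNIV - A) :: _ \<Rightarrow> complex)"
      by (auto simp: fun_eq_iff indicator_def)
    finally show ?case .
  next
    case (union A)
    have Ab: "A i \<in> sets borel" for i using union.hyps(2) by (auto simp: sets)
    show ?case
    proof (rule continuous_vector_limit[where f="\<lambda>k z. indicator (\<Union>i<k. A i) z" and w="\<lambda>z. 1"])
      fix k :: nat
      have "disjoint_family_on A {..<k}"
        using union.hyps(1) by (auto simp: disjoint_family_on_def)
      then have "(\<lambda>z. indicator (\<Union>i<k. A i) z :: complex) = (\<lambda>z. \<Sum>i<k. indicator (A i) z)"
        by (intro ext indicator_UN_disjoint) simp
      then show "continuous_vector (\<lambda>z. indicator (\<Union>i<k. A i) z)"
        by (simp only: continuous_vector_sum[OF finite_lessThan union.IH])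
    next
      show "indicator (\<Union>i. A i) \<in> borel_measurable M"
        using Ab by (intro haar_measurable[OF haar] borel_measurable_indicator) auto
      show "norm (indicator (\<Union>i<k. A i) z - indicator (\<Union>i. A i) z :: complex) \<le> norm (1 :: complex)" for k z
        by (auto simp: indicator_def)
    qed (simp_all add: sqnorm_const[simplified] LIMSEQ_indicator_UN)
  qed
qed

lemma continuous_vector_cong:
  assumes f: "continuous_vector f" and eq: "\<And>z. z \<in> unitary_group \<Longrightarrow> f z = h z" and h: "h \<in> borel_measurable M"
  shows "continuous_vector h"
  using f h by (rule continuous_vector_limit[where w="\<lambda>z. 0"]) (simp_all add: eq sqnorm_const[simplified])

lemma continuous_vector_simple:
  assumes f: "simple_function M f"
  shows "continuous_vector f"
proof -
  have fin: "finite (f ` space M)" using f by (rule simple_functionD)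
  let ?A = "\<lambda>y. f -` {y} \<inter> space M"
  have "unitary_group \<in> sets (borel :: (complex^'n^'n) measure)"
    by (rule borel_closed[OF closed_unitary_group])
  then have "A \<in> sets borel" if "A \<in> sets M" for A
    using that unfolding sets_haar[OF haar] by (auto simp: sets_restrict_space)
  then have A: "?A y \<in> sets borel" for y using simple_functionD(2)[OF f] by blast
  have "continuous_vector (\<lambda>z. \<Sum>y\<in>f ` space M. y * indicator (?A y) z)"
    by (intro continuous_vector_sum fin continuous_vector_scale continuous_vector_borel A)
  then show ?thesis
  proof (rule continuous_vector_cong)
    fix z :: "complex^'n^'n" assume "z \<in> unitary_group"
    then have z: "z \<in> space M" by (simp add: space_haar[OF haar])
    have "(\<Sum>y\<in>f ` space M. y * indicator (?A y) z) = (\<Sum>y\<in>f ` space M. if y = f z then y else 0)"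
      by (intro sum.cong refl) (use z in \<open>auto simp: indicator_def\<close>)
    also have "\<dots> = f z" using fin z by simp
    finally show "(\<Sum>y\<in>f ` space M. y * indicator (?A y) z) = f z" .
  qed (rule borel_measurable_simple_function[OF f])
qed

lemma continuous_vector_L2:
  assumes f: "f \<in> L2_funs M"
  shows "continuous_vector f"
proof -
  have fm [measurable]: "f \<in> borel_measurable M" and fin: "sqnorm M f < \<infinity>"
    using f by (simp_all add: L2_funs_iff)
  obtain s where s: "\<And>i. simple_function M (s i)" and lim: "\<And>z. z \<in> space M \<Longrightarrow> (\<lambda>i. s i z) \<longlonglongrightarrow> f z"
    and bound: "\<And>i z. z \<in> space M \<Longrightarrow> dist (s i z) 0 \<le> 2 * dist (f z) 0"
    using borel_measurable_implies_sequence_metric[OF fm, of 0] by blast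
  show ?thesis
  proof (rule continuous_vector_limit[where f=s and w="\<lambda>z. 3 * f z"])
    have "sqnorm M (\<lambda>z. 3 * f z) = 9 * sqnorm M f"
      by (simp add: sqnorm_def norm_mult power_mult_distrib ennreal_mult nn_integral_cmult)
    then show "sqnorm M (\<lambda>z. 3 * f z) < \<infinity>" using fin by (simp add: ennreal_mult_less_top)
    show "norm (s k z - f z) \<le> norm (3 * f z)" if "z \<in> unitary_group" for k z
      using bound[of z k] that norm_triangle_ineq4[of "s k z" "f z"]
      by (simp add: space_haar[OF haar] norm_mult)
  qed (use s lim in \<open>simp_all add: continuous_vector_simple space_haar[OF haar]\<close>)
qed

lemma rho_strongly_continuous:
  fixes G :: "'n cover"
  assumes f: "f \<in> L2_funs M" and G: "G \<in> cover_set"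
  shows "((\<lambda>H. L2_norm M (\<lambda>z. rho \<sigma> \<tau> H f z - rho \<sigma> \<tau> G f z)) \<longlongrightarrow> 0) (at G within cover_set)"
proof -
  have fm: "f \<in> borel_measurable M" using f by (simp add: L2_funs_iff)
  have "L2_norm M h = sqrt (enn2real (sqnorm M h))" if "h \<in> borel_measurable M" for h
    using that unfolding L2_norm_def sqnorm_def by (subst integral_eq_nn_integral) simp_all
  then have eq: "L2_norm M (\<lambda>z. rho \<sigma> \<tau> H f z - rho \<sigma> \<tau> G f z)
      = sqrt (enn2real (sqnorm M (\<lambda>z. rho \<sigma> \<tau> H f z - rho \<sigma> \<tau> G f z)))"
    if "H \<in> cover_set" for H :: "'n cover"
    using rho_diff_measurable[OF G that fm] by blast
  have "((\<lambda>H. sqnorm M (\<lambda>z. rho \<sigma> \<tau> H f z - rho \<sigma> \<tau> G f z)) \<longlongrightarrow> ennreal 0) (at G within cover_set)"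
    using continuous_vectorD(2)[OF continuous_vector_L2[OF f] G] by simp
  then have "((\<lambda>H. sqrt (enn2real (sqnorm M (\<lambda>z. rho \<sigma> \<tau> H f z - rho \<sigma> \<tau> G f z)))) \<longlongrightarrow> sqrt 0) (at G within cover_set)"
    by (intro tendsto_real_sqrt tendsto_enn2real) simp_all
  then show ?thesis
    by (subst tendsto_cong[where g="\<lambda>H. sqrt (enn2real (sqnorm M (\<lambda>z. rho \<sigma> \<tau> H f z - rho \<sigma> \<tau> G f z)))"])
      (auto simp: eventually_at_filter eq)
qed

end

theorem mainTheorem3:
  fixes \<sigma> \<tau> :: complex and M :: "(complex^'n^'n) measure"
  assumes "Re \<sigma> + Re \<tau> = - real CARD('n)"
    and "Im \<sigma> = Im \<tau>"
    and "haar_measure M"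
  shows "unitary_representation_L2 (Unn_cover :: 'n cover monoid) M (rho \<sigma> \<tau>)"
  unfolding unitary_representation_L2_def
proof (intro conjI ballI)
  note haar = assms(3) and re = assms(1) and im = assms(2)
  have carrier: "carrier (Unn_cover :: 'n cover monoid) = cover_set"
    and mult: "mult (Unn_cover :: 'n cover monoid) = cover_mult"
    and one: "one (Unn_cover :: 'n cover monoid) = (mat 1, 0, 0)"
    by (simp_all add: Unn_cover_def)
  show "unitary_operator_L2 M (rho \<sigma> \<tau> G)" if "G \<in> carrier Unn_cover" for G :: "'n cover"
    using that unfolding carrier by (rule rho_unitary[OF haar re im])
  show "AE z in M. rho \<sigma> \<tau> (one (Unn_cover :: 'n cover monoid)) f z = f z" for f
    by (simp add: one rho_one)
  show "AE z in M. rho \<sigma> \<tau> (mult Unn_cover G H) f z = rho \<sigma> \<tau> G (rho \<sigma> \<tau> H f) z"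
    if "G \<in> carrier Unn_cover" "H \<in> carrier Unn_cover" for G H :: "'n cover" and f
    using that unfolding carrier mult
    by (intro AE_haarI[OF haar] rho_mult unitary_contraction)
  show "((\<lambda>H. L2_norm M (\<lambda>z. rho \<sigma> \<tau> H f z - rho \<sigma> \<tau> G f z)) \<longlongrightarrow> 0) (at G within carrier Unn_cover)"
    if "f \<in> L2_funs M" "G \<in> carrier Unn_cover" for f and G :: "'n cover"
    using that unfolding carrier by (rule rho_strongly_continuous[OF haar re im])
qed

end
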